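(* There is an explicit (deterministic) family of $3$-regular expander graphs on which the simple random walk, started from a worst-case initial position, exhibits total-variation cutoff. That is, there are an explicit sequence $(G_k)_{k\ge 1}$ of finite $3$-regular graphs with $|V(G_k)|\to\infty$ and a constant $c>0$ such that $\mathrm{ch}(G_k)>c$ for all $k$, and such that the mixing times of the simple random walks on the $G_k$ satisfy \[\lim_{k\to\infty}\frac{t_{\mathrm{mix}}^{(k)}(\epsilon)}{t_{\mathrm{mix}}^{(k)}(1-\epsilon)}=1\qquad\text{for every } 0<\epsilon<1 .\]
   Context: For a finite regular graph $G$, the Cheeger constant is $\mathrm{ch}(G)=\min_{\emptyset\ne S\subsetneq V(G)}\frac{|\partial S|}{\min(|S|,|V(G)\setminus S|)}$, where $\partial S$ is the set of edges with exactly one endpoint in $S$. A family of bounded-degree graphs is a family of expanders if there is a fixed $c>0$ with $\mathrm{ch}(G)>c$ for all members. The simple random walk (SRW) on $G$ is the discrete-time Markov chain moving at each step to a uniformly chosen neighbor. For an aperiodic irreducible discrete-time chain $(X_t)$ on a finite state space $\Omega$ with stationary distribution $\pi$, let $d(t)=\max_{x\in\Omega}\|\mathbb P_x(X_t\in\cdot)-\pi\|_{\mathrm{TV}}$, where $\|\mu-\nu\|_{\mathrm{TV}}=\frac12\sum_x|\mu(x)-\nu(x)|$, and $t_{\mathrm{mix}}(\epsilon)=\min\{t:d(t)<\epsilon\}$ for $0<\epsilon<1$. The quantity $t_{\mathrm{mix}}^{(k)}(\epsilon)$ is this mixing time for the SRW on $G_k$. (The SRW on the graphs in question is understood to be irreducible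 and aperiodic.) "Explicit" means given by a deterministic construction (as opposed to a random one). *)

theory Defs
  imports "HOL-Probability.Probability_Mass_Function" "Graph_Theory.Pair_Digraph"
begin

section \<open>Regular graphs and the Cheeger constant\<close>

text \<open>Finite simple graphs are the instances of the locale \<^const>\<open>pair_graph\<close>: an undirected
  edge is a pair of opposite arcs, and there are no loops.\<close>

definition regular_graph :: "nat \<Rightarrow> 'a pair_pre_digraph \<Rightarrow> bool" where
  "regular_graph d G \<longleftrightarrow> pair_graph G \<and> (\<forall>v\<in>pverts G. out_degree (with_proj G) v = d)"

text \<open>Edges are unordered pairs here, so that each edge is counted once in the boundary.\<close>

definition edges :: "'a pair_pre_digraph \<Rightarrow> 'a set set" where
  "edges G = {{u, v} | u v. (u, v) \<in> parcs G}"

definition edge_boundary :: "'a pair_pre_digraph \<Rightarrow> 'a set \<Rightarrow> 'a set set" where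
  "edge_boundary G S = {e \<in> edges G. card (e \<inter> S) = 1}"

definition cheeger :: "'a pair_pre_digraph \<Rightarrow> real" where
  "cheeger G =
     Min ((\<lambda>S. real (card (edge_boundary G S)) / real (min (card S) (card (pverts G - S))))
       ` {S. S \<noteq> {} \<and> S \<subset> pverts G})"


section \<open>Finite Markov chains\<close>

text \<open>A chain is given by its transition kernel \<open>K\<close> and its state space \<open>\<Omega>\<close>; only the
  distributions \<open>K x\<close> with \<open>x \<in> \<Omega>\<close> matter, and they are to be supported in \<open>\<Omega>\<close>.\<close>

primrec chain_law :: "('a \<Rightarrow> 'a pmf) \<Rightarrow> 'a \<Rightarrow> nat \<Rightarrow> 'a pmf" where
  "chain_law K x 0 = return_pmf x"
| "chain_law K x (Suc t) = bind_pmf (chain_law K x t) K"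

definition irreducible_chain :: "'a set \<Rightarrow> ('a \<Rightarrow> 'a pmf) \<Rightarrow> bool" where
  "irreducible_chain \<Omega> K \<longleftrightarrow> (\<forall>x\<in>\<Omega>. \<forall>y\<in>\<Omega>. \<exists>t. pmf (chain_law K x t) y > 0)"

definition aperiodic_chain :: "'a set \<Rightarrow> ('a \<Rightarrow> 'a pmf) \<Rightarrow> bool" where
  "aperiodic_chain \<Omega> K \<longleftrightarrow> (\<forall>x\<in>\<Omega>. Gcd {t. t \<ge> 1 \<and> pmf (chain_law K x t) x > 0} = 1)"

text \<open>The description is meaningful for irreducible chains on a finite nonempty state space, where
  the stationary distribution exists and is unique.\<close>

definition stationary :: "'a set \<Rightarrow> ('a \<Rightarrow> 'a pmf) \<Rightarrow> 'a pmf" where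
  "stationary \<Omega> K = (THE \<pi>. set_pmf \<pi> \<subseteq> \<Omega> \<and> bind_pmf \<pi> K = \<pi>)"

definition tv_dist :: "'a set \<Rightarrow> 'a pmf \<Rightarrow> 'a pmf \<Rightarrow> real" where
  "tv_dist \<Omega> \<mu> \<nu> = (1/2) * (\<Sum>x\<in>\<Omega>. \<bar>pmf \<mu> x - pmf \<nu> x\<bar>)"

definition worst_dist :: "'a set \<Rightarrow> ('a \<Rightarrow> 'a pmf) \<Rightarrow> nat \<Rightarrow> real" where
  "worst_dist \<Omega> K t = Max ((\<lambda>x. tv_dist \<Omega> (chain_law K x t) (stationary \<Omega> K)) ` \<Omega>)"

definition mixing_time :: "'a set \<Rightarrow> ('a \<Rightarrow> 'a pmf) \<Rightarrow> real \<Rightarrow> nat" where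
  "mixing_time \<Omega> K \<epsilon> = (LEAST t. worst_dist \<Omega> K t < \<epsilon>)"

definition srw :: "'a pair_pre_digraph \<Rightarrow> 'a \<Rightarrow> 'a pmf" where
  "srw G v = pmf_of_set {w. (v, w) \<in> parcs G}"


section \<open>Explicit sequences of graphs\<close>

text \<open>The total recursive functions, in Kleene's form: minimisation is only applied to regular
  functions, so all functions are total. Arguments are passed as a list of arbitrary length, of
  which every recursive function inspects only finitely many entries; missing entries count as
  zero.\<close>

definition arg :: "nat \<Rightarrow> nat list \<Rightarrow> nat" where
  "arg i xs = (if i < length xs then xs ! i else 0)"

inductive recursive :: "(nat list \<Rightarrow> nat) \<Rightarrow> bool" where
  zero: "recursive (\<lambda>xs. 0)"
| succ: "recursive (\<lambda>xs. Suc (arg 0 xs))"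
| proj: "recursive (arg i)"
| comp: "recursive f \<Longrightarrow> \<forall>g\<in>set gs. recursive g \<Longrightarrow> recursive (\<lambda>xs. f (map (\<lambda>g. g xs) gs))"
| prec: "recursive f \<Longrightarrow> recursive g \<Longrightarrow>
    recursive (\<lambda>xs. rec_nat (f (tl xs)) (\<lambda>n r. g (n # r # tl xs)) (arg 0 xs))"
| minim: "recursive f \<Longrightarrow> \<forall>xs. \<exists>n. f (n # xs) = 0 \<Longrightarrow>
    recursive (\<lambda>xs. LEAST n. f (n # xs) = 0)"

text \<open>A sequence of graphs is explicit if an algorithm computes from \<open>k\<close> the \<open>k\<close>-th graph: its
  vertices are numbered from 0, and both their number and the adjacency relation are computable,
  uniformly in \<open>k\<close>.\<close>

definition explicit_graphs :: "(nat \<Rightarrow> nat pair_pre_digraph) \<Rightarrow> bool" where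
  "explicit_graphs G \<longleftrightarrow> (\<exists>N A. recursive N \<and> recursive A \<and>
     (\<forall>k. pverts (G k) = {..<N [k]} \<and>
       parcs (G k) = {(u, v). u < N [k] \<and> v < N [k] \<and> A [k, u, v] = 1}))"

end

theory Submission
  imports Defs
begin

text \<open>Take a bounded-degree expander, replace its vertices by pentagons, and hang a binary tree on
  them, all but the last few levels of which are stretched by a constant factor. From the root of the
  tree the walk has a linear drift towards the expander and reaches it at a concentrated time, spread
  out evenly, so that hardly any further mixing is needed: this is the cutoff. A walk that starts
  further down needs more steps to mix inside the expander, but at most a constant number for each level
  that it saved; if the stretching is strong enough, the root is therefore the worst starting point. The
  unstretched levels at the bottom keep the walk from returning to the stretched part.

  The expander is a Schreier graph of binary vectors, whose spectral gap follows from the Walsh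
  transform and a paradoxical decomposition by degrees of polynomials. The time of arrival is controlled
  by exponential functions of a level function with drift exactly 1, and the density on arrival by a
  superharmonic function.

  Only computability of the sequence is required, so the \<open>k\<close>-th graph is the first one, in an
  enumeration of codes, that passes a decidable test for the degree, the expansion, and the mixing
  profile up to precision \<open>1 / k\<close>. The construction above shows that the search succeeds.\<close>

section \<open>An expander on binary vectors\<close>

text \<open>The obstacle is a circularity between stretching and spectral gap: the gap of the
  stretched tree deteriorates with the factor \<open>M\<close>, while \<open>M\<close> has to be
  large compared with the mixing rate. It is broken by using two gaps. The walk reflected in the
  bottom levels \<open>B\<close> contracts at the rate \<open>lamB\<close>, an absolute constant
  because every level of \<open>B\<close> above the clouds branches. This rate fixes the number
  \<open>a\<close> of mixing steps paid per binary digit of a vertex name, and \<open>a\<close>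
  fixes \<open>M\<close>. Only then does the gap of the whole graph enter, through
  \<open>gG\<close>, which depends on \<open>M\<close> alone; so the expansion stays bounded below
  while the height of the tree and the number of unstretched levels grow with the precision.
  Progress is measured in expected hitting times \<open>D\<close>, and the cutoff sits at
  \<open>D H\<close>. Pentagons serve two purposes. The expander has degree four and the tree needs
  one more port, which makes five; and an odd cycle keeps the spectrum away from -1, as the walk is
  not lazy.\<close>

definition walsh :: "nat \<Rightarrow> nat set \<Rightarrow> nat set \<Rightarrow> real" where
  "walsh n A B = (\<Prod>i<n. if i \<in> A \<and> i \<in> B then -1 else 1)"

lemma walsh_commute: "walsh n A B = walsh n B A"
  unfolding walsh_def by (intro prod.cong) auto

lemma walsh_sym_diff: "walsh n A (sym_diff B C) = walsh n A B * walsh n A C"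
  unfolding walsh_def by (subst prod.distrib[symmetric]) (intro prod.cong, auto)

lemma walsh_sym_diff': "walsh n (sym_diff B C) A = walsh n B A * walsh n C A"
  using walsh_sym_diff walsh_commute by metis

lemma walsh_square [simp]: "walsh n A B * walsh n A B = 1"
  unfolding walsh_def by (subst prod.distrib[symmetric]) (auto intro!: prod.neutral)

lemma abs_walsh [simp]: "\<bar>walsh n A B\<bar> = 1"
  using walsh_square[of n A B] by (metis abs_mult_self_eq abs_1 abs_square_eq_1 power2_eq_square)

lemma walsh_singleton: "i < n \<Longrightarrow> walsh n A {i} = (if i \<in> A then -1 else 1)"
  unfolding walsh_def by (subst prod.remove[of _ i]) (auto intro!: prod.neutral)

lemma bij_betw_sym_diff:
  assumes "C \<subseteq> {..<n}"
  shows "bij_betw (\<lambda>A. sym_diff A C) (Pow {..<n}) (Pow {..<n})"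
  by (rule bij_betwI[where g = "\<lambda>A. sym_diff A C"]) (use assms in auto)

lemma sum_walsh:
  assumes "C \<subseteq> {..<n}"
  shows "(\<Sum>A\<in>Pow {..<n}. walsh n A C) = (if C = {} then 2 ^ n else 0)"
proof (cases "C = {}")
  case True
  then show ?thesis by (simp add: walsh_def card_Pow)
next
  case False
  then obtain i where i: "i \<in> C" by auto
  with assms have "i < n" by auto
  have "(\<Sum>A\<in>Pow {..<n}. walsh n A C) = (\<Sum>A\<in>Pow {..<n}. walsh n (sym_diff A {i}) C)"
    by (rule sum.reindex_bij_betw[symmetric]) (use \<open>i < n\<close> in \<open>auto intro: bij_betw_sym_diff\<close>)
  also have "\<dots> = - (\<Sum>A\<in>Pow {..<n}. walsh n A C)"
    using i \<open>i < n\<close> by (simp add: walsh_sym_diff' walsh_commute[of n "{i}"] walsh_singleton sum_negf)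
  finally show ?thesis using False by simp
qed

section \<open>Fourier analysis on pairs of binary vectors\<close>

type_synonym bvec = "nat set \<times> nat set"

definition bvecs :: "nat \<Rightarrow> bvec set" where
  "bvecs n = Pow {..<n} \<times> Pow {..<n}"

definition chi :: "nat \<Rightarrow> bvec \<Rightarrow> bvec \<Rightarrow> real" where
  "chi n \<xi> x = walsh n (fst \<xi>) (fst x) * walsh n (snd \<xi>) (snd x)"

definition fourier :: "nat \<Rightarrow> (bvec \<Rightarrow> real) \<Rightarrow> bvec \<Rightarrow> real" where
  "fourier n f \<xi> = (\<Sum>x\<in>bvecs n. f x * chi n \<xi> x)"

lemma finite_bvecs [simp]: "finite (bvecs n)"
  by (simp add: bvecs_def)

lemma card_bvecs: "card (bvecs n) = 2 ^ (2 * n)"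
  by (simp add: bvecs_def card_cartesian_product card_Pow power_add mult_2)

lemma sum_chi:
  assumes "x \<in> bvecs n" "y \<in> bvecs n"
  shows "(\<Sum>\<xi>\<in>bvecs n. chi n \<xi> x * chi n \<xi> y) = (if x = y then 4 ^ n else 0)"
proof -
  have "(\<Sum>\<xi>\<in>bvecs n. chi n \<xi> x * chi n \<xi> y)
      = (\<Sum>\<alpha>\<in>Pow {..<n}. \<Sum>\<beta>\<in>Pow {..<n}.
          walsh n \<alpha> (sym_diff (fst x) (fst y)) * walsh n \<beta> (sym_diff (snd x) (snd y)))"
    unfolding bvecs_def by (simp add: sum.cartesian_product chi_def walsh_sym_diff case_prod_beta mult_ac)
  also have "\<dots> = (\<Sum>\<alpha>\<in>Pow {..<n}. walsh n \<alpha> (sym_diff (fst x) (fst y)))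
      * (\<Sum>\<beta>\<in>Pow {..<n}. walsh n \<beta> (sym_diff (snd x) (snd y)))"
    by (simp add: sum_product)
  also have "\<dots> = (if x = y then 4 ^ n else 0)"
  proof -
    have "sym_diff A B = {} \<longleftrightarrow> A = B" for A B :: "nat set" by blast
    moreover have "sym_diff (fst x) (fst y) \<subseteq> {..<n}" "sym_diff (snd x) (snd y) \<subseteq> {..<n}"
      using assms by (auto simp: bvecs_def)
    ultimately show ?thesis
      by (simp add: sum_walsh prod_eq_iff del: Un_empty flip: power_mult_distrib)
  qed
  finally show ?thesis .
qed

lemma fourier_diff: "fourier n (\<lambda>x. f x - g x) \<xi> = fourier n f \<xi> - fourier n g \<xi>"
  unfolding fourier_def by (simp add: algebra_simps sum_subtractf)

lemma parseval: "(\<Sum>\<xi>\<in>bvecs n. (fourier n f \<xi>)\<^sup>2) = 4 ^ n * (\<Sum>x\<in>bvecs n. (f x)\<^sup>2)"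
proof -
  have "(\<Sum>\<xi>\<in>bvecs n. (fourier n f \<xi>)\<^sup>2)
      = (\<Sum>\<xi>\<in>bvecs n. \<Sum>x\<in>bvecs n. \<Sum>y\<in>bvecs n. f x * f y * (chi n \<xi> x * chi n \<xi> y))"
    unfolding fourier_def power2_eq_square by (simp add: sum_product mult_ac)
  also have "\<dots> = (\<Sum>x\<in>bvecs n. \<Sum>y\<in>bvecs n. \<Sum>\<xi>\<in>bvecs n. f x * f y * (chi n \<xi> x * chi n \<xi> y))"
    by (subst sum.swap) (intro sum.cong refl sum.swap)
  also have "\<dots> = (\<Sum>x\<in>bvecs n. \<Sum>y\<in>bvecs n. if x = y then 4 ^ n * (f x)\<^sup>2 else 0)"
    by (intro sum.cong refl) (auto simp: sum_chi power2_eq_square simp flip: sum_distrib_left)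
  finally show ?thesis by (simp add: sum_distrib_left)
qed

lemma fourier_reindex:
  assumes "bij_betw T (bvecs n) (bvecs n)"
    and "\<And>x. x \<in> bvecs n \<Longrightarrow> chi n \<xi> x = s * chi n \<eta> (T x)"
  shows "fourier n (\<lambda>x. f (T x)) \<xi> = s * fourier n f \<eta>"
proof -
  have "fourier n (\<lambda>x. f (T x)) \<xi> = (\<Sum>x\<in>bvecs n. s * (f (T x) * chi n \<eta> (T x)))"
    unfolding fourier_def by (intro sum.cong refl) (simp add: assms(2))
  also have "\<dots> = (\<Sum>x\<in>bvecs n. s * (f x * chi n \<eta> x))"
    by (rule sum.reindex_bij_betw[OF assms(1)])
  finally show ?thesis by (simp add: fourier_def sum_distrib_left)
qed

section \<open>The generating maps and their dual action on frequencies\<close>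

definition shl :: "nat \<Rightarrow> nat set \<Rightarrow> nat set" where "shl n B = {i. i < n \<and> i > 0 \<and> i - 1 \<in> B}"
definition shr :: "nat \<Rightarrow> nat set \<Rightarrow> nat set" where "shr n A = {i. Suc i < n \<and> Suc i \<in> A}"

text \<open>Read a set as the exponents of a polynomial over the field with two elements. Then
  \<open>shl\<close> multiplies by the variable, dropping the term of degree \<open>n\<close>, and
  \<open>shr\<close> is its transpose; so the dual of \<open>uniV\<close> raises degrees.\<close>

lemma walsh_shl: "walsh n (shl n B) A = walsh n B (shr n A)"
proof (cases n)
  case (Suc m)
  show ?thesis unfolding Suc walsh_def shl_def shr_def
    apply (subst prod.lessThan_Suc_shift, subst prod.lessThan_Suc)
    apply (auto intro!: prod.cong)
    done
qed (simp add: walsh_def)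

definition rotV :: "bvec \<Rightarrow> bvec" where
  "rotV x = (sym_diff (fst x) (snd x), fst x)"
definition rotV' :: "bvec \<Rightarrow> bvec" where
  "rotV' x = (snd x, sym_diff (fst x) (snd x))"
definition tauV :: "nat \<Rightarrow> bvec \<Rightarrow> bvec" where
  "tauV n x = (fst x, sym_diff (snd x) {n - 1})"
text \<open>A unipotent map followed by a translation. Since \<open>shr n\<close> never contains
  \<open>n - 1\<close>, the translation rules out fixed points, which would become loops of the
  graph.\<close>

definition uniV :: "nat \<Rightarrow> bvec \<Rightarrow> bvec" where
  "uniV n x = (fst x, sym_diff (snd x) (sym_diff (shr n (fst x)) {n - 1}))"

lemma bij_rotV: "bij_betw rotV (bvecs n) (bvecs n)"
  by (rule bij_betwI[where g = rotV']) (auto simp: bvecs_def rotV_def rotV'_def)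

lemma tauV_in: "n > 0 \<Longrightarrow> x \<in> bvecs n \<Longrightarrow> tauV n x \<in> bvecs n"
  by (auto simp: bvecs_def tauV_def)
lemma tauV_tauV [simp]: "tauV n (tauV n x) = x"
  by (cases x) (auto simp: tauV_def)
lemma tauV_neq: "tauV n x \<noteq> x"
  by (cases x) (auto simp: tauV_def)
lemma uniV_in: "n > 0 \<Longrightarrow> x \<in> bvecs n \<Longrightarrow> uniV n x \<in> bvecs n"
  by (auto simp: bvecs_def uniV_def shr_def)
lemma uniV_uniV [simp]: "uniV n (uniV n x) = x"
  by (cases x) (auto simp: uniV_def)
lemma uniV_neq: "uniV n x \<noteq> x"
proof -
  have "n - 1 \<notin> shr n (fst x)" by (auto simp: shr_def)
  then have "n - 1 \<in> snd (uniV n x) \<longleftrightarrow> n - 1 \<notin> snd x" by (auto simp: uniV_def)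
  then show ?thesis by auto
qed

lemma bij_tauV: "n > 0 \<Longrightarrow> bij_betw (tauV n) (bvecs n) (bvecs n)"
  by (rule bij_betwI[where g = "tauV n"]) (auto simp: tauV_in)
lemma bij_uniV: "n > 0 \<Longrightarrow> bij_betw (uniV n) (bvecs n) (bvecs n)"
  by (rule bij_betwI[where g = "uniV n"]) (auto simp: uniV_in)

definition unih :: "nat \<Rightarrow> bvec \<Rightarrow> bvec" where
  "unih n \<xi> = (sym_diff (fst \<xi>) (shl n (snd \<xi>)), snd \<xi>)"

lemma fourier_rotV: "fourier n (\<lambda>x. f (rotV x)) \<xi> = fourier n f (rotV' \<xi>)"
  using fourier_reindex[OF bij_rotV, of n \<xi> 1 "rotV' \<xi>" f]
  by (auto simp: chi_def rotV_def rotV'_def walsh_sym_diff walsh_sym_diff')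

lemma fourier_tauV:
  assumes "n > 0"
  shows "fourier n (\<lambda>x. f (tauV n x)) \<xi> = (if n - 1 \<in> snd \<xi> then -1 else 1) * fourier n f \<xi>"
  using assms
  by (intro fourier_reindex bij_tauV) (auto simp: chi_def tauV_def walsh_sym_diff walsh_singleton)

text \<open>The translation part of \<open>uniV\<close> contributes only a sign, which the absolute
  values remove.\<close>

lemma fourier_uniV:
  assumes "n > 0"
  shows "\<bar>fourier n (\<lambda>x. f (uniV n x)) \<xi>\<bar> = \<bar>fourier n f (unih n \<xi>)\<bar>"
proof -
  define s :: real where "s = walsh n (snd \<xi>) {n - 1}"
  have "fourier n (\<lambda>x. f (uniV n x)) \<xi> = s * fourier n f (unih n \<xi>)"
    using assms
    by (intro fourier_reindex bij_uniV)
       (auto simp: chi_def uniV_def unih_def s_def walsh_sym_diff walsh_sym_diff' walsh_shl algebra_simps)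
  then show ?thesis by (simp add: s_def abs_mult)
qed

text \<open>In terms of polynomials, the first component has the larger degree in
  \<open>clsA\<close>, the second in \<open>clsB\<close>, and the degrees agree in
  \<open>clsC\<close>; \<open>m\<close> is the larger degree.\<close>

definition clsA :: "nat \<Rightarrow> bvec set" where
  "clsA n = {\<xi>\<in>bvecs n. \<exists>m. m \<in> fst \<xi> \<and> m \<notin> snd \<xi> \<and> (\<forall>j>m. j \<notin> fst \<xi> \<and> j \<notin> snd \<xi>)}"
definition clsB :: "nat \<Rightarrow> bvec set" where
  "clsB n = {\<xi>\<in>bvecs n. \<exists>m. m \<notin> fst \<xi> \<and> m \<in> snd \<xi> \<and> (\<forall>j>m. j \<notin> fst \<xi> \<and> j \<notin> snd \<xi>)}"
definition clsC :: "nat \<Rightarrow> bvec set" where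
  "clsC n = {\<xi>\<in>bvecs n. \<exists>m. m \<in> fst \<xi> \<and> m \<in> snd \<xi> \<and> (\<forall>j>m. j \<notin> fst \<xi> \<and> j \<notin> snd \<xi>)}"

lemma cls_cover: "bvecs n \<subseteq> insert ({}, {}) (clsA n \<union> clsB n \<union> clsC n)"
proof
  fix \<xi> assume \<xi>: "\<xi> \<in> bvecs n"
  show "\<xi> \<in> insert ({}, {}) (clsA n \<union> clsB n \<union> clsC n)"
  proof (cases "fst \<xi> \<union> snd \<xi> = {}")
    case True
    then show ?thesis by (cases \<xi>) auto
  next
    case False
    have fin: "finite (fst \<xi> \<union> snd \<xi>)"
      using \<xi> by (auto simp: bvecs_def intro: finite_subset[of _ "{..<n}"])
    define m where "m = Max (fst \<xi> \<union> snd \<xi>)"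
    have "m \<in> fst \<xi> \<union> snd \<xi>" unfolding m_def using fin False by (rule Max_in)
    moreover have "\<forall>j>m. j \<notin> fst \<xi> \<and> j \<notin> snd \<xi>"
      unfolding m_def using fin by (meson Max_ge UnCI leD)
    ultimately show ?thesis using \<xi> unfolding clsA_def clsB_def clsC_def by blast
  qed
qed

lemma cls_sub: "clsA n \<subseteq> bvecs n" "clsB n \<subseteq> bvecs n" "clsC n \<subseteq> bvecs n"
  by (auto simp: clsA_def clsB_def clsC_def)

lemma cls_disjoint: "clsB n \<inter> clsC n = {}"
  unfolding clsB_def clsC_def by (auto, metis linorder_neqE_nat)

lemma rotV'_AB: "rotV' ` clsA n \<subseteq> clsB n"
  unfolding clsA_def clsB_def rotV'_def bvecs_def by fastforce

lemma rotV'_BC: "rotV' ` clsB n \<subseteq> clsC n"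
  unfolding clsB_def clsC_def rotV'_def bvecs_def by fastforce

text \<open>Adding the shifted second component gives the first one the degree \<open>m + 1\<close>,
  above that of the second. This fails only if the leading term is shifted out, that is, if the
  second component contains \<open>n - 1\<close>.\<close>

lemma unih_A: "unih n ` (clsB n \<union> clsC n - {\<xi>. n - 1 \<in> snd \<xi>}) \<subseteq> clsA n"
proof
  fix \<eta> assume "\<eta> \<in> unih n ` (clsB n \<union> clsC n - {\<xi>. n - 1 \<in> snd \<xi>})"
  then obtain \<xi> m where \<xi>: "\<xi> \<in> bvecs n" "n - 1 \<notin> snd \<xi>" "\<eta> = unih n \<xi>"
    and m: "m \<in> snd \<xi>" "\<forall>j>m. j \<notin> fst \<xi> \<and> j \<notin> snd \<xi>"
    unfolding clsB_def clsC_def by blast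
  have "m < n" using \<xi>(1) m(1) by (auto simp: bvecs_def)
  moreover have "m \<noteq> n - 1" using \<xi> m by auto
  ultimately have "Suc m < n" by simp
  have "Suc m \<in> fst \<eta>" "Suc m \<notin> snd \<eta>"
    using m \<open>Suc m < n\<close> \<xi>(3) by (auto simp: unih_def shl_def)
  moreover have "j \<notin> fst \<eta> \<and> j \<notin> snd \<eta>" if "j > Suc m" for j
    using that m(2) \<xi>(3) by (auto simp: unih_def shl_def) 
  moreover have "\<eta> \<in> bvecs n" using \<xi> by (auto simp: bvecs_def unih_def shl_def)
  ultimately show "\<eta> \<in> clsA n" unfolding clsA_def by blast
qed

lemma inj_unih: "inj_on (unih n) X"
  by (rule inj_on_inverseI[where g = "unih n"]) (auto simp: unih_def)

lemma inj_rotV': "inj_on rotV' X"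
  by (rule inj_on_inverseI[where g = rotV]) (auto simp: rotV_def rotV'_def)

text \<open>A difference of squares is a product \<open>(x - y) * (x + y)\<close>. The inequality of
  arithmetic and geometric means with weight \<open>s\<close> splits it into a small multiple of the
  total mass and the squared defect divided by \<open>s\<close>.\<close>

lemma mass_transfer:
  fixes F :: "'a \<Rightarrow> real"
  assumes "finite Z" "X \<subseteq> Z" "Y \<subseteq> Z" "S ` X \<subseteq> Y" "inj_on S X" "s > 0"
    and d: "\<And>\<xi>. \<xi> \<in> Z \<Longrightarrow> \<bar>\<bar>F \<xi>\<bar> - \<bar>F (S \<xi>)\<bar>\<bar> \<le> d \<xi>"
  shows "(\<Sum>\<xi>\<in>X. (F \<xi>)\<^sup>2) \<le> (\<Sum>\<xi>\<in>Y. (F \<xi>)\<^sup>2) + s * (\<Sum>\<xi>\<in>Z. (F \<xi>)\<^sup>2) + (\<Sum>\<xi>\<in>Z. (d \<xi>)\<^sup>2) / s"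
proof -
  have pt: "(F \<xi>)\<^sup>2 \<le> (F (S \<xi>))\<^sup>2 + (s/2 * (F \<xi>)\<^sup>2 + s/2 * (F (S \<xi>))\<^sup>2) + (d \<xi>)\<^sup>2 / s"
    if "\<xi> \<in> Z" for \<xi>
  proof -
    define x y where "x = \<bar>F \<xi>\<bar>" and "y = \<bar>F (S \<xi>)\<bar>"
    have "\<bar>x - y\<bar> \<le> \<bar>d \<xi>\<bar>" using d[OF that] unfolding x_def y_def by linarith
    then have dxy: "(x - y)\<^sup>2 \<le> (d \<xi>)\<^sup>2" by (rule abs_le_square_iff[THEN iffD1])
    have "(x - y) * (x + y) \<le> s/4 * (x + y)\<^sup>2 + (x - y)\<^sup>2 / s"
    proof -
      have "0 \<le> (s/2 * (x + y) - (x - y))\<^sup>2 / s" using \<open>s > 0\<close> by simp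
      also have "\<dots> = s/4 * (x + y)\<^sup>2 - (x - y) * (x + y) + (x - y)\<^sup>2 / s"
        using \<open>s > 0\<close> by (simp add: field_simps power2_eq_square)
      finally show ?thesis by simp
    qed
    also have "(x + y)\<^sup>2 \<le> 2 * x\<^sup>2 + 2 * y\<^sup>2"
      using zero_le_power2[of "x - y"] by (simp add: power2_eq_square algebra_simps)
    also have "(x - y)\<^sup>2 / s \<le> (d \<xi>)\<^sup>2 / s" using dxy \<open>s > 0\<close> by (simp add: divide_right_mono)
    finally have "x\<^sup>2 - y\<^sup>2 \<le> s/4 * (2 * x\<^sup>2 + 2 * y\<^sup>2) + (d \<xi>)\<^sup>2 / s"
      using \<open>s > 0\<close> by (simp add: power2_eq_square algebra_simps)
    then show ?thesis by (simp add: x_def y_def algebra_simps)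
  qed
  have S: "(\<Sum>\<xi>\<in>X. (F (S \<xi>))\<^sup>2) \<le> (\<Sum>\<xi>\<in>Y. (F \<xi>)\<^sup>2)"
  proof -
    have "(\<Sum>\<xi>\<in>X. (F (S \<xi>))\<^sup>2) = (\<Sum>\<xi>\<in>S ` X. (F \<xi>)\<^sup>2)" using assms(5) by (simp add: sum.reindex)
    also have "\<dots> \<le> (\<Sum>\<xi>\<in>Y. (F \<xi>)\<^sup>2)" using assms by (intro sum_mono2) (auto intro: finite_subset)
    finally show ?thesis .
  qed
  have m: "(\<Sum>\<xi>\<in>W. (F \<xi>)\<^sup>2) \<le> (\<Sum>\<xi>\<in>Z. (F \<xi>)\<^sup>2)" if "W \<subseteq> Z" for W
    using assms that by (intro sum_mono2) auto
  have "(\<Sum>\<xi>\<in>X. (F \<xi>)\<^sup>2)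
      \<le> (\<Sum>\<xi>\<in>X. (F (S \<xi>))\<^sup>2 + (s/2 * (F \<xi>)\<^sup>2 + s/2 * (F (S \<xi>))\<^sup>2) + (d \<xi>)\<^sup>2 / s)"
    using assms(2) pt by (intro sum_mono) auto
  also have "\<dots> = (\<Sum>\<xi>\<in>X. (F (S \<xi>))\<^sup>2)
      + (s/2 * (\<Sum>\<xi>\<in>X. (F \<xi>)\<^sup>2) + s/2 * (\<Sum>\<xi>\<in>X. (F (S \<xi>))\<^sup>2)) + (\<Sum>\<xi>\<in>X. (d \<xi>)\<^sup>2) / s"
    by (simp add: sum.distrib sum_distrib_left sum_divide_distrib)
  also have "\<dots> \<le> (\<Sum>\<xi>\<in>Y. (F \<xi>)\<^sup>2)
      + (s/2 * (\<Sum>\<xi>\<in>Z. (F \<xi>)\<^sup>2) + s/2 * (\<Sum>\<xi>\<in>Z. (F \<xi>)\<^sup>2)) + (\<Sum>\<xi>\<in>Z. (d \<xi>)\<^sup>2) / s"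
    using \<open>s > 0\<close> S m[OF assms(2)] m[OF assms(3)] assms(1,2)
    by (intro add_mono mult_left_mono divide_right_mono sum_mono2) auto
  finally show ?thesis by simp
qed

text \<open>The dual maps inject A into B, B into C, and the disjoint union of B and C, up to the
  set \<open>T\<close>, into A. If \<open>f\<close> is nearly invariant, all these injections nearly
  preserve its spectral mass, so A carries about as much as B and C together and at most as much as
  either; hence all three carry little. Mean zero takes care of the frequency zero.\<close>

lemma expander_bvecs:
  fixes f :: "bvec \<Rightarrow> real"
  assumes n: "n > 0" and f0: "(\<Sum>x\<in>bvecs n. f x) = 0"
  shows "(\<Sum>x\<in>bvecs n. (f x)\<^sup>2) \<le> 216 * ((\<Sum>x\<in>bvecs n. (f x - f (rotV x))\<^sup>2)
    + (\<Sum>x\<in>bvecs n. (f x - f (uniV n x))\<^sup>2) + (\<Sum>x\<in>bvecs n. (f x - f (tauV n x))\<^sup>2))"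
proof -
  let ?V = "bvecs n"
  define F where "F = fourier n f"
  define mu where "mu X = (\<Sum>\<xi>\<in>X. (F \<xi>)\<^sup>2)" for X
  define T where "T = {\<xi> :: bvec. n - 1 \<in> snd \<xi>}"
  define ER where "ER = (\<Sum>x\<in>?V. (f x - f (rotV x))\<^sup>2)"
  define EU where "EU = (\<Sum>x\<in>?V. (f x - f (uniV n x))\<^sup>2)"
  define ET where "ET = (\<Sum>x\<in>?V. (f x - f (tauV n x))\<^sup>2)"
  let ?FR = "fourier n (\<lambda>x. f x - f (rotV x))"
  let ?FU = "fourier n (\<lambda>x. f x - f (uniV n x))"
  let ?FT = "fourier n (\<lambda>x. f x - f (tauV n x))"
  have fin: "finite X" if "X \<subseteq> ?V" for X using that by (rule finite_subset) simp
  have F0: "F ({}, {}) = 0" using f0 by (simp add: F_def fourier_def chi_def walsh_def)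
  have mono: "mu X \<le> mu Y" if "X \<subseteq> Y" "finite Y" for X Y
    unfolding mu_def using that by (intro sum_mono2) auto
  have un: "mu (X \<union> Y) \<le> mu X + mu Y" if "finite X" "finite Y" for X Y
    unfolding mu_def using that by (simp add: sum_Un sum_nonneg)
  have dR: "\<bar>\<bar>F \<xi>\<bar> - \<bar>F (rotV' \<xi>)\<bar>\<bar> \<le> \<bar>?FR \<xi>\<bar>" for \<xi>
    by (simp add: fourier_diff F_def fourier_rotV)
  have dU: "\<bar>\<bar>F \<xi>\<bar> - \<bar>F (unih n \<xi>)\<bar>\<bar> \<le> \<bar>?FU \<xi>\<bar>" for \<xi>
    by (simp add: fourier_diff F_def flip: fourier_uniV[OF n])
  have RR: "mu X \<le> mu Y + 1/18 * mu ?V + 18 * (4 ^ n * ER)"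
    if "X \<subseteq> ?V" "Y \<subseteq> ?V" "rotV' ` X \<subseteq> Y" for X Y
    using mass_transfer[OF _ that inj_rotV', of "1/18" F "\<lambda>\<xi>. \<bar>?FR \<xi>\<bar>"] dR
    by (simp add: mu_def ER_def parseval mult_ac)
  have AB: "mu (clsA n) \<le> mu (clsB n) + 1/18 * mu ?V + 18 * (4 ^ n * ER)"
    by (intro RR rotV'_AB cls_sub)
  have BC: "mu (clsB n) \<le> mu (clsC n) + 1/18 * mu ?V + 18 * (4 ^ n * ER)"
    by (intro RR rotV'_BC cls_sub)
  have U: "mu (clsB n \<union> clsC n - T) \<le> mu (clsA n) + 1/18 * mu ?V + 18 * (4 ^ n * EU)"
    using mass_transfer[OF _ _ cls_sub(1) unih_A inj_unih, of n "1/18" F "\<lambda>\<xi>. \<bar>?FU \<xi>\<bar>"] dU cls_sub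
    by (simp add: mu_def EU_def parseval mult_ac T_def) blast
  \<comment> \<open>On \<open>T\<close> the translation \<open>tauV\<close> changes the sign of the
    transform, so the difference has the transform \<open>2 * F\<close> there.\<close>
  have T: "4 * mu (?V \<inter> T) \<le> 4 ^ n * ET"
  proof -
    have "4 * mu (?V \<inter> T) = (\<Sum>\<xi>\<in>?V \<inter> T. (?FT \<xi>)\<^sup>2)"
      unfolding mu_def sum_distrib_left
      by (intro sum.cong refl) (auto simp: fourier_diff fourier_tauV[OF n] T_def F_def power2_eq_square)
    also have "\<dots> \<le> (\<Sum>\<xi>\<in>?V. (?FT \<xi>)\<^sup>2)" by (intro sum_mono2) auto
    finally show ?thesis by (simp add: parseval ET_def)
  qed
  have "mu (clsB n) + mu (clsC n) = mu (clsB n \<union> clsC n)"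
    unfolding mu_def using cls_disjoint cls_sub fin by (intro sum.union_disjoint[symmetric]) auto
  also have "\<dots> \<le> mu ((clsB n \<union> clsC n - T) \<union> (?V \<inter> T))"
    using cls_sub[of n] by (intro mono) (auto intro: fin)
  also have "\<dots> \<le> mu (clsB n \<union> clsC n - T) + mu (?V \<inter> T)"
    using cls_sub[of n] by (intro un fin) auto
  finally have 1: "mu (clsB n) + mu (clsC n) \<le> mu (clsB n \<union> clsC n - T) + mu (?V \<inter> T)" .
  have "mu ?V \<le> mu ({({}, {})} \<union> (clsA n \<union> (clsB n \<union> clsC n)))"
    using cls_cover[of n] cls_sub[of n] by (intro mono) (auto intro: fin)
  also have "\<dots> \<le> mu {({}, {})} + mu (clsA n \<union> (clsB n \<union> clsC n))"
    using cls_sub[of n] by (intro un fin) (auto simp: bvecs_def)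
  also have "mu (clsA n \<union> (clsB n \<union> clsC n)) \<le> mu (clsA n) + mu (clsB n \<union> clsC n)"
    using cls_sub[of n] by (intro un fin) auto
  also have "mu (clsB n \<union> clsC n) \<le> mu (clsB n) + mu (clsC n)"
    using cls_sub[of n] by (intro un fin) auto
  also have "mu {({}, {})} = 0" by (simp add: mu_def F0)
  finally have 2: "mu ?V \<le> mu (clsA n) + (mu (clsB n) + mu (clsC n))" by simp
  \<comment> \<open>Solving the inequalities bounds the masses of A, B and C by 4 times the error in
    \<open>AB\<close>, 2 times that in \<open>BC\<close> and 3 times that in \<open>U\<close> and
    \<open>T\<close>. With weight 1/18 these nine errors contain half of \<open>mu ?V\<close>, which
    is absorbed on the left.\<close>
  have "mu ?V \<le> 4 ^ n * (216 * ER + 108 * EU + 3/2 * ET)"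
    using AB BC U T 1 2 by (simp add: algebra_simps)
  moreover have "mu ?V = 4 ^ n * (\<Sum>x\<in>?V. (f x)\<^sup>2)" by (simp add: mu_def F_def parseval)
  ultimately have "(\<Sum>x\<in>?V. (f x)\<^sup>2) \<le> 216 * ER + 108 * EU + 3/2 * ET" by simp
  moreover have "ER \<ge> 0" "EU \<ge> 0" "ET \<ge> 0" by (auto simp: ER_def EU_def ET_def sum_nonneg)
  ultimately show ?thesis by (simp flip: ER_def EU_def ET_def)
qed

text \<open>Transport to numbers below a power of two, the form in which the leaves of the tree are
  named.\<close>

lemma expander_exists:
  assumes "n > 0"
  obtains R U T :: "nat \<Rightarrow> nat" where
    "bij_betw R {..<2 ^ (2 * n)} {..<2 ^ (2 * n)}"
    "\<And>v. v < 2 ^ (2 * n) \<Longrightarrow> U v < 2 ^ (2 * n) \<and> U (U v) = v \<and> U v \<noteq> v"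
    "\<And>v. v < 2 ^ (2 * n) \<Longrightarrow> T v < 2 ^ (2 * n) \<and> T (T v) = v \<and> T v \<noteq> v"
    "\<And>f :: nat \<Rightarrow> real. (\<Sum>v<2 ^ (2 * n). f v) = 0 \<Longrightarrow> (\<Sum>v<2 ^ (2 * n). (f v)\<^sup>2)
      \<le> 216 * ((\<Sum>v<2 ^ (2 * n). (f v - f (R v))\<^sup>2)
        + (\<Sum>v<2 ^ (2 * n). (f v - f (U v))\<^sup>2) + (\<Sum>v<2 ^ (2 * n). (f v - f (T v))\<^sup>2))"
proof -
  let ?N = "{..<2 ^ (2 * n)} :: nat set"
  have "card ?N = card (bvecs n)" by (simp add: card_bvecs)
  then obtain h where h: "bij_betw h ?N (bvecs n)"
    using finite_same_card_bij[of ?N "bvecs n"] by auto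
  define g where "g = inv_into ?N h"
  have g: "bij_betw g (bvecs n) ?N" unfolding g_def by (rule bij_betw_inv_into[OF h])
  have gh: "g (h v) = v" if "v \<in> ?N" for v unfolding g_def by (rule bij_betw_inv_into_left[OF h that])
  have hg: "h (g x) = x" if "x \<in> bvecs n" for x unfolding g_def by (rule bij_betw_inv_into_right[OF h that])
  have hin: "h v \<in> bvecs n" if "v < 2 ^ (2 * n)" for v using bij_betwE[OF h] that by auto
  have gin: "g x < 2 ^ (2 * n)" if "x \<in> bvecs n" for x using bij_betwE[OF g] that by auto
  define c where "c S = (\<lambda>v. g (S (h v)))" for S :: "bvec \<Rightarrow> bvec"
  have inv: "c S v < 2 ^ (2 * n) \<and> c S (c S v) = v \<and> c S v \<noteq> v"
    if "v < 2 ^ (2 * n)" "\<And>x. x \<in> bvecs n \<Longrightarrow> S x \<in> bvecs n" "\<And>x. S (S x) = x" "\<And>x. S x \<noteq> x" for S v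
  proof -
    have S: "S (h v) \<in> bvecs n" by (intro that hin)
    have "h (g (S (h v))) \<noteq> h v" unfolding hg[OF S] by (rule that(4))
    then have "g (S (h v)) \<noteq> v" by metis
    then show ?thesis using gin[OF S] hg[OF S] gh[of v] that(1,3) by (simp add: c_def)
  qed
  have en: "(\<Sum>v<2 ^ (2 * n). (f v - f (c S v))\<^sup>2) = (\<Sum>x\<in>bvecs n. (f (g x) - f (g (S x)))\<^sup>2)"
    for f :: "nat \<Rightarrow> real" and S
    by (subst sum.reindex_bij_betw[OF h, symmetric]) (auto simp: c_def gh intro!: sum.cong)
  show thesis
  proof (rule that[of "c rotV" "c (uniV n)" "c (tauV n)"])
    show "bij_betw (c rotV) ?N ?N"
      unfolding c_def
      using bij_betw_trans[OF bij_betw_trans[OF h bij_rotV] g] by (simp add: o_def)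
    show "c (uniV n) v < 2 ^ (2 * n) \<and> c (uniV n) (c (uniV n) v) = v \<and> c (uniV n) v \<noteq> v"
      if "v < 2 ^ (2 * n)" for v
      using that assms by (intro inv) (auto simp: uniV_in uniV_neq)
    show "c (tauV n) v < 2 ^ (2 * n) \<and> c (tauV n) (c (tauV n) v) = v \<and> c (tauV n) v \<noteq> v"
      if "v < 2 ^ (2 * n)" for v
      using that assms by (intro inv) (auto simp: tauV_in tauV_neq)
    fix f :: "nat \<Rightarrow> real" assume f: "(\<Sum>v<2 ^ (2 * n). f v) = 0"
    have "(\<Sum>x\<in>bvecs n. f (g x)) = 0" using f by (subst sum.reindex_bij_betw[OF g]) simp
    from expander_bvecs[OF assms this]
    show "(\<Sum>v<2 ^ (2 * n). (f v)\<^sup>2) \<le> 216 * ((\<Sum>v<2 ^ (2 * n). (f v - f (c rotV v))\<^sup>2)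
        + (\<Sum>v<2 ^ (2 * n). (f v - f (c (uniV n) v))\<^sup>2) + (\<Sum>v<2 ^ (2 * n). (f v - f (c (tauV n) v))\<^sup>2))"
      by (simp add: en sum.reindex_bij_betw[OF g, of "\<lambda>v. (f v)\<^sup>2"])
  qed
qed

section \<open>Symmetric stochastic kernels on a finite set\<close>

definition kapp :: "'a set \<Rightarrow> ('a \<Rightarrow> 'a \<Rightarrow> real) \<Rightarrow> ('a \<Rightarrow> real) \<Rightarrow> 'a \<Rightarrow> real" where
  "kapp V k f x = (\<Sum>y\<in>V. k x y * f y)"

definition kpow :: "'a set \<Rightarrow> ('a \<Rightarrow> 'a \<Rightarrow> real) \<Rightarrow> nat \<Rightarrow> 'a \<Rightarrow> 'a \<Rightarrow> real" where
  "kpow V k t x y = (kapp V k ^^ t) (\<lambda>z. if z = y then 1 else 0) x"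

lemma kapp_add: "kapp V k (\<lambda>x. f x + g x) = (\<lambda>x. kapp V k f x + kapp V k g x)"
  by (auto simp: kapp_def algebra_simps sum.distrib)

lemma kapp_diff: "kapp V k (\<lambda>x. f x - g x) = (\<lambda>x. kapp V k f x - kapp V k g x)"
  by (auto simp: kapp_def algebra_simps sum_subtractf)

lemma kapp_cmult: "kapp V k (\<lambda>x. c * f x) = (\<lambda>x. c * kapp V k f x)"
  by (auto simp: kapp_def sum_distrib_left mult_ac)

lemma kapp_cong: "(\<And>y. y \<in> V \<Longrightarrow> f y = g y) \<Longrightarrow> kapp V k f x = kapp V k g x"
  by (simp add: kapp_def)

lemma kapp_pow_diff: "(kapp V k ^^ t) (\<lambda>x. f x - g x) = (\<lambda>x. (kapp V k ^^ t) f x - (kapp V k ^^ t) g x)"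
  by (induction t) (auto simp: kapp_diff)

text \<open>Nonnegative kernels, not necessarily stochastic: killed walks are included.\<close>

locale sym_kernel =
  fixes V :: "'a set" and k :: "'a \<Rightarrow> 'a \<Rightarrow> real"
  assumes finite_V: "finite V"
    and k_sym: "\<And>x y. x \<in> V \<Longrightarrow> y \<in> V \<Longrightarrow> k x y = k y x"
    and k_nonneg: "\<And>x y. x \<in> V \<Longrightarrow> y \<in> V \<Longrightarrow> k x y \<ge> 0"
begin

abbreviation "app \<equiv> kapp V k"
abbreviation "pw \<equiv> kpow V k"
definition "ip f g = (\<Sum>x\<in>V. f x * g x :: real)"

lemma app_mono: "x \<in> V \<Longrightarrow> (\<And>y. y \<in> V \<Longrightarrow> f y \<le> g y) \<Longrightarrow> app f x \<le> app g x"
  unfolding kapp_def by (intro sum_mono mult_left_mono k_nonneg)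

lemma app_pow_nonneg: "x \<in> V \<Longrightarrow> (\<And>y. y \<in> V \<Longrightarrow> 0 \<le> f y) \<Longrightarrow> 0 \<le> (app ^^ t) f x"
  by (induction t arbitrary: x) (auto simp: kapp_def intro!: sum_nonneg k_nonneg mult_nonneg_nonneg)

lemma app_sym: "ip f (app g) = ip (app f) g"
proof -
  have "ip f (app g) = (\<Sum>x\<in>V. \<Sum>y\<in>V. k x y * f x * g y)"
    by (simp add: ip_def kapp_def sum_distrib_left mult_ac)
  also have "\<dots> = (\<Sum>y\<in>V. \<Sum>x\<in>V. k x y * f x * g y)" by (rule sum.swap)
  also have "\<dots> = (\<Sum>y\<in>V. \<Sum>x\<in>V. k y x * f x * g y)"
    by (intro sum.cong refl) (simp add: k_sym)
  also have "\<dots> = ip (app f) g"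
    by (simp add: ip_def kapp_def sum_distrib_right sum_distrib_left mult_ac)
  finally show ?thesis .
qed

lemma app_pow_sym: "ip f ((app ^^ t) g) = ip ((app ^^ t) f) g"
proof (induction t arbitrary: f)
  case (Suc t)
  have "ip f ((app ^^ Suc t) g) = ip (app f) ((app ^^ t) g)" by (simp add: app_sym)
  also have "\<dots> = ip ((app ^^ t) (app f)) g" by (rule Suc)
  finally show ?case by (simp add: funpow_swap1)
qed simp

lemma ip_delta: "x \<in> V \<Longrightarrow> ip (\<lambda>z. if z = x then 1 else 0) f = f x"
  using finite_V by (simp add: ip_def if_distrib[of "\<lambda>c. c * _"] cong: if_cong)

lemma ip_commute: "ip f g = ip g f" by (simp add: ip_def mult.commute)

lemma pw_sym: "x \<in> V \<Longrightarrow> y \<in> V \<Longrightarrow> pw t x y = pw t y x"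
  using app_pow_sym[of "\<lambda>z. if z = x then 1 else 0" t "\<lambda>z. if z = y then 1 else 0"]
  by (simp add: kpow_def ip_delta ip_commute[of "(app ^^ t) _"])

lemma app_pow_eq: "x \<in> V \<Longrightarrow> (app ^^ t) f x = (\<Sum>y\<in>V. pw t x y * f y)"
proof -
  assume x: "x \<in> V"
  have "(app ^^ t) f x = ip ((app ^^ t) (\<lambda>z. if z = x then 1 else 0)) f"
    by (simp add: ip_delta[OF x] flip: app_pow_sym)
  also have "\<dots> = (\<Sum>y\<in>V. pw t y x * f y)" by (simp add: ip_def kpow_def)
  finally show ?thesis using x by (simp add: pw_sym cong: sum.cong)
qed

lemma pw_nonneg: "x \<in> V \<Longrightarrow> pw t x y \<ge> 0"
  unfolding kpow_def by (rule app_pow_nonneg) auto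

text \<open>Iterated Foster-Lyapunov drift condition. As \<open>\<rho> \<le> 1\<close> and the rows
  have sum at most 1, the additive error grows at most linearly in \<open>t\<close>.\<close>

lemma app_pow_add_le:
  assumes "\<And>x. x \<in> V \<Longrightarrow> app \<phi> x \<le> \<rho> * \<phi> x + c" and "0 \<le> \<rho>" "\<rho> \<le> 1" "c \<ge> 0"
    and sub: "\<And>x. x \<in> V \<Longrightarrow> (\<Sum>y\<in>V. k x y) \<le> 1" and "x \<in> V"
  shows "(app ^^ t) \<phi> x \<le> \<rho> ^ t * \<phi> x + t * c"
  using assms(6)
proof (induction t arbitrary: x)
  case (Suc t)
  have "(app ^^ Suc t) \<phi> x \<le> app (\<lambda>y. \<rho> ^ t * \<phi> y + t * c) x"
    using Suc by (auto intro: app_mono)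
  also have "\<dots> = \<rho> ^ t * app \<phi> x + t * c * (\<Sum>y\<in>V. k x y)"
    by (simp add: kapp_def algebra_simps sum.distrib sum_distrib_left)
  also have "\<dots> \<le> \<rho> ^ t * (\<rho> * \<phi> x + c) + t * c * 1"
    using assms Suc.prems by (intro add_mono mult_left_mono) auto
  also have "\<dots> \<le> \<rho> ^ Suc t * \<phi> x + Suc t * c"
    using mult_right_mono[OF power_le_one[OF assms(2,3), of t] assms(4)] by (simp add: algebra_simps)
  finally show ?case .
qed auto

end

locale stoch_kernel = sym_kernel +
  assumes k_sum: "\<And>x. x \<in> V \<Longrightarrow> (\<Sum>y\<in>V. k x y) = 1"
begin

lemma app_const: "x \<in> V \<Longrightarrow> app (\<lambda>y. c) x = c"
  by (simp add: kapp_def k_sum flip: sum_distrib_right)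

lemma app_pow_const: "x \<in> V \<Longrightarrow> (app ^^ t) (\<lambda>y. c) x = c"
proof (induction t arbitrary: x)
  case (Suc t)
  then have "(app ^^ Suc t) (\<lambda>y. c) x = app (\<lambda>y. c) x" by (auto intro: kapp_cong)
  then show ?case using Suc by (simp add: app_const)
qed simp

lemma pw_sum: "x \<in> V \<Longrightarrow> (\<Sum>y\<in>V. pw t x y) = 1"
  using app_pow_eq[of x t "\<lambda>y. 1"] by (simp add: app_pow_const)

lemma sum_app: "(\<Sum>x\<in>V. app f x) = (\<Sum>x\<in>V. f x)"
  using app_sym[of "\<lambda>x. 1" f] by (simp add: ip_def app_const cong: sum.cong)

lemma sum_app_pow: "(\<Sum>x\<in>V. (app ^^ t) f x) = (\<Sum>x\<in>V. f x)"
  by (induction t) (auto simp: sum_app)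

section \<open>Quadratic forms, Barta's argument and its consequences\<close>

definition en :: "real \<Rightarrow> ('a \<Rightarrow> real) \<Rightarrow> real" where
  "en \<sigma> f = 1/2 * (\<Sum>x\<in>V. \<Sum>y\<in>V. k x y * (f x + \<sigma> * f y)\<^sup>2)"

lemma en_nonneg: "en \<sigma> f \<ge> 0"
  unfolding en_def by (intro mult_nonneg_nonneg sum_nonneg k_nonneg) auto

text \<open>Hence a lower bound on the form with \<open>\<sigma> = -1\<close> (the Dirichlet form)
  keeps the spectrum away from 1, and one with \<open>\<sigma> = 1\<close> keeps it away from
  -1.\<close>

lemma en_eq:
  assumes "\<sigma>\<^sup>2 = 1"
  shows "en \<sigma> f = ip f f + \<sigma> * ip f (app f)"
proof -
  have "(\<Sum>x\<in>V. \<Sum>y\<in>V. k x y * (f x + \<sigma> * f y)\<^sup>2)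
     = (\<Sum>x\<in>V. \<Sum>y\<in>V. k x y * (f x * f x) + k x y * (f y * f y) + 2 * \<sigma> * (k x y * f x * f y))"
  proof (intro sum.cong refl)
    fix x y
    have "(f x + \<sigma> * f y)\<^sup>2 = f x * f x + \<sigma>\<^sup>2 * (f y * f y) + 2 * \<sigma> * (f x * f y)"
      by (simp add: power2_eq_square algebra_simps)
    then show "k x y * (f x + \<sigma> * f y)\<^sup>2
        = k x y * (f x * f x) + k x y * (f y * f y) + 2 * \<sigma> * (k x y * f x * f y)"
      using assms by (simp add: algebra_simps)
  qed
  also have "\<dots> = (\<Sum>x\<in>V. \<Sum>y\<in>V. k x y * (f x * f x)) + (\<Sum>x\<in>V. app (\<lambda>y. f y * f y) x)
       + 2 * \<sigma> * (\<Sum>x\<in>V. \<Sum>y\<in>V. k x y * f x * f y)"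
    by (simp add: sum.distrib sum_distrib_left kapp_def)
  also have "(\<Sum>x\<in>V. \<Sum>y\<in>V. k x y * (f x * f x)) = ip f f"
    unfolding ip_def by (intro sum.cong refl) (subst sum_distrib_right[symmetric], simp add: k_sum)
  also have "(\<Sum>x\<in>V. app (\<lambda>y. f y * f y) x) = ip f f" by (simp add: sum_app ip_def)
  also have "(\<Sum>x\<in>V. \<Sum>y\<in>V. k x y * f x * f y) = ip f (app f)"
    by (simp add: ip_def kapp_def sum_distrib_left mult_ac)
  finally show ?thesis by (simp add: en_def)
qed

text \<open>Barta's argument: by the inequality of arithmetic and geometric means, an edge \<open>x y\<close> satisfies
  \<open>(f x \<plusminus> f y)\<^sup>2 \<ge> (f x)\<^sup>2 (1 - \<phi> y / \<phi> x) + (f y)\<^sup>2 (1 - \<phi> x / \<phi> y)\<close>.\<close>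

lemma barta:
  assumes \<sigma>: "\<sigma>\<^sup>2 = 1" and \<phi>: "\<And>x. x \<in> V \<Longrightarrow> \<phi> x > 0"
  shows "(\<Sum>x\<in>V. (f x)\<^sup>2 * (1 - app \<phi> x / \<phi> x)) \<le> en \<sigma> f"
proof -
  have edge: "(f x)\<^sup>2 * (1 - \<phi> y / \<phi> x) + (f y)\<^sup>2 * (1 - \<phi> x / \<phi> y) \<le> (f x + \<sigma> * f y)\<^sup>2"
    if "x \<in> V" "y \<in> V" for x y
  proof -
    have p: "\<phi> x > 0" "\<phi> y > 0" using \<phi> that by auto
    have "0 \<le> (\<phi> y * f x + \<sigma> * \<phi> x * f y)\<^sup>2 / (\<phi> x * \<phi> y)" using p by simp
    also have "\<dots> = (f x)\<^sup>2 * (\<phi> y / \<phi> x) + \<sigma>\<^sup>2 * (f y)\<^sup>2 * (\<phi> x / \<phi> y) + 2 * \<sigma> * f x * f y"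
      using p by (simp add: power2_eq_square field_simps)
    finally have *: "0 \<le> (f x)\<^sup>2 * (\<phi> y / \<phi> x) + (f y)\<^sup>2 * (\<phi> x / \<phi> y) + 2 * \<sigma> * f x * f y"
      using \<sigma> by simp
    have "(f x + \<sigma> * f y)\<^sup>2 = (f x)\<^sup>2 + \<sigma>\<^sup>2 * (f y)\<^sup>2 + 2 * \<sigma> * f x * f y"
      by (simp add: power2_eq_square algebra_simps)
    with * \<sigma> show ?thesis by (simp add: algebra_simps)
  qed
  have A: "(\<Sum>x\<in>V. \<Sum>y\<in>V. k x y * ((f x)\<^sup>2 * (1 - \<phi> y / \<phi> x))) = (\<Sum>x\<in>V. (f x)\<^sup>2 * (1 - app \<phi> x / \<phi> x))"
  proof (intro sum.cong refl)
    fix x assume x: "x \<in> V"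
    have "(\<Sum>y\<in>V. k x y * ((f x)\<^sup>2 * (1 - \<phi> y / \<phi> x)))
        = (f x)\<^sup>2 * ((\<Sum>y\<in>V. k x y) - (\<Sum>y\<in>V. k x y * \<phi> y) / \<phi> x)"
      unfolding sum_divide_distrib sum_subtractf[symmetric] sum_distrib_left
      by (intro sum.cong refl) (simp add: algebra_simps)
    then show "(\<Sum>y\<in>V. k x y * ((f x)\<^sup>2 * (1 - \<phi> y / \<phi> x))) = (f x)\<^sup>2 * (1 - app \<phi> x / \<phi> x)"
      by (simp add: k_sum[OF x] kapp_def)
  qed
  have B: "(\<Sum>x\<in>V. \<Sum>y\<in>V. k x y * ((f y)\<^sup>2 * (1 - \<phi> x / \<phi> y)))
      = (\<Sum>x\<in>V. \<Sum>y\<in>V. k x y * ((f x)\<^sup>2 * (1 - \<phi> y / \<phi> x)))"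
    by (subst sum.swap) (intro sum.cong refl, simp add: k_sym)
  have "(\<Sum>x\<in>V. (f x)\<^sup>2 * (1 - app \<phi> x / \<phi> x)) = 1/2 * (\<Sum>x\<in>V. \<Sum>y\<in>V.
      k x y * ((f x)\<^sup>2 * (1 - \<phi> y / \<phi> x)) + k x y * ((f y)\<^sup>2 * (1 - \<phi> x / \<phi> y)))"
    by (simp add: sum.distrib A B)
  also have "\<dots> \<le> en \<sigma> f"
    unfolding en_def using edge
    by (intro mult_left_mono sum_mono) (auto simp flip: distrib_left intro!: mult_left_mono k_nonneg)
  finally show ?thesis .
qed

text \<open>A positive function that decays at a fixed rate outside \<open>C\<close> controls
  \<open>f\<close> there. Its possible growth by the factor \<open>\<Lambda>\<close> inside
  \<open>C\<close> is charged to the mass of \<open>f\<close> on \<open>C\<close>.\<close>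

lemma barta_poincare:
  assumes \<sigma>: "\<sigma>\<^sup>2 = 1" and C: "C \<subseteq> V" and \<phi>: "\<And>x. x \<in> V \<Longrightarrow> \<phi> x > 0"
    and 1: "\<And>x. x \<in> V - C \<Longrightarrow> app \<phi> x \<le> (1 - \<eta>) * \<phi> x"
    and 2: "\<And>x. x \<in> C \<Longrightarrow> app \<phi> x \<le> \<Lambda> * \<phi> x"
  shows "\<eta> * (\<Sum>x\<in>V - C. (f x)\<^sup>2) \<le> en \<sigma> f + (\<Lambda> - 1) * (\<Sum>x\<in>C. (f x)\<^sup>2)"
proof -
  have "\<eta> * (\<Sum>x\<in>V - C. (f x)\<^sup>2) - (\<Lambda> - 1) * (\<Sum>x\<in>C. (f x)\<^sup>2)
      = (\<Sum>x\<in>V - C. (f x)\<^sup>2 * \<eta>) + (\<Sum>x\<in>C. (f x)\<^sup>2 * (1 - \<Lambda>))"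
    by (simp add: sum_distrib_left sum_distrib_right sum_subtractf algebra_simps)
  also have "\<dots> \<le> (\<Sum>x\<in>V - C. (f x)\<^sup>2 * (1 - app \<phi> x / \<phi> x)) + (\<Sum>x\<in>C. (f x)\<^sup>2 * (1 - app \<phi> x / \<phi> x))"
  proof (intro add_mono sum_mono mult_left_mono)
    fix x assume x: "x \<in> V - C"
    then have "app \<phi> x / \<phi> x \<le> 1 - \<eta>" using 1[OF x] \<phi>[of x] by (simp add: field_simps)
    then show "\<eta> \<le> 1 - app \<phi> x / \<phi> x" by simp
  next
    fix x assume x: "x \<in> C"
    then have "app \<phi> x / \<phi> x \<le> \<Lambda>" using 2[OF x] \<phi>[of x] C by (auto simp: field_simps)
    then show "1 - \<Lambda> \<le> 1 - app \<phi> x / \<phi> x" by simp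
  qed auto
  also have "\<dots> = (\<Sum>x\<in>V. (f x)\<^sup>2 * (1 - app \<phi> x / \<phi> x))"
    using C finite_V by (simp add: sum.subset_diff)
  also have "\<dots> \<le> en \<sigma> f" by (rule barta[OF \<sigma> \<phi>])
  finally show ?thesis by simp
qed

lemma en_shift: "en (-1) (\<lambda>x. f x - c) = en (-1) f"
  by (simp add: en_def)

text \<open>The mean, here 0, is the best constant in least squares.\<close>

lemma sum_sq_shift:
  assumes "(\<Sum>x\<in>V. f x) = 0"
  shows "ip f f \<le> (\<Sum>x\<in>V. (f x - c)\<^sup>2)"
proof -
  have "(\<Sum>x\<in>V. (f x - c)\<^sup>2) = ip f f + (\<Sum>x\<in>V. c\<^sup>2) - 2 * c * (\<Sum>x\<in>V. f x)"
    unfolding ip_def sum_distrib_left sum.distrib[symmetric] sum_subtractf[symmetric]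
    by (intro sum.cong refl) (simp add: power2_eq_square algebra_simps)
  then show ?thesis using assms by simp
qed

text \<open>The gap of a core \<open>C\<close> passes to all of \<open>V\<close> when
  \<open>\<phi>\<close> certifies a fast return to \<open>C\<close>. For
  \<open>\<sigma> = -1\<close> the core determines \<open>f\<close> only up to a constant
  \<open>c\<close>; this is harmless, because the Dirichlet form ignores constants and the mean is
  the best one.\<close>

lemma gap_extend:
  assumes C: "C \<subseteq> V" and \<phi>: "\<And>x. x \<in> V \<Longrightarrow> \<phi> x > 0"
    and 1: "\<And>x. x \<in> V - C \<Longrightarrow> app \<phi> x \<le> (1 - \<eta>) * \<phi> x"
    and 2: "\<And>x. x \<in> C \<Longrightarrow> app \<phi> x \<le> \<Lambda> * \<phi> x"
    and "\<eta> > 0" "\<Lambda> \<ge> 1" "a \<ge> 0"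
    and gap: "\<And>f. \<exists>c. (\<Sum>x\<in>C. (f x - c)\<^sup>2) \<le> a * en (-1) f"
    and gap': "\<And>f. (\<Sum>x\<in>C. (f x)\<^sup>2) \<le> a * en 1 f"
    and f0: "(\<Sum>x\<in>V. f x) = 0" and \<sigma>: "\<sigma> = 1 \<or> \<sigma> = -1"
  shows "ip f f \<le> ((1 + (\<Lambda> - 1) * a) / \<eta> + a) * en \<sigma> f"
proof -
  obtain c where c: "(\<Sum>x\<in>C. (f x - c)\<^sup>2) \<le> a * en \<sigma> f" and c': "en \<sigma> (\<lambda>x. f x - c) = en \<sigma> f"
  proof (cases "\<sigma> = 1")
    case True
    then show ?thesis using gap'[of f] by (intro that[of 0]) auto
  next
    case False
    then have "\<sigma> = -1" using \<sigma> by simp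
    then show ?thesis using gap[of f] en_shift[of f] that by blast
  qed
  have "\<eta> * (\<Sum>x\<in>V - C. (f x - c)\<^sup>2) \<le> en \<sigma> f + (\<Lambda> - 1) * (\<Sum>x\<in>C. (f x - c)\<^sup>2)"
    using barta_poincare[OF _ C \<phi> 1 2, of \<sigma> "\<lambda>x. f x - c"] \<sigma> by (auto simp: c')
  also have "\<dots> \<le> en \<sigma> f + (\<Lambda> - 1) * (a * en \<sigma> f)"
    using c \<open>\<Lambda> \<ge> 1\<close> by (intro add_left_mono mult_left_mono) auto
  finally have "(\<Sum>x\<in>V - C. (f x - c)\<^sup>2) \<le> (1 + (\<Lambda> - 1) * a) / \<eta> * en \<sigma> f"
    using \<open>\<eta> > 0\<close> by (simp add: field_simps)
  with c have "(\<Sum>x\<in>V - C. (f x - c)\<^sup>2) + (\<Sum>x\<in>C. (f x - c)\<^sup>2) \<le> ((1 + (\<Lambda> - 1) * a) / \<eta> + a) * en \<sigma> f"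
    by (simp add: algebra_simps)
  also have "(\<Sum>x\<in>V - C. (f x - c)\<^sup>2) + (\<Sum>x\<in>C. (f x - c)\<^sup>2) = (\<Sum>x\<in>V. (f x - c)\<^sup>2)"
    using C finite_V by (simp add: sum.subset_diff)
  finally show ?thesis using sum_sq_shift[OF f0, of c] by linarith
qed

section \<open>From quadratic forms to contraction in the mean square\<close>

lemma ip_nonneg: "ip f f \<ge> 0" by (simp add: ip_def sum_nonneg)

lemma ip_bilin:
  "ip (\<lambda>x. f x + g x) h = ip f h + ip g h" "ip (\<lambda>x. f x - g x) h = ip f h - ip g h"
  "ip h (\<lambda>x. f x + g x) = ip h f + ip h g" "ip h (\<lambda>x. f x - g x) = ip h f - ip h g"
  "ip (\<lambda>x. c * f x) h = c * ip f h" "ip h (\<lambda>x. c * f x) = c * ip h f"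
  by (auto simp: ip_def algebra_simps sum.distrib sum_subtractf sum_distrib_left)

text \<open>A bound on the quadratic form bounds the operator norm, by polarisation.\<close>

lemma contraction:
  assumes A: "A \<ge> 1"
    and gap: "\<And>f \<sigma>. (\<Sum>x\<in>V. f x) = 0 \<Longrightarrow> \<sigma> = 1 \<or> \<sigma> = -1 \<Longrightarrow> ip f f \<le> A * en \<sigma> f"
    and f0: "(\<Sum>x\<in>V. f x) = 0"
  shows "ip (app f) (app f) \<le> (1 - 1/A)\<^sup>2 * ip f f"
proof -
  define l where "l = 1 - 1/A"
  have l: "l \<ge> 0" using A by (simp add: l_def)
  have q: "\<bar>ip u (app u)\<bar> \<le> l * ip u u" if "(\<Sum>x\<in>V. u x) = 0" for u
  proof -
    have "ip u u / A \<le> en (-1) u" "ip u u / A \<le> en 1 u"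
      using gap[OF that, of "-1"] gap[OF that, of 1] A by (auto simp: field_simps)
    then have "ip u u / A \<le> ip u u - ip u (app u)" "ip u u / A \<le> ip u u + ip u (app u)"
      by (auto simp: en_eq)
    then show ?thesis by (auto simp: l_def algebra_simps abs_le_iff)
  qed
  have pol: "2 * ip g (app f) \<le> l * (ip f f + ip g g)" if "(\<Sum>x\<in>V. g x) = 0" for g
  proof -
    have 1: "\<bar>ip (\<lambda>x. f x + g x) (app (\<lambda>x. f x + g x))\<bar> \<le> l * ip (\<lambda>x. f x + g x) (\<lambda>x. f x + g x)"
      by (rule q) (simp add: sum.distrib f0 that)
    have 2: "\<bar>ip (\<lambda>x. f x - g x) (app (\<lambda>x. f x - g x))\<bar> \<le> l * ip (\<lambda>x. f x - g x) (\<lambda>x. f x - g x)"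
      by (rule q) (simp add: sum_subtractf f0 that)
    have s: "ip f (app g) = ip g (app f)" using app_sym ip_commute by metis
    have "4 * ip g (app f) = ip (\<lambda>x. f x + g x) (app (\<lambda>x. f x + g x)) - ip (\<lambda>x. f x - g x) (app (\<lambda>x. f x - g x))"
      by (simp add: kapp_add kapp_diff ip_bilin s)
    also have "\<dots> \<le> l * ip (\<lambda>x. f x + g x) (\<lambda>x. f x + g x) + l * ip (\<lambda>x. f x - g x) (\<lambda>x. f x - g x)"
      using 1 2 by linarith
    also have "\<dots> = 2 * l * (ip f f + ip g g)"
      by (simp add: ip_bilin algebra_simps ip_commute)
    finally show ?thesis by simp
  qed
  define a b where "a = ip f f" and "b = ip (app f) (app f)"
  have a: "a \<ge> 0" and b: "b \<ge> 0" by (auto simp: a_def b_def ip_nonneg)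
  have key: "2 * c * b \<le> l * (a + c\<^sup>2 * b)" for c
    using pol[of "\<lambda>x. c * app f x"] f0
    by (simp add: ip_bilin sum_app a_def b_def power2_eq_square mult_ac flip: sum_distrib_left)
  show ?thesis
  proof (cases "b = 0")
    case True
    then show ?thesis using ip_nonneg by (simp add: b_def)
  next
    case False
    with b have "b > 0" by simp
    \<comment> \<open>This scale gives \<open>s * app f\<close> the norm of \<open>f\<close>, the
      optimal choice in \<open>key\<close>.\<close>
    define s where "s = sqrt (a / b)"
    have s: "s\<^sup>2 * b = a" using a \<open>b > 0\<close> by (simp add: s_def)
    show ?thesis
    proof (cases "s = 0")
      case True
      then have "a = 0" using s by simp
      then have "2 * b \<le> l * b" using key[of 1] by simp
      then have "2 \<le> l" using \<open>b > 0\<close> by simp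
      moreover have "l < 1" using A by (simp add: l_def)
      ultimately show ?thesis by simp
    next
      case False
      have "s \<ge> 0" using a b by (simp add: s_def)
      with False have "s > 0" by simp
      have "2 * s * b \<le> l * (2 * a)" using key[of s] s by simp
      then have "s * b \<le> l * a" by simp
      then have "(s * b)\<^sup>2 \<le> (l * a)\<^sup>2" using \<open>s > 0\<close> \<open>b > 0\<close> by (intro power_mono) auto
      then have "a * b \<le> l\<^sup>2 * a * a" using s by (simp add: power2_eq_square algebra_simps)
      moreover have "a > 0" using s \<open>s > 0\<close> \<open>b > 0\<close> by (metis mult_pos_pos zero_less_power)
      ultimately have "b \<le> l\<^sup>2 * a" by simp
      then show ?thesis by (simp add: a_def b_def l_def)
    qed
  qed
qed

lemma contraction_pow:
  assumes A: "A \<ge> 1"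
    and gap: "\<And>f \<sigma>. (\<Sum>x\<in>V. f x) = 0 \<Longrightarrow> \<sigma> = 1 \<or> \<sigma> = -1 \<Longrightarrow> ip f f \<le> A * en \<sigma> f"
    and f0: "(\<Sum>x\<in>V. f x) = 0"
  shows "ip ((app ^^ t) f) ((app ^^ t) f) \<le> ((1 - 1/A) ^ t)\<^sup>2 * ip f f"
proof (induction t)
  case (Suc t)
  have "ip ((app ^^ Suc t) f) ((app ^^ Suc t) f) \<le> (1 - 1/A)\<^sup>2 * ip ((app ^^ t) f) ((app ^^ t) f)"
    unfolding funpow.simps o_apply by (rule contraction[OF A gap]) (auto simp: sum_app_pow f0)
  also have "\<dots> \<le> (1 - 1/A)\<^sup>2 * (((1 - 1/A) ^ t)\<^sup>2 * ip f f)"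
    using Suc by (intro mult_left_mono) auto
  finally show ?case by (simp add: power_mult_distrib mult_ac)
qed simp

lemma l1_le_l2: "(\<Sum>x\<in>V. \<bar>f x\<bar>) \<le> sqrt (card V * ip f f)"
proof -
  have "(\<Sum>x\<in>V. \<bar>f x\<bar>)\<^sup>2 \<le> card V * (\<Sum>x\<in>V. \<bar>f x\<bar>\<^sup>2)"
    using Cauchy_Schwarz_ineq_sum[of "\<lambda>x. 1" "\<lambda>x. \<bar>f x\<bar>" V] by simp
  then have "(\<Sum>x\<in>V. \<bar>f x\<bar>)\<^sup>2 \<le> card V * ip f f" by (simp add: ip_def power2_eq_square)
  then show ?thesis by (rule real_le_rsqrt)
qed

end

section \<open>Expander clouds below a stretched binary tree\<close>

datatype vert = Tr nat nat | Cl nat nat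

definition flip :: "nat \<Rightarrow> nat" where "flip a = (if even a then a + 1 else a - 1)"

lemma flip_flip [simp]: "flip (flip a) = a" by (auto simp: flip_def)
lemma flip_neq: "flip a \<noteq> a" by (auto simp: flip_def elim: oddE)
lemma flip_less: "a < 2 ^ m \<Longrightarrow> m > 0 \<Longrightarrow> flip a < 2 ^ m"
proof -
  assume "a < 2 ^ m" "m > 0"
  then obtain m' where "m = Suc m'" by (cases m) auto
  then show ?thesis using \<open>a < 2 ^ m\<close> by (auto simp: flip_def elim!: evenE)
qed

lemma less_5E:
  assumes "p < (5::nat)"
  obtains "p = 0" | "p = 1" | "p = 2" | "p = 3" | "p = 4"
  using assms by linarith

lemma lessThan_5: "{..<5::nat} = {0, 1, 2, 3, 4}" by auto

text \<open>Levels \<open>0, \<dots>, L - 1\<close> form a tree, whose levels below \<open>H\<close> branch only at the multiples of \<open>M\<close>;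
  in between, sibling branches are joined by rungs, which makes the graph 3-regular. \<open>b l\<close> is the
  length of the binary words that name the vertices of level \<open>l\<close>. Each leaf is a vertex of a
  pentagon, and the pentagons are joined along the edges of an expander given by a permutation
  \<open>R\<close> with inverse \<open>R'\<close> and two involutions \<open>U\<close> and \<open>T\<close>.\<close>

locale tree_graph =
  fixes M H r :: nat and R R' U T :: "nat \<Rightarrow> nat"
  fixes L :: nat and br :: "nat \<Rightarrow> bool" and b :: "nat \<Rightarrow> nat"
  defines "L \<equiv> H + r"
    and "br \<equiv> \<lambda>l. M dvd l \<or> H \<le> l"
    and "b \<equiv> \<lambda>l. 1 + (\<Sum>i<l. if br i then 1 else 0)"
  assumes M: "M > 0" and r: "r > 0"
    and R: "\<And>v. v < 2 ^ b L \<Longrightarrow> R v < 2 ^ b L \<and> R' (R v) = v"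
    and R': "\<And>v. v < 2 ^ b L \<Longrightarrow> R' v < 2 ^ b L \<and> R (R' v) = v"
    and U: "\<And>v. v < 2 ^ b L \<Longrightarrow> U v < 2 ^ b L \<and> U (U v) = v \<and> U v \<noteq> v"
    and T: "\<And>v. v < 2 ^ b L \<Longrightarrow> T v < 2 ^ b L \<and> T (T v) = v \<and> T v \<noteq> v"
    and expander: "\<And>f :: nat \<Rightarrow> real. (\<Sum>v<2 ^ b L. f v) = 0 \<Longrightarrow> (\<Sum>v<2 ^ b L. (f v)\<^sup>2)
      \<le> 216 * ((\<Sum>v<2 ^ b L. (f v - f (R v))\<^sup>2)
        + (\<Sum>v<2 ^ b L. (f v - f (U v))\<^sup>2) + (\<Sum>v<2 ^ b L. (f v - f (T v))\<^sup>2))"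
begin

lemma b_0: "b 0 = 1" by (simp add: b_def)
lemma b_Suc: "b (Suc l) = (if br l then Suc (b l) else b l)" by (simp add: b_def)
lemma b_pos: "b l > 0" by (simp add: b_def)
lemma br_0: "br 0" by (simp add: br_def)
lemma br_ge: "H \<le> l \<Longrightarrow> br l" by (simp add: br_def)
lemma L_pos: "L > 0" using r by (simp add: L_def)
lemma b_mono: "l \<le> l' \<Longrightarrow> b l \<le> b l'"
  by (rule lift_Suc_mono_le) (simp_all add: b_Suc)

text \<open>The last level of the tree is formed by port 4 of the pentagons, so formulas about
  children need no special case for leaves.\<close>

definition node :: "nat \<Rightarrow> nat \<Rightarrow> vert" where
  "node l c = (if l = L then Cl c 4 else Tr l c)"

definition up :: "nat \<Rightarrow> nat \<Rightarrow> vert" where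
  "up l a = Tr (l - 1) (if br (l - 1) then a div 2 else a)"

text \<open>Ports 0 and 2 are the two ends of the edges of the permutation \<open>R\<close>, while
  the involutions \<open>U\<close> and \<open>T\<close> need one port each. Since ports 0 and 2 are
  not adjacent in the pentagon, a fixed point of \<open>R\<close> yields a chord and not a double
  edge.\<close>

definition ext :: "nat \<Rightarrow> nat \<Rightarrow> vert" where
  "ext v p = (if p = 0 then Cl (R v) 2 else if p = 1 then Cl (U v) 1 else if p = 2 then Cl (R' v) 0
    else if p = 3 then Cl (T v) 3 else up L v)"

text \<open>Level 0 consists of two roots, as \<open>b 0 = 1\<close>; the edge between them replaces
  the missing parent edge and makes them 3-valent as well.\<close>

fun nb :: "vert \<Rightarrow> vert set" where
  "nb (Tr l a) = (if l = 0 then {Tr 0 (flip a), node 1 (2 * a), node 1 (2 * a + 1)}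
     else if br l then {up l a, node (Suc l) (2 * a), node (Suc l) (2 * a + 1)}
     else {up l a, Tr l (flip a), node (Suc l) a})"
| "nb (Cl v p) = {Cl v ((p + 1) mod 5), Cl v ((p + 4) mod 5), ext v p}"

fun lev :: "vert \<Rightarrow> nat" where
  "lev (Tr l a) = l" | "lev (Cl v p) = L"

definition VT :: "vert set" where "VT = (\<lambda>(l, a). Tr l a) ` (SIGMA l:{..<L}. {..<2 ^ b l})"
definition VC :: "vert set" where "VC = (\<lambda>(v, p). Cl v p) ` ({..<2 ^ b L} \<times> {..<5})"
definition V :: "vert set" where "V = VT \<union> VC"

lemma VT_iff [simp]: "Tr l a \<in> VT \<longleftrightarrow> l < L \<and> a < 2 ^ b l" "Cl v p \<notin> VT"
  by (auto simp: VT_def)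
lemma VC_iff [simp]: "Cl v p \<in> VC \<longleftrightarrow> v < 2 ^ b L \<and> p < 5" "Tr l a \<notin> VC"
  by (auto simp: VC_def)
lemma V_iff [simp]: "Tr l a \<in> V \<longleftrightarrow> l < L \<and> a < 2 ^ b l" "Cl v p \<in> V \<longleftrightarrow> v < 2 ^ b L \<and> p < 5"
  by (auto simp: V_def)
lemma fin_V: "finite V" "finite VT" "finite VC"
  by (auto simp: V_def VT_def VC_def)

lemma VC_sub: "VC \<subseteq> V" by (auto simp: V_def)

lemma lev_le: "x \<in> V \<Longrightarrow> lev x \<le> L"
  by (cases x) auto

lemma lev_node: "lev (node l c) = l" by (simp add: node_def)
lemma lev_up: "lev (up l c) = l - 1" by (simp add: up_def)

lemma node_V: "l \<le> L \<Longrightarrow> c < 2 ^ b l \<Longrightarrow> node l c \<in> V"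
  by (auto simp: node_def)

lemma node_inj: "node l c = node l' c' \<longleftrightarrow> l = l' \<and> c = c'"
  by (auto simp: node_def)

lemma up_V: "0 < l \<Longrightarrow> l \<le> L \<Longrightarrow> a < 2 ^ b l \<Longrightarrow> up l a \<in> V"
  by (cases l) (auto simp: up_def b_Suc)

lemma ext_V: "v < 2 ^ b L \<Longrightarrow> p < 5 \<Longrightarrow> ext v p \<in> V"
  using R R' U T L_pos by (auto simp: ext_def intro!: up_V)

lemma nb_V: "x \<in> V \<Longrightarrow> nb x \<subseteq> V"
proof (cases x)
  case (Tr l a)
  assume "x \<in> V"
  then have l: "l < L" "a < 2 ^ b l" using Tr by auto
  then have "br l \<Longrightarrow> 2 * a < 2 ^ b (Suc l) \<and> 2 * a + 1 < 2 ^ b (Suc l)" by (auto simp: b_Suc)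
  moreover have "\<not> br l \<Longrightarrow> a < 2 ^ b (Suc l)" using l by (auto simp: b_Suc)
  ultimately show ?thesis
    using Tr l br_0 flip_less[OF l(2) b_pos] by (auto intro!: node_V up_V)
next
  case (Cl v p)
  assume "x \<in> V"
  then show ?thesis using Cl by (auto intro: ext_V)
qed

lemma up_nb: "0 < l \<Longrightarrow> l \<le> L \<Longrightarrow> up l a \<in> nb (node l a)"
  using r by (auto simp: node_def ext_def)

lemma node_nb_up: "0 < l \<Longrightarrow> node l a \<in> nb (up l a)"
  using br_0 by (cases l) (auto simp: up_def node_inj)

lemma nb_sym: "x \<in> V \<Longrightarrow> y \<in> nb x \<Longrightarrow> x \<in> nb y"
proof (cases x)
  case (Tr l a)
  assume xy: "x \<in> V" "y \<in> nb x"
  then have l: "l < L" "a < 2 ^ b l" using Tr by auto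
  have x: "x = node l a" using l Tr by (simp add: node_def)
  have up2: "x = up (Suc l) (2 * a)" "x = up (Suc l) (2 * a + 1)" if "br l"
    using that Tr by (auto simp: up_def)
  have up1: "x = up (Suc l) a" if "\<not> br l" using that Tr by (auto simp: up_def)
  consider "0 < l" "y = up l a" | "l = 0 \<or> \<not> br l" "y = Tr l (flip a)"
    | c where "y = node (Suc l) c" "x = up (Suc l) c"
  proof (cases "l = 0")
    case True
    then show ?thesis using xy Tr up2 br_0 that by auto
  next
    case False
    then show ?thesis using xy Tr up2 up1 that by (cases "br l") auto
  qed
  then show ?thesis
  proof cases
    case 1
    then show ?thesis using node_nb_up[of l a] x by simp
  next
    case 2
    then show ?thesis using Tr by auto
  next
    case 3
    then show ?thesis using up_nb[of "Suc l" c] l by simp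
  qed
next
  case (Cl v p)
  assume xy: "x \<in> V" "y \<in> nb x"
  then have v: "v < 2 ^ b L" "p < 5" using Cl by auto
  consider "y = Cl v ((p + 1) mod 5)" | "y = Cl v ((p + 4) mod 5)" | "y = ext v p"
    using xy Cl by auto
  then show ?thesis
  proof cases
    case 3
    from v(2) show ?thesis
    proof (cases rule: less_5E)
      case 5
      then have "x = node L v" "y = up L v" using 3 Cl by (auto simp: node_def ext_def)
      then show ?thesis using node_nb_up[OF L_pos] by simp
    qed (use 3 Cl v R R' U T in \<open>auto simp: ext_def\<close>)
  qed (use v(2) Cl in \<open>auto elim!: less_5E\<close>)
qed

lemma nb_irrefl: "x \<in> V \<Longrightarrow> x \<notin> nb x"
proof (cases x)
  case (Tr l a)
  then show ?thesis using flip_neq[of a] by (auto simp: node_def up_def)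
next
  case (Cl v p)
  assume "x \<in> V"
  then have v: "v < 2 ^ b L" "p < 5" using Cl by auto
  from v(2) show ?thesis
    by (cases rule: less_5E)
      (use Cl v U[of v] T[of v] in \<open>auto simp: ext_def up_def\<close>)
qed

section \<open>Sums over neighbourhoods and 3-regularity\<close>

definition nsum :: "(vert \<Rightarrow> real) \<Rightarrow> vert \<Rightarrow> real" where "nsum f x = (\<Sum>y\<in>nb x. f y)"

text \<open>Writing the sum with three separate terms includes that the three neighbours are
  distinct; with a constant function this is the degree count in \<open>card_nb\<close>.\<close>

lemma nsum_Tr:
  assumes "l < L"
  shows "nsum f (Tr l a) = (if l = 0 then f (Tr 0 (flip a)) + f (node 1 (2 * a)) + f (node 1 (2 * a + 1))
     else if br l then f (up l a) + f (node (Suc l) (2 * a)) + f (node (Suc l) (2 * a + 1))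
     else f (up l a) + f (Tr l (flip a)) + f (node (Suc l) a))"
  using assms by (cases l) (auto simp: nsum_def node_def up_def)

lemma nsum_Cl:
  assumes "p < 5"
  shows "nsum f (Cl v p) = f (Cl v ((p + 1) mod 5)) + f (Cl v ((p + 4) mod 5)) + f (ext v p)"
  using assms by (cases rule: less_5E) (auto simp: nsum_def ext_def up_def)

lemma card_nb: "x \<in> V \<Longrightarrow> card (nb x) = 3"
proof -
  assume "x \<in> V"
  then have "nsum (\<lambda>_. 1) x = 3" by (cases x) (auto simp: nsum_Tr nsum_Cl)
  then show ?thesis by (simp add: nsum_def)
qed

lemma nsum_lev_Tr:
  assumes "l < L"
  shows "nsum (\<lambda>x. \<phi> (lev x)) (Tr l a) = (if l = 0 then \<phi> 0 + 2 * \<phi> 1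
     else if br l then \<phi> (l - 1) + 2 * \<phi> (Suc l) else \<phi> (l - 1) + \<phi> l + \<phi> (Suc l))"
  using assms by (simp add: nsum_Tr lev_node lev_up)

lemma nsum_lev_Cl:
  assumes "p < 5"
  shows "nsum (\<lambda>x. \<phi> (lev x)) (Cl v p) = (if p = 4 then 2 * \<phi> L + \<phi> (L - 1) else 3 * \<phi> L)"
  using assms by (cases rule: less_5E) (auto simp: nsum_Cl ext_def lev_up)

section \<open>Poincare inequalities for the pentagons and the expander\<close>

lemma cloud_edges:
  assumes "stoch_kernel W k" and "VC \<subseteq> W"
    and k: "\<And>x y. x \<in> VC \<Longrightarrow> y \<in> VC \<Longrightarrow> y \<in> nb x \<Longrightarrow> k x y \<ge> 1/3"
    and S: "inj_on g S" "g ` S \<subseteq> VC" "\<And>s. s \<in> S \<Longrightarrow> m s \<in> VC \<and> m s \<in> nb (g s)"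
  shows "(\<Sum>s\<in>S. (f (g s) + \<sigma> * f (m s))\<^sup>2) \<le> 6 * stoch_kernel.en W k \<sigma> f"
proof -
  interpret stoch_kernel W k by fact
  have fS: "finite S" using S fin_V(3) by (meson finite_imageD finite_subset)
  \<comment> \<open>The factor 3 makes up for the weight 1/3 of an edge, and the factor 1/2 in
    \<open>en\<close> doubles it to 6. Injectivity of \<open>g\<close> ensures that every row of the
    double sum is used at most once.\<close>
  have "(\<Sum>s\<in>S. (f (g s) + \<sigma> * f (m s))\<^sup>2) \<le> (\<Sum>s\<in>S. 3 * (\<Sum>y\<in>W. k (g s) y * (f (g s) + \<sigma> * f y)\<^sup>2))"
  proof (intro sum_mono)
    fix s assume s: "s \<in> S"
    have "(f (g s) + \<sigma> * f (m s))\<^sup>2 \<le> 3 * (k (g s) (m s) * (f (g s) + \<sigma> * f (m s))\<^sup>2)"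
      using k[of "g s" "m s"] S s mult_right_mono[of "1/3" "k (g s) (m s)" "(f (g s) + \<sigma> * f (m s))\<^sup>2"]
      by auto
    also have "\<dots> \<le> 3 * (\<Sum>y\<in>W. k (g s) y * (f (g s) + \<sigma> * f y)\<^sup>2)"
      using S s \<open>VC \<subseteq> W\<close> finite_V k_nonneg
      by (intro mult_left_mono member_le_sum[where f = "\<lambda>y. k (g s) y * (f (g s) + \<sigma> * f y)\<^sup>2"])
         (auto intro!: mult_nonneg_nonneg k_nonneg)
    finally show "(f (g s) + \<sigma> * f (m s))\<^sup>2 \<le> 3 * (\<Sum>y\<in>W. k (g s) y * (f (g s) + \<sigma> * f y)\<^sup>2)" .
  qed
  also have "\<dots> = (\<Sum>x\<in>g ` S. 3 * (\<Sum>y\<in>W. k x y * (f x + \<sigma> * f y)\<^sup>2))"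
    using S(1) by (simp add: sum.reindex)
  also have "\<dots> \<le> (\<Sum>x\<in>W. 3 * (\<Sum>y\<in>W. k x y * (f x + \<sigma> * f y)\<^sup>2))"
    using S(2) \<open>VC \<subseteq> W\<close> finite_V k_nonneg
    by (intro sum_mono2) (auto intro!: sum_nonneg)
  finally show ?thesis by (simp add: en_def sum_distrib_left)
qed

lemma sum_VC: "(\<Sum>x\<in>VC. f x) = (\<Sum>v<2 ^ b L. \<Sum>p<5. f (Cl v p))"
  unfolding VC_def by (subst sum.reindex) (auto simp: inj_on_def sum.cartesian_product case_prod_beta o_def)

lemma pentagon_sum:
  fixes \<sigma> :: real and f :: "nat \<Rightarrow> real"
  shows "(\<Sum>p<5. (f p + \<sigma> * f ((p + 1) mod 5))\<^sup>2)
    = (f 0 + \<sigma> * f 1)\<^sup>2 + (f 1 + \<sigma> * f 2)\<^sup>2 + (f 2 + \<sigma> * f 3)\<^sup>2 + (f 3 + \<sigma> * f 4)\<^sup>2 + (f 4 + \<sigma> * f 0)\<^sup>2"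
  unfolding lessThan_5 by (simp add: numeral_2_eq_2)

lemma cauchy2: "(x + y)\<^sup>2 \<le> 2 * (x\<^sup>2 + y\<^sup>2)" for x y :: real
  using zero_le_power2[of "x - y"] by (simp add: power2_eq_square algebra_simps)

lemma cauchy3: "(x + y + z)\<^sup>2 \<le> 3 * (x\<^sup>2 + y\<^sup>2 + z\<^sup>2)" for x y z :: real
  using zero_le_power2[of "x - y"] zero_le_power2[of "y - z"] zero_le_power2[of "x - z"]
  by (simp add: power2_eq_square algebra_simps)

text \<open>Around an odd cycle the alternating sum of the edge sums \<open>f p + f (p + 1)\<close>
  telescopes to twice one value of \<open>f\<close>. On an even cycle an alternating
  \<open>f\<close> would have energy 0.\<close>

lemma pentagon_odd:
  fixes f :: "nat \<Rightarrow> real"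
  assumes "p < 5"
  shows "(f p)\<^sup>2 \<le> 5 * (\<Sum>p<5. (f p + 1 * f ((p + 1) mod 5))\<^sup>2)"
proof -
  have *: "((a - b + c - d + e) / 2)\<^sup>2 \<le> 5 * (a\<^sup>2 + b\<^sup>2 + c\<^sup>2 + d\<^sup>2 + e\<^sup>2)" for a b c d e :: real
  proof -
    have "(a - b + c - d + e)\<^sup>2 = (((a - b) + (c - d)) + e)\<^sup>2" by (simp add: algebra_simps)
    also have "\<dots> \<le> 2 * (2 * (2 * (a\<^sup>2 + b\<^sup>2) + 2 * (c\<^sup>2 + d\<^sup>2)) + e\<^sup>2)"
      using cauchy2[of "(a - b) + (c - d)" e] cauchy2[of "a - b" "c - d"] cauchy2[of a "-b"] cauchy2[of c "-d"]
      by (simp add: algebra_simps)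
    also have "\<dots> \<le> 8 * (a\<^sup>2 + b\<^sup>2 + c\<^sup>2 + d\<^sup>2 + e\<^sup>2)" by simp
    also have "\<dots> \<le> 20 * (a\<^sup>2 + b\<^sup>2 + c\<^sup>2 + d\<^sup>2 + e\<^sup>2)" by simp
    finally show ?thesis by (simp add: power_divide)
  qed
  define S where "S = (\<Sum>p<5. (f p + 1 * f ((p + 1) mod 5))\<^sup>2)"
  note S = S_def[unfolded pentagon_sum]
  from assms have "(f p)\<^sup>2 \<le> 5 * S"
  proof (cases rule: less_5E)
    case 1 then show ?thesis
      using *[of "f 0 + f 1" "f 1 + f 2" "f 2 + f 3" "f 3 + f 4" "f 4 + f 0"] unfolding S by simp
  next
    case 2 then show ?thesis
      using *[of "f 1 + f 2" "f 2 + f 3" "f 3 + f 4" "f 4 + f 0" "f 0 + f 1"] unfolding S by (simp add: add_ac)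
  next
    case 3 then show ?thesis
      using *[of "f 2 + f 3" "f 3 + f 4" "f 4 + f 0" "f 0 + f 1" "f 1 + f 2"] unfolding S by (simp add: add_ac)
  next
    case 4 then show ?thesis
      using *[of "f 3 + f 4" "f 4 + f 0" "f 0 + f 1" "f 1 + f 2" "f 2 + f 3"] unfolding S by (simp add: add_ac)
  next
    case 5 then show ?thesis
      using *[of "f 4 + f 0" "f 0 + f 1" "f 1 + f 2" "f 2 + f 3" "f 3 + f 4"] unfolding S by (simp add: add_ac)
  qed
  then show ?thesis by (simp add: S_def)
qed

text \<open>Every vertex of the pentagon is at most two edges away from vertex 0.\<close>

lemma pentagon_diff:
  fixes f :: "nat \<Rightarrow> real"
  assumes "p < 5"
  shows "(f p - f 0)\<^sup>2 \<le> 4 * (\<Sum>p<5. (f p + (-1) * f ((p + 1) mod 5))\<^sup>2)"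
proof -
  define S where "S = (\<Sum>p<5. (f p + (-1) * f ((p + 1) mod 5))\<^sup>2)"
  have S: "S = (f 0 - f 1)\<^sup>2 + (f 1 - f 2)\<^sup>2 + (f 2 - f 3)\<^sup>2 + (f 3 - f 4)\<^sup>2 + (f 4 - f 0)\<^sup>2"
    unfolding S_def pentagon_sum by simp
  have nn: "0 \<le> (f 0 - f 1)\<^sup>2" "0 \<le> (f 1 - f 2)\<^sup>2" "0 \<le> (f 2 - f 3)\<^sup>2" "0 \<le> (f 3 - f 4)\<^sup>2" "0 \<le> (f 4 - f 0)\<^sup>2"
    by auto
  from assms have "(f p - f 0)\<^sup>2 \<le> 4 * S"
  proof (cases rule: less_5E)
    case 2 
    have "(f 1 - f 0)\<^sup>2 \<le> 4 * S" using S nn power2_commute[of "f 1" "f 0"] by linarith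
    then show ?thesis using 2 by simp
  next
    case 3 
    have "(f 0 - f 2)\<^sup>2 \<le> 2 * ((f 0 - f 1)\<^sup>2 + (f 1 - f 2)\<^sup>2)"
      using cauchy2[of "f 0 - f 1" "f 1 - f 2"] by simp
    also have "\<dots> \<le> 4 * S" unfolding S by simp
    finally have "(f 2 - f 0)\<^sup>2 \<le> 4 * S" by (simp only: power2_commute[of "f 2" "f 0"])
    then show ?thesis using 3 by simp
  next
    case 4 
    have "(f 3 - f 0)\<^sup>2 \<le> 2 * ((f 3 - f 4)\<^sup>2 + (f 4 - f 0)\<^sup>2)"
      using cauchy2[of "f 3 - f 4" "f 4 - f 0"] by simp
    also have "\<dots> \<le> 4 * S" unfolding S by simp
    finally have "(f 3 - f 0)\<^sup>2 \<le> 4 * S" .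
    then show ?thesis using 4 by simp
  next
    case 5
    have "(f 4 - f 0)\<^sup>2 \<le> 4 * S" using S nn by linarith
    then show ?thesis using 5 by simp
  qed (use S nn in \<open>simp add: add_nonneg_nonneg\<close>)
  then show ?thesis by (simp add: S_def)
qed

lemma cloud_gap_odd:
  assumes "stoch_kernel W k" and "VC \<subseteq> W"
    and k: "\<And>x y. x \<in> VC \<Longrightarrow> y \<in> VC \<Longrightarrow> y \<in> nb x \<Longrightarrow> k x y \<ge> 1/3"
  shows "(\<Sum>x\<in>VC. (f x)\<^sup>2) \<le> 2000000 * stoch_kernel.en W k 1 f"
proof -
  interpret stoch_kernel W k by fact
  have "(\<Sum>x\<in>VC. (f x)\<^sup>2) \<le> (\<Sum>v<2 ^ b L. \<Sum>p<5::nat. 5 * (\<Sum>p<5. (f (Cl v p) + 1 * f (Cl v ((p + 1) mod 5)))\<^sup>2))"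
    unfolding sum_VC by (intro sum_mono pentagon_odd) auto
  also have "\<dots> = 25 * (\<Sum>x\<in>{..<2 ^ b L} \<times> {..<5}.
      (f (case x of (v, p) \<Rightarrow> Cl v p) + 1 * f (case x of (v, p) \<Rightarrow> Cl v ((p + 1) mod 5)))\<^sup>2)"
    by (simp add: sum_distrib_left sum.cartesian_product case_prod_beta)
  also have "\<dots> \<le> 25 * (6 * en 1 f)"
    by (intro mult_left_mono cloud_edges[OF assms]) (auto simp: inj_on_def)
  \<comment> \<open>The factor 150 would do; it is raised to that of \<open>cloud_gap\<close>
    because \<open>gap_extend\<close> takes one constant for both signs.\<close>
  also have "\<dots> \<le> 2000000 * en 1 f" using en_nonneg[of 1 f] by simp
  finally show ?thesis .
qed

text \<open>Each pentagon is represented by its vertex 0. The function \<open>F\<close> on the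
  representatives obeys the inequality of the expander, and \<open>cyc\<close> pays for moving
  inside a pentagon.\<close>

lemma cloud_gap:
  assumes "stoch_kernel W k" and "VC \<subseteq> W"
    and k: "\<And>x y. x \<in> VC \<Longrightarrow> y \<in> VC \<Longrightarrow> y \<in> nb x \<Longrightarrow> k x y \<ge> 1/3"
  shows "\<exists>c. (\<Sum>x\<in>VC. (f x - c)\<^sup>2) \<le> 2000000 * stoch_kernel.en W k (-1) f"
proof -
  interpret stoch_kernel W k by fact
  define N :: nat where "N = 2 ^ b L"
  define e where "e = en (-1) f"
  define F where "F v = f (Cl v 0)" for v
  define c where "c = (\<Sum>v<N. F v) / N"
  define cyc where "cyc v = (\<Sum>p<5. (f (Cl v p) + (-1) * f (Cl v ((p + 1) mod 5)))\<^sup>2)" for v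
  have N: "N > 0" by (simp add: N_def)
  have e0: "e \<ge> 0" by (simp add: e_def en_nonneg)
  have in_cl: "(f (Cl v p) - F v)\<^sup>2 \<le> 4 * cyc v" if "p < 5" for v p
    unfolding F_def cyc_def using pentagon_diff[OF that, of "\<lambda>p. f (Cl v p)"] by simp
  have in_cl': "(F v - f (Cl v p))\<^sup>2 \<le> 4 * cyc v" if "p < 5" for v p
    using in_cl[OF that, of v] by (simp add: power2_commute)
  have cyc: "(\<Sum>v<N. cyc v) \<le> 6 * e"
  proof -
    have "(\<Sum>v<N. cyc v) = (\<Sum>x\<in>{..<N} \<times> {..<5}.
      (f (case x of (v, p) \<Rightarrow> Cl v p) + (-1) * f (case x of (v, p) \<Rightarrow> Cl v ((p + 1) mod 5)))\<^sup>2)"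
      by (simp add: cyc_def sum.cartesian_product case_prod_beta)
    also have "\<dots> \<le> 6 * e" unfolding N_def e_def
      by (intro cloud_edges[OF assms]) (auto simp: inj_on_def)
    finally show ?thesis .
  qed
  have perm: "(\<Sum>v<N. cyc (S v)) \<le> 6 * e" if "inj_on S {..<N}" "S ` {..<N} \<subseteq> {..<N}" for S
  proof -
    have "(\<Sum>v<N. cyc (S v)) = (\<Sum>v\<in>S ` {..<N}. cyc v)" using that by (simp add: sum.reindex)
    also have "\<dots> \<le> (\<Sum>v<N. cyc v)" using that by (intro sum_mono2) (auto simp: cyc_def sum_nonneg)
    finally show ?thesis using cyc by simp
  qed
  have ext: "(\<Sum>v<N. (f (Cl v p) - f (Cl (S v) q))\<^sup>2) \<le> 6 * e"
    if "\<And>v. v < N \<Longrightarrow> S v < N \<and> ext v p = Cl (S v) q" "p < 5" "q < 5" for S p q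
  proof -
    have "(\<Sum>v<N. (f (Cl v p) + (-1) * f (Cl (S v) q))\<^sup>2) \<le> 6 * e"
      unfolding N_def e_def
      by (rule cloud_edges[OF assms]) (use that in \<open>auto simp: inj_on_def N_def\<close>)
    then show ?thesis by simp
  qed
  have step: "(\<Sum>v<N. (F v - F (S v))\<^sup>2) \<le> 162 * e"
    if S: "inj_on S {..<N}" "\<And>v. v < N \<Longrightarrow> S v < N \<and> ext v p = Cl (S v) q" "p < 5" "q < 5" for S p q
  proof -
    have "(\<Sum>v<N. (F v - F (S v))\<^sup>2)
        \<le> (\<Sum>v<N. 12 * cyc v + 3 * (f (Cl v p) - f (Cl (S v) q))\<^sup>2 + 12 * cyc (S v))"
    proof (intro sum_mono)
      fix v
      \<comment> \<open>An edge of the expander is replaced by a walk inside one pentagon, one outer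
        edge, and a walk inside the other; the total cost is 12 * 6 + 3 * 6 + 12 * 6 = 162 units of
        energy.\<close>
      have "(F v - F (S v))\<^sup>2 \<le> 3 * ((F v - f (Cl v p))\<^sup>2 + (f (Cl v p) - f (Cl (S v) q))\<^sup>2
          + (f (Cl (S v) q) - F (S v))\<^sup>2)"
        using cauchy3[of "F v - f (Cl v p)" "f (Cl v p) - f (Cl (S v) q)" "f (Cl (S v) q) - F (S v)"] by simp
      then show "(F v - F (S v))\<^sup>2 \<le> 12 * cyc v + 3 * (f (Cl v p) - f (Cl (S v) q))\<^sup>2 + 12 * cyc (S v)"
        using in_cl'[OF \<open>p < 5\<close>, of v] in_cl[OF \<open>q < 5\<close>, of "S v"] by simp
    qed
    also have "\<dots> = 12 * (\<Sum>v<N. cyc v) + 3 * (\<Sum>v<N. (f (Cl v p) - f (Cl (S v) q))\<^sup>2) + 12 * (\<Sum>v<N. cyc (S v))"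
      by (simp add: sum.distrib sum_distrib_left)
    also have "\<dots> \<le> 12 * (6 * e) + 3 * (6 * e) + 12 * (6 * e)"
      using cyc perm[OF S(1)] S(2) ext[OF S(2-4)] by (intro add_mono mult_left_mono) auto
    finally show ?thesis by simp
  qed
  have inv: "inj_on S {..<N}" if "\<And>v. v < N \<Longrightarrow> S' (S v) = v" for S S' :: "nat \<Rightarrow> nat"
    using that by (intro inj_on_inverseI[of _ S']) auto
  have sR: "(\<Sum>v<N. (F v - F (R v))\<^sup>2) \<le> 162 * e"
    by (rule step[of _ 0 2]) (use R in \<open>auto simp: N_def ext_def intro!: inv[unfolded N_def, of R']\<close>)
  have sU: "(\<Sum>v<N. (F v - F (U v))\<^sup>2) \<le> 162 * e"
    by (rule step[of _ 1 1]) (use U in \<open>auto simp: N_def ext_def intro!: inv[unfolded N_def, of U]\<close>)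
  have sT: "(\<Sum>v<N. (F v - F (T v))\<^sup>2) \<le> 162 * e"
    by (rule step[of _ 3 3]) (use T in \<open>auto simp: N_def ext_def intro!: inv[unfolded N_def, of T]\<close>)
  have "(\<Sum>v<N. F v - c) = 0" using N by (simp add: sum_subtractf c_def)
  \<comment> \<open>216 * 3 * 162 = 104976, rounded up below to 105000; the final factor is then 40
    * 6 + 10 * 105000, safely below 2000000.\<close>
  from expander[of "\<lambda>v. F v - c", folded N_def, OF this]
  have "(\<Sum>v<N. (F v - c)\<^sup>2) \<le> 216 * (162 * e + 162 * e + 162 * e)"
    using sR sU sT by simp
  then have Fc: "(\<Sum>v<N. (F v - c)\<^sup>2) \<le> 105000 * e" using e0 by simp
  have "(\<Sum>x\<in>VC. (f x - c)\<^sup>2) \<le> (\<Sum>v<N. \<Sum>p<5::nat. 8 * cyc v + 2 * (F v - c)\<^sup>2)"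
    unfolding sum_VC N_def[symmetric]
  proof (intro sum_mono)
    fix v p assume "p \<in> {..<5::nat}"
    then show "(f (Cl v p) - c)\<^sup>2 \<le> 8 * cyc v + 2 * (F v - c)\<^sup>2"
      using cauchy2[of "f (Cl v p) - F v" "F v - c"] in_cl[of p v] by simp
  qed
  also have "\<dots> = 40 * (\<Sum>v<N. cyc v) + 10 * (\<Sum>v<N. (F v - c)\<^sup>2)"
    by (simp add: sum.distrib sum_distrib_left)
  finally have "(\<Sum>x\<in>VC. (f x - c)\<^sup>2) \<le> 40 * (\<Sum>v<N. cyc v) + 10 * (\<Sum>v<N. (F v - c)\<^sup>2)" .
  then have "(\<Sum>x\<in>VC. (f x - c)\<^sup>2) \<le> 2000000 * e" using cyc Fc e0 by linarith
  then show ?thesis by (auto simp: e_def)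
qed

end

section \<open>Drift, hitting and mixing\<close>

text \<open>The constant of \<open>gap_extend\<close> for a core constant 2000000,
  \<open>\<eta> = 1/18\<close> and \<open>\<Lambda> = 3/2\<close>, as used in
  \<open>gap_B\<close>.\<close>

definition gB :: real where "gB = 20000018"
definition lamB :: real where "lamB = 1 - 1 / gB"

context tree_graph
begin

definition kG :: "vert \<Rightarrow> vert \<Rightarrow> real" where "kG x y = (if y \<in> nb x then 1/3 else 0)"

definition B :: "vert set" where "B = {x\<in>V. H \<le> lev x}"

text \<open>The probability of leaving \<open>B\<close> is moved to the diagonal, which keeps the
  kernel symmetric and the uniform distribution on \<open>B\<close> invariant.\<close>

definition kB :: "vert \<Rightarrow> vert \<Rightarrow> real" where
  "kB x y = kG x y + (if x = y then 1 - (\<Sum>z\<in>B. kG x z) else 0)"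

lemma kG_nonneg: "kG x y \<ge> 0" by (simp add: kG_def)
lemma kG_sym: "x \<in> V \<Longrightarrow> y \<in> V \<Longrightarrow> kG x y = kG y x"
  using nb_sym by (auto simp: kG_def)

lemma B_sub: "B \<subseteq> V" by (auto simp: B_def)
lemma VC_sub_B: "VC \<subseteq> B"
  by (auto simp: VC_def B_def L_def)
lemma fin_B: "finite B" using B_sub fin_V(1) by (rule finite_subset)

lemma sum_kG: "x \<in> V \<Longrightarrow> (\<Sum>y\<in>V. kG x y * f y) = nsum f x / 3"
proof -
  assume "x \<in> V"
  then have nb: "V \<inter> nb x = nb x" using nb_V by blast
  have "(\<Sum>y\<in>V. kG x y * f y) = (\<Sum>y\<in>V. if y \<in> nb x then f y / 3 else 0)"
    by (intro sum.cong) (auto simp: kG_def)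
  also have "\<dots> = (\<Sum>y\<in>nb x. f y / 3)"
    using fin_V(1) nb by (simp add: sum.inter_restrict[symmetric])
  finally show ?thesis by (simp add: nsum_def sum_divide_distrib)
qed

lemma app_kG: "x \<in> V \<Longrightarrow> kapp V kG f x = nsum f x / 3"
  by (simp add: kapp_def sum_kG)

lemma nsum_const: "x \<in> V \<Longrightarrow> nsum (\<lambda>_. c) x = 3 * c"
  by (simp add: nsum_def card_nb)

sublocale G: stoch_kernel V kG
proof
  show "(\<Sum>y\<in>V. kG x y) = 1" if "x \<in> V" for x
    using sum_kG[OF that, of "\<lambda>_. 1"] nsum_const[OF that, of 1] by simp
qed (auto simp: fin_V kG_nonneg kG_sym)

text \<open>With row sums possibly below 1, this is the walk killed on leaving
  \<open>B\<close>.\<close>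

sublocale Q: sym_kernel B kG
  using B_sub by unfold_locales (auto simp: fin_B kG_nonneg intro: kG_sym)

lemma sum_B_kG_le: "x \<in> V \<Longrightarrow> (\<Sum>y\<in>B. kG x y) \<le> 1"
  using G.k_sum[of x] sum_mono2[OF fin_V(1) B_sub, of "kG x"] kG_nonneg by auto

sublocale KB: stoch_kernel B kB
proof
  fix x y assume xy: "x \<in> B" "y \<in> B"
  then have V: "x \<in> V" "y \<in> V" using B_sub by auto
  show "kB x y = kB y x" using kG_sym[OF V] by (auto simp: kB_def)
  show "kB x y \<ge> 0" using kG_nonneg[of x y] sum_B_kG_le[OF V(1)] by (auto simp: kB_def)
next
  fix x assume "x \<in> B"
  then show "(\<Sum>y\<in>B. kB x y) = 1" using fin_B by (simp add: kB_def sum.distrib)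
qed (rule fin_B)

lemma app_kB: "x \<in> B \<Longrightarrow> kapp B kB f x = nsum (\<lambda>y. if y \<in> B then f y else f x) x / 3"
proof -
  assume x: "x \<in> B"
  then have xV: "x \<in> V" using B_sub by auto
  have s: "(\<Sum>y\<in>V. kG x y * h y) = (\<Sum>y\<in>B. kG x y * h y) + (\<Sum>y\<in>V - B. kG x y * h y)" for h
    using B_sub fin_V by (simp add: sum.subset_diff add.commute)
  have "kapp B kB f x = (\<Sum>y\<in>B. kG x y * f y + (if x = y then (1 - (\<Sum>z\<in>B. kG x z)) * f y else 0))"
    unfolding kapp_def kB_def by (intro sum.cong) (auto simp: algebra_simps)
  also have "\<dots> = (\<Sum>y\<in>B. kG x y * f y) + (1 - (\<Sum>z\<in>B. kG x z)) * f x"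
    using x fin_B by (simp add: sum.distrib)
  also have "1 - (\<Sum>z\<in>B. kG x z) = (\<Sum>z\<in>V - B. kG x z)"
    using s[of "\<lambda>_. 1"] G.k_sum[OF xV] by simp
  also have "(\<Sum>y\<in>B. kG x y * f y) + (\<Sum>z\<in>V - B. kG x z) * f x
      = (\<Sum>y\<in>V. kG x y * (if y \<in> B then f y else f x))"
    by (simp add: s sum_distrib_right)
  finally show ?thesis by (simp add: sum_kG[OF xV])
qed

lemma nsum_mono: "(\<And>y. y \<in> nb x \<Longrightarrow> f y \<le> g y) \<Longrightarrow> nsum f x \<le> nsum g x"
  unfolding nsum_def by (rule sum_mono)

text \<open>In \<open>B\<close> every level above the clouds branches, so the function
  \<open>(2/3) ^ lev x\<close> has neighbourhood sum at most 3/2 + 2 * 2/3 = 17/6 times its value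
  and shrinks by 17/18 per step. No stretched level is involved, so \<open>M\<close> does not
  occur.\<close>

lemma gap_B:
  assumes "(\<Sum>x\<in>B. f x) = 0" "\<sigma> = 1 \<or> \<sigma> = -1"
  shows "KB.ip f f \<le> gB * KB.en \<sigma> f"
proof -
  let ?\<phi> = "\<lambda>x. (2/3::real) ^ lev x"
  have k: "kB x y \<ge> 1/3" if "x \<in> VC" "y \<in> VC" "y \<in> nb x" for x y
    using that nb_irrefl[of x] VC_sub by (auto simp: kB_def kG_def)
  have up: "(2/3::real) ^ (l - 1) \<le> 3/2 * (2/3) ^ l" for l by (cases l) auto
  have "KB.ip f f \<le> ((1 + (3/2 - 1) * 2000000) / (1/18) + 2000000) * KB.en \<sigma> f"
  proof (rule KB.gap_extend[OF VC_sub_B, where \<phi> = ?\<phi>])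
    fix x assume "x \<in> B - VC"
    then obtain l a where x: "x = Tr l a" "l < L" "H \<le> l" "x \<in> B"
      by (cases x) (auto simp: B_def)
    have "nsum (\<lambda>y. if y \<in> B then ?\<phi> y else ?\<phi> x) x
        \<le> nsum (\<lambda>y. if lev y < l then 3/2 * (2/3) ^ l else ?\<phi> y) x"
    proof (rule nsum_mono)
      fix y assume y: "y \<in> nb x"
      have "y \<in> V" using y nb_V x B_sub by blast
      moreover have "?\<phi> y \<le> 3/2 * (2/3) ^ l" if "lev y < l"
      proof -
        have "lev y = l - 1" using y that x br_ge[of l] by (auto simp: lev_node lev_up split: if_splits)
        then show ?thesis using up by simp
      qed
      ultimately show "(if y \<in> B then ?\<phi> y else ?\<phi> x) \<le> (if lev y < l then 3/2 * (2/3) ^ l else ?\<phi> y)"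
        using x by (auto simp: B_def)
    qed
    also have "\<dots> \<le> (17/6) * (2/3) ^ l"
      using x br_ge[of l] by (subst x(1), subst nsum_Tr) (auto simp: lev_node lev_up)
    finally show "kapp B kB ?\<phi> x \<le> (1 - 1/18) * ?\<phi> x"
      using x(4) by (simp add: app_kB) (simp add: x(1))
  next
    fix x assume xC: "x \<in> VC"
    then obtain v p where x: "x = Cl v p" "p < 5" "v < 2 ^ b L" by (cases x) auto
    have "nsum (\<lambda>y. if y \<in> B then ?\<phi> y else ?\<phi> x) x \<le> nsum (\<lambda>y. 3/2 * (2/3) ^ L) x"
    proof (rule nsum_mono)
      fix y assume y: "y \<in> nb x"
      have "lev y = L \<or> lev y = L - 1" using y x by (auto simp: ext_def lev_up split: if_splits)
      then have "?\<phi> y \<le> 3/2 * (2/3) ^ L" using up[of L] by auto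
      then show "(if y \<in> B then ?\<phi> y else ?\<phi> x) \<le> 3/2 * (2/3) ^ L" using x by auto
    qed
    also have "\<dots> = 3 * (3/2 * (2/3) ^ L)" using xC VC_sub by (intro nsum_const) auto
    finally have n: "nsum (\<lambda>y. if y \<in> B then ?\<phi> y else ?\<phi> x) x \<le> 3 * (3/2 * (2/3) ^ L)" .
    have "x \<in> B" using xC VC_sub_B by blast
    from app_kB[OF this, of ?\<phi>] n show "kapp B kB ?\<phi> x \<le> 3/2 * ?\<phi> x"
      by (simp add: x(1))
  qed (use assms cloud_gap[OF KB.stoch_kernel_axioms VC_sub_B k]
      cloud_gap_odd[OF KB.stoch_kernel_axioms VC_sub_B k] in auto)
  then show ?thesis by (simp add: gB_def)
qed

lemma kB_pow_l1:
  assumes "(\<Sum>x\<in>B. f x) = 0"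
  shows "(\<Sum>x\<in>B. \<bar>(kapp B kB ^^ t) f x\<bar>) \<le> lamB ^ t * sqrt (card B * KB.ip f f)"
proof -
  have "gB \<ge> 1" by (simp add: gB_def)
  then have "KB.ip ((kapp B kB ^^ t) f) ((kapp B kB ^^ t) f) \<le> (lamB ^ t)\<^sup>2 * KB.ip f f"
    unfolding lamB_def using gap_B assms by (rule KB.contraction_pow)
  then have "sqrt (card B * KB.ip ((kapp B kB ^^ t) f) ((kapp B kB ^^ t) f))
      \<le> sqrt ((lamB ^ t)\<^sup>2 * (card B * KB.ip f f))"
    by (intro real_sqrt_le_mono) (simp add: mult.left_commute mult_left_mono)
  also have "\<dots> = lamB ^ t * sqrt (card B * KB.ip f f)"
    by (simp add: real_sqrt_mult lamB_def gB_def)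
  finally show ?thesis using KB.l1_le_l2 order_trans by blast
qed

section \<open>A level function with drift 1\<close>

primrec del :: "nat \<Rightarrow> real" where
  "del 0 = 3/2"
| "del (Suc l) = (if br (Suc l) then (3 + del l) / 2 else del l + 3)"

text \<open>The recursion for \<open>del\<close> is the condition that \<open>D\<close> has drift
  exactly 1 in the tree (\<open>D_drift\<close>); thus \<open>D l\<close>, for
  \<open>l \<le> L\<close>, is the expected time to reach level \<open>l\<close> from level
  0.\<close>

definition D :: "nat \<Rightarrow> real" where "D l = (\<Sum>i<l. del i)"

definition K :: real where "K = 6 * M + 3"

lemma D_Suc: "D (Suc l) = D l + del l" by (simp add: D_def)
lemma D_0: "D 0 = 0" by (simp add: D_def)

lemma K_pos: "K \<ge> 3" by (simp add: K_def)

lemma del_ge: "del l \<ge> 3/2" by (induction l) auto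

text \<open>An unbranched level adds 3 to \<open>del\<close>, at most \<open>M - 1\<close> times in
  a row, and a branching averages it with 3; a value up to \<open>6 * M + 3\<close> therefore drops
  to \<open>3 * M + 3\<close> before it can grow again.\<close>

lemma del_le_aux: "del l \<le> K \<and> (l < H \<longrightarrow> del l \<le> 3 * M + 3 + 3 * (l mod M))"
proof (induction l)
  case (Suc l)
  show ?case
  proof (cases "br (Suc l)")
    case True
    then show ?thesis using Suc by (auto simp: K_def)
  next
    case False
    then have "Suc l < H" "\<not> M dvd Suc l" by (auto simp: br_def)
    then have m: "Suc l mod M = Suc (l mod M)" by (metis mod_Suc dvd_eq_mod_eq_0)
    have "Suc l mod M < M" using M by simp
    then have "real (Suc l mod M) \<le> M - 1" by linarith
    then show ?thesis using Suc False \<open>Suc l < H\<close> m by (auto simp: K_def)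
  qed
qed (use M in \<open>auto simp: K_def\<close>)

lemma del_le: "del l \<le> K" using del_le_aux by blast

lemma del_mod: "l < H \<Longrightarrow> del l \<ge> 3 * (l mod M)"
proof (induction l)
  case (Suc l)
  show ?case
  proof (cases "br (Suc l)")
    case True
    then have "M dvd Suc l" using Suc by (auto simp: br_def)
    then show ?thesis using del_ge[of "Suc l"] by (simp add: dvd_eq_mod_eq_0)
  next
    case False
    have "real (Suc l mod M) \<le> Suc (l mod M)" by (simp add: mod_Suc)
    then show ?thesis using False Suc by auto
  qed
qed simp

lemma D_mono: "l \<le> l' \<Longrightarrow> D l \<le> D l'"
  by (rule lift_Suc_mono_le) (use del_ge in \<open>auto simp: D_Suc intro: order_trans[of 0 "3/2"]\<close>)

lemma D_nonneg: "D l \<ge> 0" using D_mono[of 0 l] by (simp add: D_0)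

lemma D_add: "D l + 3/2 * j \<le> D (l + j)"
proof (induction j)
  case (Suc j)
  have "3/2 * real (Suc j) = 3/2 * j + 3/2" by simp
  then show ?case using Suc del_ge[of "l + j"] unfolding add_Suc_right D_Suc by linarith
qed simp

lemma D_add_le: "D (l + j) \<le> D l + K * j"
proof (induction j)
  case (Suc j)
  then show ?case using del_le[of "l + j"] by (simp add: D_Suc algebra_simps)
qed simp

lemma D_nb: "x \<in> V \<Longrightarrow> y \<in> nb x \<Longrightarrow> \<bar>D (lev y) - D (lev x)\<bar> \<le> K"
proof -
  assume xy: "x \<in> V" "y \<in> nb x"
  have "lev y = lev x \<or> lev y = Suc (lev x) \<or> Suc (lev y) = lev x"
  proof (cases x)
    case (Tr l a)
    then show ?thesis using xy by (auto simp: lev_node lev_up split: if_splits)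
  next
    case (Cl v p)
    then show ?thesis using xy L_pos by (auto simp: ext_def lev_up split: if_splits)
  qed
  then show ?thesis using del_ge[of "lev x"] del_le[of "lev x"] del_ge[of "lev y"] del_le[of "lev y"] K_pos
      D_Suc[of "lev x"] D_Suc[of "lev y"] by auto
qed

lemma D_drift: "l < L \<Longrightarrow> nsum (\<lambda>x. D (lev x)) (Tr l a) = 3 * D l + 3"
  by (cases l) (auto simp: nsum_lev_Tr D_Suc D_0 br_0)

section \<open>Exponential moments and hitting times\<close>

definition psi :: "real \<Rightarrow> vert \<Rightarrow> real" where "psi c x = exp (c * D (lev x))"

lemma exp_quadratic: "\<bar>z\<bar> \<le> 1 \<Longrightarrow> exp z \<le> 1 + z + z\<^sup>2" for z :: real
proof (cases "z \<ge> 0")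
  case True
  assume "\<bar>z\<bar> \<le> 1"
  then show ?thesis using True exp_bound by simp
next
  case False
  assume "\<bar>z\<bar> \<le> 1"
  then have y: "0 \<le> -z" "-z \<le> 1" using False by auto
  have "1 \<le> exp (-z) * (1 + z + z\<^sup>2)"
  proof -
    have "1 \<le> (1 + (-z)) * (1 + z + z\<^sup>2)"
    proof -
      have "z * (z * z) \<le> 0" using y by (intro mult_nonpos_nonneg) auto
      then show ?thesis by (simp add: power2_eq_square algebra_simps)
    qed
    also have "\<dots> \<le> exp (-z) * (1 + z + z\<^sup>2)"
      using y exp_ge_add_one_self[of "-z"] by (intro mult_right_mono) auto
    finally show ?thesis .
  qed
  then show ?thesis by (simp add: exp_minus field_simps)
qed

text \<open>Second-order expansion of the exponential: the drift contributes \<open>c\<close>, and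
  \<open>K\<close> bounds the increments of \<open>D\<close>, whence the error
  \<open>c\<^sup>2 * K\<^sup>2\<close>.\<close>

lemma psi_Tr:
  assumes "l < L" "a < 2 ^ b l" and c: "\<bar>c\<bar> * K \<le> 1"
  shows "kapp V kG (psi c) (Tr l a) \<le> (1 + c + c\<^sup>2 * K\<^sup>2) * psi c (Tr l a)"
proof -
  let ?x = "Tr l a"
  have x: "?x \<in> V" using assms by simp
  have "nsum (psi c) ?x \<le> nsum (\<lambda>y. psi c ?x * ((1 + c\<^sup>2 * K\<^sup>2 - c * D l) + c * D (lev y))) ?x"
  proof (rule nsum_mono)
    fix y assume y: "y \<in> nb ?x"
    define d where "d = D (lev y) - D l"
    have d: "\<bar>d\<bar> \<le> K" using D_nb[OF x y] by (simp add: d_def)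
    have "\<bar>c * d\<bar> \<le> \<bar>c\<bar> * K" unfolding abs_mult using d by (intro mult_left_mono) auto
    then have "exp (c * d) \<le> 1 + c * d + (c * d)\<^sup>2" using c by (intro exp_quadratic) simp
    also have "(c * d)\<^sup>2 \<le> c\<^sup>2 * K\<^sup>2"
      unfolding power_mult_distrib using d K_pos abs_le_square_iff[of d K] by (intro mult_left_mono) auto
    finally have "exp (c * d) \<le> (1 + c\<^sup>2 * K\<^sup>2 - c * D l) + c * D (lev y)" by (simp add: d_def algebra_simps)
    moreover have "psi c y = psi c ?x * exp (c * d)"
      by (simp add: psi_def d_def algebra_simps flip: exp_add)
    ultimately show "psi c y \<le> psi c ?x * ((1 + c\<^sup>2 * K\<^sup>2 - c * D l) + c * D (lev y))"
      by (simp add: psi_def)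
  qed
  also have "\<dots> = psi c ?x * (nsum (\<lambda>y. 1 + c\<^sup>2 * K\<^sup>2 - c * D l) ?x + c * nsum (\<lambda>y. D (lev y)) ?x)"
    unfolding nsum_def by (simp add: sum.distrib sum_distrib_left distrib_left)
  also have "\<dots> = psi c ?x * (3 * (1 + c\<^sup>2 * K\<^sup>2 - c * D l) + c * (3 * D l + 3))"
    using assms by (simp only: nsum_const[OF x] D_drift)
  finally show ?thesis by (simp add: app_kG[OF x] algebra_simps)
qed

lemma psi_Cl_neg:
  assumes "v < 2 ^ b L" "p < 5" and c: "0 \<le> \<theta>" "\<theta> * K \<le> 1"
  shows "kapp V kG (psi (-\<theta>)) (Cl v p) \<le> 3 * psi (-\<theta>) (Cl v p)"
proof -
  let ?x = "Cl v p"
  have x: "?x \<in> V" using assms by simp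
  have "nsum (psi (-\<theta>)) ?x \<le> nsum (\<lambda>y. 3 * psi (-\<theta>) ?x) ?x"
  proof (rule nsum_mono)
    fix y assume y: "y \<in> nb ?x"
    have "D (lev ?x) - D (lev y) \<le> K" using D_nb[OF x y] by simp
    then have "\<theta> * (D (lev ?x) - D (lev y)) \<le> \<theta> * K" using c by (intro mult_left_mono)
    then have "-\<theta> * D (lev y) \<le> 1 + -\<theta> * D (lev ?x)" using c by (simp add: algebra_simps)
    then have "psi (-\<theta>) y \<le> exp 1 * psi (-\<theta>) ?x"
      unfolding psi_def exp_add[symmetric] by simp
    also have "\<dots> \<le> 3 * psi (-\<theta>) ?x" using exp_le by (simp add: psi_def)
    finally show "psi (-\<theta>) y \<le> 3 * psi (-\<theta>) ?x" .
  qed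
  then show ?thesis by (simp add: app_kG[OF x] nsum_const[OF x])
qed

lemma psi_Cl_pos:
  assumes "v < 2 ^ b L" "p < 5" and c: "0 \<le> \<theta>"
  shows "kapp V kG (psi \<theta>) (Cl v p) \<le> psi \<theta> (Cl v p)"
proof -
  let ?x = "Cl v p"
  have x: "?x \<in> V" using assms by simp
  have "nsum (psi \<theta>) ?x \<le> nsum (\<lambda>y. psi \<theta> ?x) ?x"
  proof (rule nsum_mono)
    fix y assume y: "y \<in> nb ?x"
    have "D (lev y) \<le> D L" using nb_V[OF x] y lev_le by (intro D_mono) auto
    then show "psi \<theta> y \<le> psi \<theta> ?x" using c by (simp add: psi_def mult_left_mono)
  qed
  then show ?thesis by (simp add: app_kG[OF x] nsum_const[OF x])
qed

lemma V_cases: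
  assumes "x \<in> V"
  obtains l a where "x = Tr l a" "l < L" "a < 2 ^ b l" | v p where "x = Cl v p" "v < 2 ^ b L" "p < 5"
  using assms by (cases x) auto

text \<open>Markov's inequality for \<open>psi (-\<theta>)\<close>, whose mean decays geometrically
  as long as the walk is in the tree. In the clouds it may grow, but there it equals
  \<open>exp (- \<theta> * D L)\<close>, so this costs at most 3 times that amount per step.\<close>

lemma hit_late:
  assumes \<theta>: "0 < \<theta>" "\<theta> * K\<^sup>2 \<le> 1" and x: "x \<in> V" and A: "A \<subseteq> V" "\<And>z. z \<in> A \<Longrightarrow> lev z \<le> j"
  shows "(\<Sum>z\<in>A. G.pw s x z) \<le> ((1 - \<theta> + \<theta>\<^sup>2 * K\<^sup>2) ^ s * exp (- \<theta> * D (lev x)) + 3 * real s * exp (- \<theta> * D L)) * exp (\<theta> * D j)"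
proof -
  have tK: "\<theta> * K \<le> 1"
  proof -
    have "K \<le> K\<^sup>2" using K_pos by (simp add: power2_eq_square)
    then have "\<theta> * K \<le> \<theta> * K\<^sup>2" using \<theta> by (intro mult_left_mono) auto
    then show ?thesis using \<theta> by linarith
  qed
  define \<rho> where "\<rho> = 1 - \<theta> + \<theta>\<^sup>2 * K\<^sup>2"
  have tt: "\<theta>\<^sup>2 * K\<^sup>2 \<le> \<theta>" using \<theta> mult_left_mono[OF \<theta>(2), of \<theta>] by (simp add: power2_eq_square mult_ac)
  have "\<theta> * K \<ge> \<theta> * 3" using \<theta> K_pos by (intro mult_left_mono) auto
  then have "\<theta> \<le> 1" using tK by linarith
  moreover have "0 \<le> \<theta>\<^sup>2 * K\<^sup>2" by simp
  ultimately have \<rho>: "0 \<le> \<rho>" "\<rho> \<le> 1" unfolding \<rho>_def using tt by linarith+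
  have step: "kapp V kG (psi (-\<theta>)) y \<le> \<rho> * psi (-\<theta>) y + 3 * exp (- \<theta> * D L)" if "y \<in> V" for y
    using that
  proof (cases rule: V_cases)
    case (1 l a)
    then show ?thesis using psi_Tr[of l a "-\<theta>"] \<theta> tK by (simp add: \<rho>_def add_increasing2)
  next
    case (2 v p)
    have "0 \<le> \<rho> * psi (-\<theta>) y" using \<rho> by (simp add: psi_def)
    then show ?thesis using psi_Cl_neg[of v p \<theta>] 2 \<theta> tK by (simp add: psi_def)
  qed
  have "(kapp V kG ^^ s) (psi (-\<theta>)) x \<le> \<rho> ^ s * psi (-\<theta>) x + s * (3 * exp (- \<theta> * D L))"
    by (rule G.app_pow_add_le[OF step \<rho>]) (auto simp: G.k_sum x)
  then have *: "(\<Sum>z\<in>V. G.pw s x z * psi (-\<theta>) z) \<le> \<rho> ^ s * exp (- \<theta> * D (lev x)) + 3 * real s * exp (- \<theta> * D L)"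
    by (simp add: G.app_pow_eq[OF x] psi_def mult_ac)
  have "(\<Sum>z\<in>A. G.pw s x z) \<le> (\<Sum>z\<in>A. G.pw s x z * psi (-\<theta>) z * exp (\<theta> * D j))"
  proof (intro sum_mono)
    fix z assume "z \<in> A"
    then have "1 \<le> psi (-\<theta>) z * exp (\<theta> * D j)"
      using \<theta> D_mono[OF A(2)] by (simp add: psi_def flip: exp_add)
    then show "G.pw s x z \<le> G.pw s x z * psi (-\<theta>) z * exp (\<theta> * D j)"
      using mult_left_mono[OF _ G.pw_nonneg[OF x, of s z]] by (fastforce simp: mult.assoc)
  qed
  also have "\<dots> = (\<Sum>z\<in>A. G.pw s x z * psi (-\<theta>) z) * exp (\<theta> * D j)" by (simp add: sum_distrib_right)
  also have "\<dots> \<le> (\<Sum>z\<in>V. G.pw s x z * psi (-\<theta>) z) * exp (\<theta> * D j)"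
    using A G.pw_nonneg[OF x] by (intro mult_right_mono sum_mono2) (auto simp: fin_V psi_def)
  also have "\<dots> \<le> (\<rho> ^ s * exp (- \<theta> * D (lev x)) + 3 * real s * exp (- \<theta> * D L)) * exp (\<theta> * D j)"
    using * by (intro mult_right_mono) auto
  finally show ?thesis by (simp add: \<rho>_def)
qed

text \<open>Markov's inequality for \<open>psi \<theta>\<close>. Its growth rate in the tree also
  covers the clouds, where \<open>D\<close> is maximal and the mean cannot increase.\<close>

lemma hit_early:
  assumes \<theta>: "0 < \<theta>" "\<theta> * K \<le> 1" and x: "x \<in> V"
  shows "(\<Sum>z\<in>B. G.pw s x z) \<le> (1 + \<theta> + \<theta>\<^sup>2 * K\<^sup>2) ^ s * exp (\<theta> * D (lev x) - \<theta> * D H)"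
proof -
  define \<rho> where "\<rho> = 1 + \<theta> + \<theta>\<^sup>2 * K\<^sup>2"
  have \<rho>: "\<rho> \<ge> 1" using \<theta> by (simp add: \<rho>_def)
  have step: "kapp V kG (psi \<theta>) y \<le> \<rho> * psi \<theta> y" if "y \<in> V" for y
    using that
  proof (cases rule: V_cases)
    case (1 l a)
    then show ?thesis using psi_Tr[of l a \<theta>] \<theta> by (simp add: \<rho>_def)
  next
    case (2 v p)
    have "psi \<theta> y \<le> \<rho> * psi \<theta> y" using \<rho> by (simp add: psi_def)
    then show ?thesis using psi_Cl_pos[of v p \<theta>] 2 \<theta> by simp
  qed
  have it: "(kapp V kG ^^ s) (psi \<theta>) y \<le> \<rho> ^ s * psi \<theta> y" if "y \<in> V" for y
    using that
  proof (induction s arbitrary: y)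
    case (Suc s)
    have "(kapp V kG ^^ Suc s) (psi \<theta>) y \<le> kapp V kG (\<lambda>z. \<rho> ^ s * psi \<theta> z) y"
      using Suc by (auto intro: G.app_mono)
    also have "\<dots> = \<rho> ^ s * kapp V kG (psi \<theta>) y" by (simp add: kapp_cmult)
    also have "\<dots> \<le> \<rho> ^ s * (\<rho> * psi \<theta> y)" using step Suc \<rho> by (intro mult_left_mono) auto
    finally show ?case by (simp add: mult_ac)
  qed simp
  have *: "(\<Sum>z\<in>V. G.pw s x z * psi \<theta> z) \<le> \<rho> ^ s * exp (\<theta> * D (lev x))"
    using it[OF x] by (simp add: G.app_pow_eq[OF x] psi_def)
  have "(\<Sum>z\<in>B. G.pw s x z) \<le> (\<Sum>z\<in>B. G.pw s x z * psi \<theta> z * exp (- \<theta> * D H))"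
  proof (intro sum_mono)
    fix z assume "z \<in> B"
    then have "1 \<le> psi \<theta> z * exp (- \<theta> * D H)"
      using \<theta> D_mono[of H "lev z"] by (simp add: psi_def B_def flip: exp_add)
    then show "G.pw s x z \<le> G.pw s x z * psi \<theta> z * exp (- \<theta> * D H)"
      using mult_left_mono[OF _ G.pw_nonneg[OF x, of s z]] by (fastforce simp: mult.assoc)
  qed
  also have "\<dots> = (\<Sum>z\<in>B. G.pw s x z * psi \<theta> z) * exp (- \<theta> * D H)" by (simp add: sum_distrib_right)
  also have "\<dots> \<le> (\<Sum>z\<in>V. G.pw s x z * psi \<theta> z) * exp (- \<theta> * D H)"
    using B_sub G.pw_nonneg[OF x] by (intro mult_right_mono sum_mono2) (auto simp: fin_V psi_def)
  also have "\<dots> \<le> \<rho> ^ s * exp (\<theta> * D (lev x)) * exp (- \<theta> * D H)"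
    using * by (intro mult_right_mono) auto
  also have "\<dots> = \<rho> ^ s * exp (\<theta> * D (lev x) - \<theta> * D H)" by (simp add: exp_diff exp_minus field_simps)
  finally show ?thesis by (simp add: \<rho>_def)
qed


section \<open>A nearly superharmonic function: density and escape estimates\<close>

definition eps :: real where "eps = (1/2) ^ b L"
text \<open>The potential of a unit current from the roots to the clouds: each drop is 1 over the
  number of edges between two consecutive levels. The offset \<open>eps\<close> makes
  \<open>g l\<close> exactly \<open>(1/2) ^ b l\<close> on the unstretched levels.\<close>

definition g :: "nat \<Rightarrow> real" where "g l = eps + (\<Sum>i=l..<L. (1/2) ^ b (Suc i))"

lemma eps_pos: "eps > 0" by (simp add: eps_def)

lemma g_Suc: "l < L \<Longrightarrow> g l = g (Suc l) + (1/2) ^ b (Suc l)"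
  by (simp add: g_def sum.atLeast_Suc_lessThan)

lemma g_L: "g L = eps" by (simp add: g_def)

lemma g_pos: "g l > 0" unfolding g_def using eps_pos by (intro add_pos_nonneg sum_nonneg) auto

lemma g_antimono: "l \<le> l' \<Longrightarrow> l' \<le> L \<Longrightarrow> g l' \<le> g l"
  unfolding g_def by (intro add_left_mono sum_mono2) auto

lemma g_ge: "l \<le> L \<Longrightarrow> g l \<ge> (1/2) ^ (b l + 1)"
proof (cases "l = L")
  case False
  assume "l \<le> L"
  have "(1/2::real) ^ (b l + 1) \<le> (1/2) ^ b (Suc l)" by (intro power_decreasing) (auto simp: b_Suc)
  also have "\<dots> \<le> g l" using g_Suc[of l] g_pos[of "Suc l"] False \<open>l \<le> L\<close> by simp
  finally show ?thesis .
qed (simp add: g_L eps_def)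

lemma g_bottom: "H \<le> l \<Longrightarrow> l \<le> L \<Longrightarrow> g l = (1/2) ^ b l"
proof (induction "L - l" arbitrary: l)
  case 0
  then have "l = L" by simp
  then show ?case by (simp only: g_L eps_def)
next
  case (Suc n)
  then have "g (Suc l) = (1/2) ^ b (Suc l)" by (intro Suc(1)) auto
  then show ?case using Suc by (simp add: g_Suc b_Suc br_ge)
qed

text \<open>Equal currents in and out make \<open>g\<close> harmonic at the inner levels; at the
  roots it is superharmonic, and a cloud vertex can gain at most \<open>eps\<close> from its tree
  neighbour, as \<open>g (L - 1) = 2 * eps\<close>.\<close>

lemma app_g:
  assumes "x \<in> V"
  shows "kapp V kG (\<lambda>y. g (lev y)) x \<le> g (lev x) + eps"
  using assms
proof (cases rule: V_cases)
  case (1 l a)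
  have "nsum (\<lambda>y. g (lev y)) x \<le> 3 * g l"
  proof (cases l)
    case 0
    then show ?thesis using 1 g_antimono[of 0 1] by (simp add: nsum_lev_Tr)
  next
    case (Suc l')
    then show ?thesis using 1 g_Suc[of l'] g_Suc[of "Suc l'"] by (simp add: nsum_lev_Tr b_Suc)
  qed
  then show ?thesis using 1 eps_pos app_kG[OF assms, of "\<lambda>y. g (lev y)"] by simp
next
  case (2 v p)
  have "g (L - 1) = 2 * eps" using g_Suc[of "L - 1"] L_pos by (simp add: g_L eps_def)
  then have "nsum (\<lambda>y. g (lev y)) x \<le> 3 * (g L + eps)"
    using 2 eps_pos by (simp add: nsum_lev_Cl g_L)
  then show ?thesis using 2 app_kG[OF assms, of "\<lambda>y. g (lev y)"] by simp
qed

lemma app_pow_g: "x \<in> V \<Longrightarrow> (kapp V kG ^^ t) (\<lambda>y. g (lev y)) x \<le> g (lev x) + t * eps"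
  using G.app_pow_add_le[of "\<lambda>y. g (lev y)" 1 eps x t] app_g eps_pos by (simp add: G.k_sum)

text \<open>Reversing time by symmetry turns the density at \<open>y\<close> into one summand of the
  expectation of \<open>g\<close> for the walk from \<open>y\<close>.\<close>

lemma pw_le:
  assumes "x \<in> V" "y \<in> V"
  shows "G.pw s x y * g (lev x) \<le> g (lev y) + s * eps"
proof -
  have "G.pw s x y * g (lev x) = G.pw s y x * g (lev x)" using G.pw_sym assms by metis
  also have "\<dots> \<le> (\<Sum>z\<in>V. G.pw s y z * g (lev z))"
    using assms fin_V G.pw_nonneg g_pos
    by (intro member_le_sum[where f = "\<lambda>z. G.pw s y z * g (lev z)"]) (auto intro!: mult_nonneg_nonneg simp: less_imp_le)
  also have "\<dots> = (kapp V kG ^^ s) (\<lambda>y. g (lev y)) y" by (simp add: G.app_pow_eq[OF assms(2)])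
  also have "\<dots> \<le> g (lev y) + s * eps" by (rule app_pow_g[OF assms(2)])
  finally show ?thesis .
qed

text \<open>Optional stopping on leaving \<open>B\<close>, where \<open>g\<close> is at least
  \<open>g H\<close>. The iterated killed kernel applied to 1 is the probability of surviving
  \<open>t\<close> steps.\<close>

lemma leak:
  assumes "x \<in> B"
  shows "(1 - (kapp B kG ^^ t) (\<lambda>_. 1) x) * g H \<le> g (lev x) + t * eps"
  using assms
proof (induction t arbitrary: x)
  case 0
  then show ?case using g_pos[of "lev x"] by simp
next
  case (Suc t)
  have x: "x \<in> V" using Suc B_sub by auto
  let ?u = "\<lambda>t y. (1 - (kapp B kG ^^ t) (\<lambda>_. 1) y) * g H"
  have "?u (Suc t) x = (\<Sum>y\<in>V. kG x y) * g H - (\<Sum>y\<in>B. kG x y * (kapp B kG ^^ t) (\<lambda>_. 1) y) * g H"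
    by (simp add: G.k_sum[OF x] kapp_def algebra_simps)
  also have "(\<Sum>y\<in>V. kG x y) = (\<Sum>y\<in>B. kG x y) + (\<Sum>y\<in>V - B. kG x y)"
    using B_sub fin_V by (simp add: sum.subset_diff add.commute)
  also have "((\<Sum>y\<in>B. kG x y) + (\<Sum>y\<in>V - B. kG x y)) * g H
        - (\<Sum>y\<in>B. kG x y * (kapp B kG ^^ t) (\<lambda>_. 1) y) * g H
      = (\<Sum>y\<in>B. kG x y * ?u t y) + (\<Sum>y\<in>V - B. kG x y * g H)"
    by (simp add: sum_distrib_right sum_distrib_left sum_subtractf algebra_simps)
  also have "\<dots> \<le> (\<Sum>y\<in>B. kG x y * (g (lev y) + t * eps)) + (\<Sum>y\<in>V - B. kG x y * (g (lev y) + t * eps))"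
  proof (intro add_mono sum_mono mult_left_mono kG_nonneg)
    fix y assume "y \<in> V - B"
    then have "g H \<le> g (lev y)" by (intro g_antimono) (auto simp: B_def L_def)
    then show "g H \<le> g (lev y) + t * eps" using eps_pos by (simp add: add_increasing2)
  qed (use Suc in auto)
  also have "\<dots> = (\<Sum>y\<in>V. kG x y * (g (lev y) + t * eps))"
    using B_sub fin_V by (simp add: sum.subset_diff add.commute)
  also have "\<dots> = kapp V kG (\<lambda>y. g (lev y)) x + t * eps"
    by (simp add: kapp_def distrib_left sum.distrib G.k_sum[OF x] flip: sum_distrib_right)
  also have "\<dots> \<le> g (lev x) + Suc t * eps"
    using app_g[OF x] by (simp add: algebra_simps)
  finally show ?case by simp
qed

section \<open>Bounds on the total variation distance\<close>

definition TV :: "nat \<Rightarrow> vert \<Rightarrow> real" where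
  "TV t x = 1/2 * (\<Sum>y\<in>V. \<bar>G.pw t x y - 1 / card V\<bar>)"

lemma V_nonempty: "V \<noteq> {}" "card V > 0"
proof -
  have "Cl 0 0 \<in> V" by simp
  then show "V \<noteq> {}" by blast
  then show "card V > 0" using fin_V by (simp add: card_gt_0_iff)
qed

text \<open>Only the deficit below the uniform density counts. An upper bound on the distance thus
  needs only lower bounds on transition probabilities, and a killed walk provides them.\<close>

lemma TV_pos_part:
  assumes "x \<in> V"
  shows "TV t x = (\<Sum>y\<in>V. max 0 (1 / card V - G.pw t x y))"
proof -
  have "(\<Sum>y\<in>V. 1 / card V - G.pw t x y) = 0"
    using V_nonempty by (simp add: sum_subtractf G.pw_sum[OF assms])
  moreover have "(\<Sum>y\<in>V. \<bar>G.pw t x y - 1 / card V\<bar>)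
      = (\<Sum>y\<in>V. 2 * max 0 (1 / card V - G.pw t x y) - (1 / card V - G.pw t x y))"
    by (intro sum.cong refl) (simp add: max_def)
  ultimately show ?thesis by (simp only: TV_def sum_subtractf sum_distrib_left[symmetric]) simp
qed

text \<open>\<open>B\<close> has almost all of the uniform mass; a walk that is unlikely to be there
  is far from uniform.\<close>

lemma TV_lower:
  assumes "x \<in> V"
  shows "TV s x \<ge> 1 - card (V - B) / card V - (\<Sum>z\<in>B. G.pw s x z)"
proof -
  have c: "card V = card B + card (V - B)"
    using B_sub fin_V fin_B by (simp add: card_Diff_subset card_mono)
  have "card B / card V + card (V - B) / card V = 1"
    using V_nonempty c by (simp add: add_divide_distrib[symmetric] flip: of_nat_add)
  then have "1 - card (V - B) / card V = card B / card V" by simp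
  moreover have "card B / card V - (\<Sum>z\<in>B. G.pw s x z) = (\<Sum>z\<in>B. 1 / card V - G.pw s x z)"
    by (simp add: sum_subtractf)
  moreover have "\<dots> \<le> (\<Sum>z\<in>B. max 0 (1 / card V - G.pw s x z))" by (intro sum_mono) auto
  moreover have "\<dots> \<le> TV s x"
    unfolding TV_pos_part[OF assms] using B_sub fin_V by (intro sum_mono2) auto
  ultimately show ?thesis by linarith
qed

lemma B_nonempty: "card B > 0"
proof -
  have "Cl 0 0 \<in> B" using VC_sub_B by auto
  then show ?thesis using fin_B by (auto simp: card_gt_0_iff)
qed

lemma app_B_le:
  assumes "\<And>z. z \<in> V \<Longrightarrow> 0 \<le> f z"
  shows "kapp B kG f y \<le> kapp V kG f y"
  unfolding kapp_def using B_sub fin_V assms kG_nonneg by (intro sum_mono2) auto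

lemma app_BB_le:
  assumes "\<And>z. z \<in> B \<Longrightarrow> 0 \<le> f z" and "y \<in> B"
  shows "kapp B kG f y \<le> kapp B kB f y"
  unfolding kapp_def using assms sum_B_kG_le[of y] B_sub
  by (intro sum_mono mult_right_mono) (auto simp: kB_def)

text \<open>The walk is run for \<open>s\<close> steps, to bring it close to the clouds, and then compared for \<open>t\<close>
  steps with the walk reflected in \<open>B\<close>, which has a spectral gap independent of \<open>M\<close>.\<close>

lemma TV_upper:
  fixes mx :: real
  assumes x: "x \<in> V" and B': "B' \<subseteq> B"
    and e1: "(\<Sum>z\<in>V - B'. G.pw s x z) \<le> e1"
    and e2: "\<And>z. z \<in> B' \<Longrightarrow> 1 - (kapp B kG ^^ t) (\<lambda>_. 1) z \<le> e2" and "0 \<le> e2"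
    and mx: "\<And>z. z \<in> B' \<Longrightarrow> G.pw s x z \<le> mx" and "0 \<le> mx"
  shows "TV (s + t) x \<le> card (V - B) / card V + e1 + e2 + lamB ^ t * sqrt (card B * mx)"
proof -
  \<comment> \<open>\<open>\<nu>\<close> is the part of the law after \<open>s\<close> steps that
    lies in \<open>B'\<close>, of total mass \<open>m\<close>; \<open>a\<close> and \<open>c\<close>
    evolve it with killing and with reflection.\<close>
  define \<nu> where "\<nu> z = (if z \<in> B' then G.pw s x z else 0)" for z
  define m where "m = (\<Sum>z\<in>B. \<nu> z)"
  define a where "a = (kapp B kG ^^ t) \<nu>"
  define c where "c = (kapp B kB ^^ t) \<nu>"
  have B'V: "B' \<subseteq> V" using B' B_sub by blast
  have \<nu>0: "\<nu> z \<ge> 0" for z using G.pw_nonneg[OF x] by (simp add: \<nu>_def)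
  have m: "m = (\<Sum>z\<in>B'. G.pw s x z)"
    unfolding m_def \<nu>_def using B' fin_B by (simp add: sum.inter_restrict[symmetric] Int_absorb1 Int_absorb2)
  have "m + (\<Sum>z\<in>V - B'. G.pw s x z) = 1"
    using B'V fin_V G.pw_sum[OF x, of s] m by (simp add: sum.subset_diff add.commute)
  then have m1: "1 - m \<le> e1" "m \<le> 1"
    using e1 sum_nonneg[of "V - B'" "G.pw s x"] G.pw_nonneg[OF x] by auto
  have m0: "m \<ge> 0" unfolding m_def using \<nu>0 by (intro sum_nonneg) auto
  have PQ: "a' y \<le> (kapp V kG ^^ t) f y"
    if "a' = (kapp B kG ^^ t) \<nu>" "y \<in> B" "\<And>z. z \<in> V \<Longrightarrow> \<nu> z \<le> f z" "\<And>z. z \<in> V \<Longrightarrow> 0 \<le> f z" for a' f y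
    unfolding that(1) using that(2)
  proof (induction t arbitrary: y)
    case 0
    then show ?case using that(3) B_sub by auto
  next
    case (Suc t)
    have "(kapp B kG ^^ Suc t) \<nu> y \<le> kapp B kG ((kapp V kG ^^ t) f) y"
      unfolding funpow.simps o_apply by (rule Q.app_mono[OF Suc(2) Suc(1)])
    also have "\<dots> \<le> kapp V kG ((kapp V kG ^^ t) f) y"
      using G.app_pow_nonneg[OF _ that(4)] by (rule app_B_le)
    finally show ?case by simp
  qed
  have low: "a y \<le> G.pw (s + t) x y" if y: "y \<in> B" for y
  proof -
    have yV: "y \<in> V" using y B_sub by auto
    have "a y \<le> (kapp V kG ^^ t) (\<lambda>z. G.pw s z x) y"
      by (rule PQ[OF a_def y]) (use G.pw_sym[OF x] G.pw_nonneg x in \<open>auto simp: \<nu>_def\<close>)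
    also have "\<dots> = G.pw (s + t) y x" unfolding kpow_def by (subst add.commute) (simp add: funpow_add)
    finally show ?thesis using G.pw_sym[OF x yV] by simp
  qed
  have ac: "a y \<le> c y" if "y \<in> B" for y
    unfolding a_def c_def using that
  proof (induction t arbitrary: y)
    case (Suc t)
    have "(kapp B kG ^^ Suc t) \<nu> y \<le> kapp B kG ((kapp B kB ^^ t) \<nu>) y"
      unfolding funpow.simps o_apply by (rule Q.app_mono[OF Suc(2) Suc(1)])
    also have "\<dots> \<le> kapp B kB ((kapp B kB ^^ t) \<nu>) y"
      using KB.app_pow_nonneg[OF _ \<nu>0] Suc(2) by (rule app_BB_le)
    finally show ?case by simp
  qed simp
  \<comment> \<open>By symmetry of the killed kernel, the lost mass is the average of the escape
    probabilities over \<open>\<nu>\<close>.\<close>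
  have loss: "(\<Sum>y\<in>B. c y - a y) \<le> e2"
  proof -
    have "(\<Sum>y\<in>B. a y) = Q.ip (\<lambda>_. 1) ((kapp B kG ^^ t) \<nu>)" by (simp add: Q.ip_def a_def)
    also have "\<dots> = Q.ip ((kapp B kG ^^ t) (\<lambda>_. 1)) \<nu>" by (rule Q.app_pow_sym)
    also have "\<dots> = (\<Sum>z\<in>B. (kapp B kG ^^ t) (\<lambda>_. 1) z * \<nu> z)" by (simp add: Q.ip_def)
    finally have "(\<Sum>y\<in>B. c y - a y) = (\<Sum>z\<in>B. (1 - (kapp B kG ^^ t) (\<lambda>_. 1) z) * \<nu> z)"
      by (simp add: sum_subtractf c_def KB.sum_app_pow algebra_simps)
    also have "\<dots> \<le> (\<Sum>z\<in>B. e2 * \<nu> z)"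
      using e2 \<nu>0 G.pw_nonneg[OF x] by (intro sum_mono) (auto simp: \<nu>_def intro!: mult_right_mono)
    also have "\<dots> = e2 * m" by (simp add: m_def sum_distrib_left)
    also have "\<dots> \<le> e2" using m1 \<open>0 \<le> e2\<close> by (simp add: mult_left_le)
    finally show ?thesis .
  qed
  have mix: "(\<Sum>y\<in>B. \<bar>c y - m / card B\<bar>) \<le> lamB ^ t * sqrt (card B * mx)"
  proof -
    let ?f = "\<lambda>z. \<nu> z - m / card B"
    have f0: "(\<Sum>z\<in>B. ?f z) = 0" using B_nonempty by (simp add: sum_subtractf m_def)
    have "c y - m / card B = (kapp B kB ^^ t) ?f y" if "y \<in> B" for y
      using KB.app_pow_const[OF that] by (simp add: c_def kapp_pow_diff)
    then have "(\<Sum>y\<in>B. \<bar>c y - m / card B\<bar>) \<le> lamB ^ t * sqrt (card B * KB.ip ?f ?f)"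
      using kB_pow_l1[OF f0, of t] by simp
    also have "KB.ip ?f ?f \<le> KB.ip \<nu> \<nu>"
    proof -
      have "KB.ip ?f ?f \<le> (\<Sum>z\<in>B. (?f z - (- m / card B))\<^sup>2)" by (rule KB.sum_sq_shift[OF f0])
      then show ?thesis by (simp add: KB.ip_def power2_eq_square)
    qed
    also have "KB.ip \<nu> \<nu> \<le> mx"
    proof -
      have "KB.ip \<nu> \<nu> \<le> (\<Sum>z\<in>B. mx * \<nu> z)"
        unfolding KB.ip_def using mx \<open>0 \<le> mx\<close> G.pw_nonneg[OF x]
        by (intro sum_mono) (auto simp: \<nu>_def intro!: mult_right_mono)
      also have "\<dots> = mx * m" by (simp add: m_def sum_distrib_left)
      also have "\<dots> \<le> mx" using m1 \<open>0 \<le> mx\<close> by (simp add: mult_left_le)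
      finally show ?thesis .
    qed
    finally show ?thesis by (simp add: lamB_def gB_def mult_left_mono)
  qed
  let ?N = "real (card V)" and ?n = "real (card B)"
  have N: "?N > 0" "?n > 0" "?n \<le> ?N"
    using V_nonempty B_nonempty B_sub fin_V by (auto simp: card_mono)
  have "TV (s + t) x = (\<Sum>y\<in>V - B. max 0 (1 / ?N - G.pw (s + t) x y)) + (\<Sum>y\<in>B. max 0 (1 / ?N - G.pw (s + t) x y))"
    unfolding TV_pos_part[OF x] using B_sub fin_V by (simp add: sum.subset_diff)
  \<comment> \<open>On \<open>B\<close> the true density is at least \<open>a\<close>, and the
    deficit of \<open>a\<close> splits into missing total mass, imperfect mixing of the reflected
    walk, and loss by killing.\<close>
  also have "\<dots> \<le> (\<Sum>y\<in>V - B. 1 / ?N) + (\<Sum>y\<in>B. max 0 (1 / ?N - m / ?n) + \<bar>c y - m / ?n\<bar> + (c y - a y))"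
  proof (intro add_mono sum_mono)
    fix y assume "y \<in> V - B"
    then show "max 0 (1 / ?N - G.pw (s + t) x y) \<le> 1 / ?N"
      using G.pw_nonneg[OF x, of "s + t" y] N by auto
  next
    fix y assume "y \<in> B"
    then show "max 0 (1 / ?N - G.pw (s + t) x y) \<le> max 0 (1 / ?N - m / ?n) + \<bar>c y - m / ?n\<bar> + (c y - a y)"
      using low[of y] ac[of y] by linarith
  qed
  also have "\<dots> = card (V - B) / card V + ?n * max 0 (1 / ?N - m / ?n)
      + (\<Sum>y\<in>B. \<bar>c y - m / ?n\<bar>) + (\<Sum>y\<in>B. c y - a y)"
    by (simp add: sum.distrib)
  also have "?n * max 0 (1 / ?N - m / ?n) \<le> e1"
  proof -
    have "?n * (1 / ?N - m / ?n) = ?n / ?N - m" using N by (simp add: field_simps)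
    also have "?n / ?N \<le> 1" using N by simp
    also have "1 - m \<le> e1" by (rule m1)
    finally show ?thesis using m1 by (simp add: max_def)
  qed
  finally show ?thesis using mix loss by linarith
qed


section \<open>Vertex counts and the resulting explicit bounds\<close>

lemma b_bottom: "b (H + j) = b H + j"
  by (induction j) (auto simp: b_Suc br_ge)

lemma b_L: "b L = b H + r" by (simp add: L_def b_bottom)

lemma card_V_ge: "2 ^ b L \<le> card V"
proof -
  have "card ((\<lambda>v. Cl v 0) ` {..<2 ^ b L :: nat}) \<le> card V"
    by (intro card_mono fin_V) auto
  then show ?thesis by (subst (asm) card_image) (auto simp: inj_on_def)
qed

lemma card_V_minus_B: "card (V - B) \<le> H * 2 ^ b H"
proof -
  have "V - B \<subseteq> (\<lambda>(l, a). Tr l a) ` ({..<H} \<times> {..<2 ^ b H})"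
  proof
    fix x assume "x \<in> V - B"
    then obtain l a where x: "x = Tr l a" "a < 2 ^ b l" "l < H" "l < L"
      by (cases x) (auto simp: B_def L_def)
    moreover have "(2::nat) ^ b l \<le> 2 ^ b H" using x b_mono[of l H] by (intro power_increasing) auto
    ultimately show "x \<in> (\<lambda>(l, a). Tr l a) ` ({..<H} \<times> {..<2 ^ b H})"
      by (intro image_eqI[of _ _ "(l, a)"]) (auto intro: less_le_trans simp del: power_increasing_iff)
  qed
  then have "card (V - B) \<le> card ((\<lambda>(l, a). Tr l a) ` ({..<H} \<times> {..<2 ^ b H :: nat}))"
    by (intro card_mono) auto
  also have "\<dots> \<le> card ({..<H} \<times> {..<2 ^ b H :: nat})" by (intro card_image_le) auto
  finally show ?thesis by (simp add: card_cartesian_product)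
qed

lemma card_B: "card B \<le> 6 * 2 ^ b L"
proof -
  have sum: "(\<Sum>l=H..<H + j. 2 ^ b l) \<le> (2::nat) ^ b (H + j)" for j
    by (induction j) (auto simp: b_Suc br_ge)
  have "B \<subseteq> VC \<union> (\<lambda>(l, a). Tr l a) ` (SIGMA l:{H..<L}. {..<2 ^ b l})"
  proof
    fix x assume "x \<in> B"
    then show "x \<in> VC \<union> (\<lambda>(l, a). Tr l a) ` (SIGMA l:{H..<L}. {..<2 ^ b l})"
      by (cases x) (force simp: B_def)+
  qed
  then have "card B \<le> card (VC \<union> (\<lambda>(l, a). Tr l a) ` (SIGMA l:{H..<L}. {..<2 ^ b l :: nat}))"
    by (intro card_mono) (auto simp: fin_V)
  also have "\<dots> \<le> card VC + card ((\<lambda>(l, a). Tr l a) ` (SIGMA l:{H..<L}. {..<2 ^ b l :: nat}))"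
    by (rule card_Un_le)
  also have "card VC \<le> card ({..<2 ^ b L :: nat} \<times> {..<5 :: nat})"
    unfolding VC_def by (intro card_image_le) auto
  also have "\<dots> = 5 * 2 ^ b L" by (simp add: card_cartesian_product)
  also have "card ((\<lambda>(l, a). Tr l a) ` (SIGMA l:{H..<L}. {..<2 ^ b l :: nat}))
      \<le> card (SIGMA l:{H..<L}. {..<2 ^ b l :: nat})"
    by (intro card_image_le) auto
  also have "\<dots> \<le> 2 ^ b L" using sum[of r] by (simp add: L_def)
  finally show ?thesis by simp
qed

lemma top_fraction: "card (V - B) / card V \<le> H * (1/2) ^ r"
proof -
  have "card (V - B) / card V \<le> real (H * 2 ^ b H) / real (2 ^ b L)"
    using card_V_minus_B card_V_ge by (intro frac_le) (auto simp only: of_nat_le_iff of_nat_0_le_iff of_nat_0_less_iff zero_less_power zero_less_numeral)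
  also have "\<dots> = H * (1/2) ^ r" by (simp add: b_L power_add power_one_over field_simps)
  finally show ?thesis .
qed

text \<open>The target \<open>B'\<close> starts \<open>q\<close> levels below the top of
  \<open>B\<close>. The \<open>q\<close> levels above it make an escape as unlikely as
  \<open>(1/2) ^ q\<close>; the levels below it, at least \<open>q\<close> in number, give the slack
  in \<open>D\<close> that turns failure to arrive into the factor
  \<open>exp (- \<theta> * q)\<close>.\<close>

lemma TV_bound:
  assumes \<theta>: "0 < \<theta>" "\<theta> * K\<^sup>2 \<le> 1" and x: "x \<in> V" and q: "2 * q \<le> r"
  shows "TV (s + t) x \<le> H * (1/2) ^ r
    + ((1 - \<theta> + \<theta>\<^sup>2 * K\<^sup>2) ^ s * exp (\<theta> * (D L - D (lev x))) + 3 * real s * exp (- \<theta> * q))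
    + ((1/2) ^ q + t * (1/2) ^ r)
    + lamB ^ t * sqrt (12 * 2 ^ b (lev x) * (2 ^ r + real s))"
proof -
  define B' where "B' = {z\<in>V. H + q \<le> lev z}"
  define \<rho> where "\<rho> = 1 - \<theta> + \<theta>\<^sup>2 * K\<^sup>2"
  define l where "l = lev x"
  have l: "l \<le> L" using x by (simp add: l_def lev_le)
  have gH: "g H = (1/2) ^ b H" by (rule g_bottom) (auto simp: L_def)
  have eps: "eps = (1/2) ^ b H * (1/2) ^ r" by (simp add: eps_def b_L power_add)
  have DL: "D (H + q) \<le> D L - q"
  proof -
    have "D (H + q) + 3/2 * q \<le> D (H + q + q)" by (rule D_add)
    also have "\<dots> \<le> D L" using q by (intro D_mono) (simp add: L_def)
    finally show ?thesis by simp
  qed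
  have B'B: "B' \<subseteq> B" by (auto simp: B'_def B_def)
  have e1: "(\<Sum>z\<in>V - B'. G.pw s x z) \<le> \<rho> ^ s * exp (\<theta> * (D L - D l)) + 3 * real s * exp (- \<theta> * q)"
  proof -
    have tt: "0 \<le> \<theta>\<^sup>2 * K\<^sup>2" by simp
    have "\<theta> * K\<^sup>2 \<ge> \<theta> * 1" using \<theta> K_pos by (intro mult_left_mono) (auto simp: one_le_power)
    then have \<rho>: "\<rho> \<ge> 0" unfolding \<rho>_def using \<theta> tt by linarith
    have "(\<Sum>z\<in>V - B'. G.pw s x z) \<le> (\<rho> ^ s * exp (- \<theta> * D l) + 3 * real s * exp (- \<theta> * D L)) * exp (\<theta> * D (H + q))"
      unfolding l_def \<rho>_def by (rule hit_late[OF \<theta> x]) (auto simp: B'_def)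
    also have "\<dots> \<le> (\<rho> ^ s * exp (- \<theta> * D l) + 3 * real s * exp (- \<theta> * D L)) * exp (\<theta> * (D L - q))"
      using \<theta> DL \<rho> by (intro mult_left_mono) auto
    also have "\<dots> = \<rho> ^ s * exp (\<theta> * (D L - D l) - \<theta> * q) + 3 * real s * exp (- \<theta> * q)"
      by (simp add: algebra_simps exp_diff exp_minus exp_add field_simps)
    also have "\<dots> \<le> \<rho> ^ s * exp (\<theta> * (D L - D l)) + 3 * real s * exp (- \<theta> * q)"
      using \<theta> \<rho> by (intro add_right_mono mult_left_mono) auto
    finally show ?thesis .
  qed
  have gB': "g (lev z) \<le> (1/2) ^ b H * (1/2) ^ q" if "z \<in> B'" for z
  proof -
    have "g (lev z) \<le> g (H + q)" using that by (intro g_antimono) (auto simp: B'_def lev_le)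
    also have "\<dots> = (1/2) ^ b (H + q)" using q by (intro g_bottom) (auto simp: L_def)
    finally show ?thesis by (simp add: b_bottom power_add)
  qed
  have e2: "1 - (kapp B kG ^^ t) (\<lambda>_. 1) z \<le> (1/2) ^ q + t * (1/2) ^ r" if z: "z \<in> B'" for z
  proof -
    have "(1 - (kapp B kG ^^ t) (\<lambda>_. 1) z) * g H \<le> g (lev z) + t * eps" using z B'B by (intro leak) auto
    also have "\<dots> \<le> (1/2) ^ b H * (1/2) ^ q + t * ((1/2) ^ b H * (1/2) ^ r)"
      using gB'[OF z] by (simp add: eps)
    also have "\<dots> = ((1/2) ^ q + t * (1/2) ^ r) * g H" by (simp add: gH algebra_simps)
    finally show ?thesis using g_pos[of H] by simp
  qed
  \<comment> \<open>This is \<open>pw_le\<close> with \<open>g (lev z) \<le> (1/2) ^ b H\<close> and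
    the lower bound \<open>(1/2) ^ (b l + 1)\<close> on \<open>g l\<close>.\<close>
  define mx where "mx = ((1/2) ^ b H + s * eps) * 2 ^ (b l + 1)"
  have mx: "G.pw s x z \<le> mx" if z: "z \<in> B'" for z
  proof -
    have zV: "z \<in> V" using z by (simp add: B'_def)
    have gz: "g (lev z) \<le> (1/2) ^ b H"
    proof (rule order_trans[OF gB'[OF z]])
      show "(1/2) ^ b H * (1/2) ^ q \<le> (1/2::real) ^ b H" by (intro mult_left_le) (auto simp: power_le_one)
    qed
    have "G.pw s x z * (1/2) ^ (b l + 1) \<le> G.pw s x z * g l"
      using g_ge[OF l] G.pw_nonneg[OF x] by (intro mult_left_mono) auto
    also have "\<dots> \<le> g (lev z) + s * eps" unfolding l_def by (rule pw_le[OF x zV])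
    also have "\<dots> \<le> (1/2) ^ b H + s * eps" using gz by simp
    finally have "G.pw s x z * (1/2) ^ (b l + 1) * 2 ^ (b l + 1) \<le> mx"
      unfolding mx_def by (intro mult_right_mono) auto
    then show ?thesis by (simp add: power_one_over)
  qed
  have mx0: "mx \<ge> 0" using eps_pos by (simp add: mx_def)
  have "TV (s + t) x \<le> card (V - B) / card V + (\<rho> ^ s * exp (\<theta> * (D L - D l)) + 3 * real s * exp (- \<theta> * q))
      + ((1/2) ^ q + t * (1/2) ^ r) + lamB ^ t * sqrt (card B * mx)"
    by (rule TV_upper[OF x B'B e1 e2 _ mx mx0]) auto
  moreover have "card B * mx \<le> 12 * 2 ^ b l * (2 ^ r + real s)"
  proof -
    have "card B * mx \<le> real (6 * 2 ^ b L) * mx"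
      using card_B mx0 by (intro mult_right_mono) (simp_all only: of_nat_le_iff)
    also have "\<dots> = 12 * 2 ^ b l * (2 ^ r + real s)"
      unfolding mx_def eps b_L by (simp add: power_add power_one_over field_simps)
    finally show ?thesis .
  qed
  then have "lamB ^ t * sqrt (card B * mx) \<le> lamB ^ t * sqrt (12 * 2 ^ b l * (2 ^ r + real s))"
    by (intro mult_left_mono real_sqrt_le_mono) (auto simp: lamB_def gB_def)
  ultimately show ?thesis using top_fraction unfolding l_def \<rho>_def by linarith
qed

lemma TV_start:
  assumes "0 < \<theta>" "\<theta> * K \<le> 1"
  shows "TV s (Tr 0 0) \<ge> 1 - H * (1/2) ^ r - (1 + \<theta> + \<theta>\<^sup>2 * K\<^sup>2) ^ s * exp (- \<theta> * D H)"
proof -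
  have x: "Tr 0 0 \<in> V" using L_pos by simp
  have h: "(\<Sum>z\<in>B. G.pw s (Tr 0 0) z) \<le> (1 + \<theta> + \<theta>\<^sup>2 * K\<^sup>2) ^ s * exp (- \<theta> * D H)"
    using hit_early[OF assms x, of s] by (simp add: D_0)
  show ?thesis using TV_lower[OF x, of s] h top_fraction by linarith
qed

section \<open>Hitting times against the length of vertex names\<close>

lemma b_top: "l \<le> H \<Longrightarrow> b l = 1 + l div M + (if l mod M = 0 then 0 else 1)"
proof (induction l)
  case (Suc l)
  have "br l \<longleftrightarrow> l mod M = 0" using Suc by (auto simp: br_def mod_eq_0_iff_dvd)
  then show ?case using Suc M by (auto simp: b_Suc div_Suc mod_Suc)
qed (simp add: b_0)

text \<open>By \<open>del_mod\<close>, each full period of \<open>M\<close> levels adds at least the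
  sum of the numbers below \<open>M\<close>.\<close>

lemma D_top: "l \<le> H \<Longrightarrow> D l \<ge> real ((l div M) * (\<Sum>i<M. i) + (\<Sum>i<l mod M. i))"
proof (induction l)
  case (Suc l)
  have d: "real (l mod M) \<le> del l"
    using del_mod[of l] Suc by simp
  have "(Suc l div M) * (\<Sum>i<M. i) + (\<Sum>i<Suc l mod M. i)
      = (l div M) * (\<Sum>i<M. i) + (\<Sum>i<l mod M. i) + l mod M"
  proof (cases "Suc (l mod M) = M")
    case True
    then have "(\<Sum>i<M. i) = (\<Sum>i<Suc (l mod M). i)" by simp
    then have "(\<Sum>i<M. i) = (\<Sum>i<l mod M. i) + l mod M" by simp
    then show ?thesis using True by (simp add: div_Suc mod_Suc)
  qed (simp add: div_Suc mod_Suc)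
  then show ?case using Suc d by (simp add: D_Suc del: sum.lessThan_Suc)
qed (simp add: D_0)

text \<open>This is where stretching pays: a period costs one digit in \<open>b\<close> but
  contributes at least \<open>a\<close> to \<open>D\<close>. A mixing time of \<open>a\<close> steps
  per digit is thus covered by the time \<open>D l\<close> saved by starting at level
  \<open>l\<close>; the unstretched levels cost at most \<open>a * r\<close>.\<close>

lemma D_vs_b:
  assumes "a \<le> (\<Sum>i<M. i)" and "l \<le> L"
  shows "real a * b l \<le> D l + real a * (2 + r)"
proof -
  have top: "a * b l \<le> D l + a * 2" if "l \<le> H" for l
  proof -
    have "a * b l \<le> a * (2 + l div M)" using b_top[OF that] by (intro mult_left_mono) auto
    also have "\<dots> = a * (l div M) + a * 2" by (simp add: algebra_simps)
    also have "a * (l div M) \<le> (l div M) * (\<Sum>i<M. i)" using assms(1) by simp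
    finally have "real (a * b l) \<le> real ((l div M) * (\<Sum>i<M. i)) + real (a * 2)"
      by (simp only: of_nat_le_iff flip: of_nat_add)
    moreover have "real ((l div M) * (\<Sum>i<M. i)) \<le> D l"
      by (rule order_trans[OF _ D_top[OF that]]) (simp only: of_nat_le_iff le_add1)
    ultimately show ?thesis by simp
  qed
  show ?thesis
  proof (cases "l \<le> H")
    case True
    have "0 \<le> real a * r" by simp
    moreover have "real a * b l \<le> D l + real a * 2" using top[OF True] by simp
    moreover have "real a * real (2 + r) = real a * 2 + real a * r" by (simp add: algebra_simps)
    ultimately show ?thesis by linarith
  next
    case False
    have "real a * b l \<le> real a * (b H + r)"
      using b_mono[OF assms(2)] by (intro mult_left_mono) (auto simp: b_L)
    also have "\<dots> = real (a * b H) + real a * r" by (simp add: algebra_simps)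
    also have "real (a * b H) \<le> D H + a * 2" by (rule top) simp
    also have "D H \<le> D l" using False by (intro D_mono) simp
    finally show ?thesis by (simp add: algebra_simps)
  qed
qed

end

context tree_graph
begin

section \<open>Spectral gap and edge expansion of the whole graph\<close>

definition gG :: real where "gG = (1 + (3 - 1) * 2000000) / (1 / (4 * K\<^sup>2)) + 2000000"

text \<open>The function \<open>psi (-\<theta>)\<close> decays towards the clouds. The choice
  \<open>\<theta> = 1 / (2 * K\<^sup>2)\<close> minimises
  \<open>- \<theta> + \<theta>\<^sup>2 * K\<^sup>2\<close> and gives the rate
  \<open>1 / (4 * K\<^sup>2)\<close>, which is independent of \<open>H\<close> and
  \<open>r\<close>.\<close>

lemma gap_G:
  assumes "(\<Sum>x\<in>V. f x) = 0" "\<sigma> = 1 \<or> \<sigma> = -1"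
  shows "G.ip f f \<le> gG * G.en \<sigma> f"
proof -
  define \<theta> where "\<theta> = 1 / (2 * K\<^sup>2)"
  have K2: "K\<^sup>2 > 0" using K_pos by simp
  have \<theta>: "0 < \<theta>" using K2 by (simp add: \<theta>_def)
  have "K \<le> K\<^sup>2" using K_pos by (simp add: power2_eq_square)
  then have "K \<le> 2 * K\<^sup>2" using K2 by linarith
  then have tK: "\<theta> * K \<le> 1" using K2 by (simp add: \<theta>_def divide_le_eq)
  have k: "kG x y \<ge> 1/3" if "x \<in> VC" "y \<in> VC" "y \<in> nb x" for x y
    using that by (simp add: kG_def)
  have c: "1 - \<theta> + \<theta>\<^sup>2 * K\<^sup>2 = 1 - 1 / (4 * K\<^sup>2)"
    using K2 by (simp add: \<theta>_def power2_eq_square field_simps)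
  show ?thesis unfolding gG_def
  proof (rule G.gap_extend[OF VC_sub, where \<phi> = "psi (-\<theta>)"])
    fix x assume "x \<in> V - VC"
    then obtain l a where x: "x = Tr l a" "l < L" "a < 2 ^ b l" by (cases x) auto
    then show "kapp V kG (psi (-\<theta>)) x \<le> (1 - 1 / (4 * K\<^sup>2)) * psi (-\<theta>) x"
      using psi_Tr[of l a "-\<theta>"] \<theta> tK by (simp add: c)
  next
    fix x assume "x \<in> VC"
    then show "kapp V kG (psi (-\<theta>)) x \<le> 3 * psi (-\<theta>) x"
      using psi_Cl_neg[of _ _ \<theta>] \<theta> tK by (cases x) auto
  qed (use assms K2 cloud_gap[OF G.stoch_kernel_axioms VC_sub k]
      cloud_gap_odd[OF G.stoch_kernel_axioms VC_sub k] in \<open>auto simp: psi_def\<close>)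
qed

lemma gG_ge: "gG \<ge> 2000000" unfolding gG_def by simp

text \<open>By contraction of a centred point mass, all entries eventually differ from
  \<open>1 / card V\<close> by less than that value. A common \<open>t\<close> later certifies
  irreducibility and aperiodicity at once.\<close>

lemma pw_pos: "\<exists>t. \<forall>x\<in>V. \<forall>y\<in>V. G.pw t x y > 0"
proof -
  define lam where "lam = 1 - 1 / gG"
  have lam: "0 \<le> lam" "lam < 1" using gG_ge by (auto simp: lam_def)
  let ?N = "real (card V)"
  have N: "?N > 0" using V_nonempty by simp
  obtain t where t: "lam ^ t < 1 / ?N" using real_arch_pow_inv[of "1 / ?N" lam] lam N by auto
  have "G.pw t x y > 0" if xy: "x \<in> V" "y \<in> V" for x y
  proof -
    let ?f = "\<lambda>z. (if z = y then 1 else 0) - 1 / ?N :: real"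
    have f0: "(\<Sum>z\<in>V. ?f z) = 0" using xy fin_V V_nonempty by (simp add: sum_subtractf)
    have "G.ip ?f ?f \<le> (\<Sum>z\<in>V. (?f z - (- 1 / ?N))\<^sup>2)" by (rule G.sum_sq_shift[OF f0])
    also have "\<dots> = 1" using xy fin_V by (simp add: if_distrib[of "\<lambda>x. x\<^sup>2"] cong: if_cong)
    finally have ip: "G.ip ?f ?f \<le> 1" .
    have "((kapp V kG ^^ t) ?f x)\<^sup>2 \<le> G.ip ((kapp V kG ^^ t) ?f) ((kapp V kG ^^ t) ?f)"
      unfolding G.ip_def power2_eq_square using xy fin_V by (intro member_le_sum[of x]) auto
    also have "\<dots> \<le> (lam ^ t)\<^sup>2 * G.ip ?f ?f"
      unfolding lam_def by (rule G.contraction_pow[OF _ gap_G f0]) (use gG_ge in auto)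
    also have "\<dots> \<le> (lam ^ t)\<^sup>2" using ip by (simp add: mult_left_le)
    finally have "\<bar>(kapp V kG ^^ t) ?f x\<bar> \<le> lam ^ t"
      using lam by (metis abs_le_square_iff abs_of_nonneg zero_le_power)
    moreover have "(kapp V kG ^^ t) ?f x = G.pw t x y - 1 / ?N"
      using G.app_pow_const[OF xy(1)] by (simp add: kapp_pow_diff kpow_def)
    ultimately show ?thesis using t by linarith
  qed
  then show ?thesis by blast
qed

text \<open>The easy half of Cheeger's inequality: the gap is tested on the centred indicator
  function of \<open>S\<close>.\<close>

lemma edge_expansion:
  assumes S: "S \<subseteq> V"
  shows "real (min (card S) (card (V - S))) \<le> gG * (\<Sum>x\<in>S. \<Sum>y\<in>V - S. if y \<in> nb x then 1 else 0)"
proof -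
  let ?N = "real (card V)" and ?s = "real (card S)" and ?c = "real (card (V - S))"
  have N: "?N > 0" using V_nonempty by simp
  have sc: "?N = ?s + ?c" using S fin_V by (simp add: card_Diff_subset card_mono finite_subset flip: of_nat_add)
  define f where "f x = (if x \<in> S then 1 else 0) - ?s / ?N" for x
  have sum_S: "(\<Sum>x\<in>V. if x \<in> S then h x else 0) = sum h S" for h :: "vert \<Rightarrow> real"
    using S fin_V by (simp add: sum.inter_restrict[symmetric] Int_absorb1)
  have f0: "(\<Sum>x\<in>V. f x) = 0" using N sum_S[of "\<lambda>_. 1"] by (simp add: f_def sum_subtractf)
  have ip: "G.ip f f = ?s * ?c / ?N"
  proof -
    have "G.ip f f = (\<Sum>x\<in>V. (if x \<in> S then 1 - 2 * ?s / ?N else 0) + (?s / ?N)\<^sup>2)"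
      unfolding G.ip_def f_def by (intro sum.cong refl) (auto simp: power2_eq_square algebra_simps)
    also have "\<dots> = ?s * (1 - 2 * ?s / ?N) + ?N * (?s / ?N)\<^sup>2"
      by (simp only: sum.distrib sum_S) simp
    also have "\<dots> = ?s - ?s * ?s / ?N" using N by (simp add: power2_eq_square algebra_simps)
    also have "\<dots> = ?s * (?N - ?s) / ?N" using N by (simp add: field_simps)
    also have "?N - ?s = ?c" using sc by simp
    finally show ?thesis .
  qed
  define E where "E = (\<Sum>x\<in>S. \<Sum>y\<in>V - S. if y \<in> nb x then 1 else (0::real))"
  have en: "G.en (-1) f = E / 3"
  proof -
    have V: "(\<Sum>x\<in>V. h x) = (\<Sum>x\<in>S. h x) + (\<Sum>x\<in>V - S. h x)" for h :: "vert \<Rightarrow> real"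
      using S fin_V by (simp add: sum.subset_diff add.commute)
    have inS: "(\<Sum>x\<in>S. \<Sum>y\<in>V. kG x y * (f x + (-1) * f y)\<^sup>2) = E / 3"
      unfolding V E_def sum_divide_distrib sum.distrib
      by (simp add: f_def kG_def if_distrib[of "\<lambda>x. x / 3"] cong: if_cong)
    have outS: "(\<Sum>x\<in>V - S. \<Sum>y\<in>V. kG x y * (f x + (-1) * f y)\<^sup>2) = E / 3"
    proof -
      have "(\<Sum>x\<in>V - S. \<Sum>y\<in>V. kG x y * (f x + (-1) * f y)\<^sup>2) = (\<Sum>x\<in>V - S. \<Sum>y\<in>S. kG x y)"
        unfolding V[of "\<lambda>y. kG _ y * _ y"] sum.distrib by (simp add: f_def)
      also have "\<dots> = (\<Sum>y\<in>S. \<Sum>x\<in>V - S. kG y x)"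
        using S by (subst sum.swap) (intro sum.cong refl kG_sym, auto)
      also have "\<dots> = E / 3"
        by (simp add: E_def sum_divide_distrib kG_def if_distrib[of "\<lambda>x. x / 3"] cong: if_cong)
      finally show ?thesis .
    qed
    show ?thesis unfolding G.en_def using V inS outS by simp
  qed
  have E0: "E \<ge> 0" by (simp add: E_def sum_nonneg)
  have "?s * ?c / ?N \<le> gG * (E / 3)" using gap_G[OF f0, of "-1"] ip en by simp
  moreover have "real (min (card S) (card (V - S))) / 2 \<le> ?s * ?c / ?N"
  proof -
    have "real (min (card S) (card (V - S))) * ?N \<le> 2 * (?s * ?c)"
    proof (cases "?s \<le> ?c")
      case True
      then have "?s * (?s + ?c) \<le> ?s * (2 * ?c)" by (intro mult_left_mono) auto
      then show ?thesis using True sc by (simp add: min_def)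
    next
      case False
      then have "?c * (?s + ?c) \<le> ?c * (2 * ?s)" by (intro mult_left_mono) auto
      then show ?thesis using False sc by (simp add: min_def mult_ac)
    qed
    then show ?thesis using N by (simp add: field_simps)
  qed
  moreover have "gG * E \<ge> 0" using E0 gG_ge by (intro mult_nonneg_nonneg) auto
  ultimately show ?thesis unfolding E_def[symmetric] by linarith
qed

section \<open>The time window around \<open>D H\<close>\<close>

lemma H_le_D: "3/2 * H \<le> D H" using D_add[of 0 H] by (simp add: D_0)
lemma D_le_H: "D H \<le> K * H" using D_add_le[of 0 H] by (simp add: D_0)

text \<open>The times \<open>kk * tc\<close> and \<open>(kk + 1) * tc\<close> are, up to rounding,
  \<open>1 - c\<close> and \<open>1 + c\<close> times \<open>D H\<close>, because
  \<open>kk / (kk + 1/2) = 1 - c\<close>. The value of \<open>\<theta>\<close> makes the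
  second-order term \<open>\<theta>\<^sup>2 * K\<^sup>2\<close> equal to \<open>c / 8\<close> of the
  drift term.\<close>

context
  fixes kk tc q a :: nat and c \<theta> :: real
  assumes kk: "kk \<ge> 1"
    and c_def: "c = 1 / (2 * kk + 1)" and \<theta>_def: "\<theta> = c / (8 * K\<^sup>2)"
    and tc_def: "tc = nat \<lfloor>D H / (kk + 1/2)\<rfloor>"
begin

lemma c: "0 < c" "c < 1" using kk by (auto simp: c_def)

lemma th: "0 < \<theta>" "\<theta> * K\<^sup>2 = c / 8" "\<theta> * K\<^sup>2 \<le> 1" "\<theta> * K \<le> 1"
proof -
  have "K > 0" using K_pos by simp
  then show "0 < \<theta>" "\<theta> * K\<^sup>2 = c / 8" using c by (auto simp: \<theta>_def)
  then show t: "\<theta> * K\<^sup>2 \<le> 1" using c by simp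
  have "K \<le> K\<^sup>2" using K_pos by (simp add: power2_eq_square)
  then have "\<theta> * K \<le> \<theta> * K\<^sup>2" using \<open>0 < \<theta>\<close> by (intro mult_left_mono) auto
  then show "\<theta> * K \<le> 1" using t by linarith
qed

lemma T_bounds:
  "real kk * tc \<le> (1 - c) * D H" "(1 + c) * D H - (kk + 1) \<le> real (kk + 1) * tc" "real (kk + 1) * tc \<le> 2 * D H"
proof -
  let ?z = "D H / (kk + 1/2)"
  have z: "?z \<ge> 0" using D_nonneg[of H] by simp
  have tc: "real tc \<le> ?z" "real tc \<ge> ?z - 1"
    using z by (auto simp: tc_def)
  have "real kk * tc \<le> kk * ?z" using tc by (intro mult_left_mono) auto
  also have "\<dots> = (1 - c) * D H" by (simp add: c_def field_simps)
  finally show "real kk * tc \<le> (1 - c) * D H" .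
  have "(1 + c) * D H - (kk + 1) = real (kk + 1) * (?z - 1)" by (simp add: c_def field_simps)
  also have "\<dots> \<le> real (kk + 1) * tc" using tc by (intro mult_left_mono) auto
  finally show "(1 + c) * D H - (kk + 1) \<le> real (kk + 1) * tc" .
  have "real (kk + 1) * tc \<le> real (kk + 1) * ?z" using tc by (intro mult_left_mono) auto
  also have "\<dots> = (1 + c) * D H" by (simp add: c_def field_simps)
  also have "\<dots> \<le> 2 * D H" using c D_nonneg by (intro mult_right_mono) auto
  finally show "real (kk + 1) * tc \<le> 2 * D H" .
qed

lemma TV_start_bound:
  assumes "s \<le> kk * tc"
  shows "TV s (Tr 0 0) \<ge> 1 - H * (1/2) ^ r - exp (- (\<theta> * c / 2) * D H)"
proof -
  have "real s \<le> real (kk * tc)" using assms by (simp only: of_nat_le_iff)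
  then have s: "real s \<le> (1 - c) * D H" using T_bounds(1) by simp
  have e: "1 + \<theta> + \<theta>\<^sup>2 * K\<^sup>2 = 1 + \<theta> * (1 + c / 8)"
    using th(2) by (simp add: power2_eq_square algebra_simps)
  have "(1 + \<theta> + \<theta>\<^sup>2 * K\<^sup>2) ^ s \<le> exp (\<theta> * (1 + c / 8)) ^ s"
    unfolding e using th c exp_ge_add_one_self[of "\<theta> * (1 + c / 8)"] by (intro power_mono) auto
  also have "\<dots> = exp (\<theta> * (1 + c / 8) * s)" by (simp add: exp_of_nat_mult[symmetric] mult_ac)
  finally have "(1 + \<theta> + \<theta>\<^sup>2 * K\<^sup>2) ^ s * exp (- \<theta> * D H) \<le> exp (\<theta> * (1 + c / 8) * s) * exp (- \<theta> * D H)"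
    by (intro mult_right_mono) auto
  also have "\<dots> = exp (\<theta> * ((1 + c / 8) * s - D H))" by (simp add: algebra_simps flip: exp_add)
  also have "\<dots> \<le> exp (\<theta> * (- (c / 2) * D H))"
  proof -
    have "(1 + c / 8) * s \<le> (1 + c / 8) * ((1 - c) * D H)" using s c by (intro mult_left_mono) auto
    also have "\<dots> = ((1 + c / 8) * (1 - c)) * D H" by simp
    also have "\<dots> \<le> (1 - c / 2) * D H"
      using c D_nonneg by (intro mult_right_mono) (auto simp: algebra_simps)
    finally have "(1 + c / 8) * s - D H \<le> - (c / 2) * D H" by (simp add: algebra_simps)
    then show ?thesis unfolding exp_le_cancel_iff using th(1) by (intro mult_left_mono) auto
  qed
  finally have *: "(1 + \<theta> + \<theta>\<^sup>2 * K\<^sup>2) ^ s * exp (- \<theta> * D H) \<le> exp (- (\<theta> * c / 2) * D H)"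
    by (simp add: mult_ac)
  show ?thesis using TV_start[OF th(1,4), of s] * by linarith
qed

text \<open>For a start at level \<open>l\<close>, \<open>t\<close> steps are reserved for mixing
  and the other \<open>s\<close> for arrival. By \<open>D_vs_b\<close> the reserved time is at most
  \<open>D l\<close> plus errors of order \<open>q\<close>, so \<open>s\<close> still exceeds the
  expected arrival time \<open>D L - D l\<close> with room to spare.\<close>

lemma TV_end_bound:
  assumes q: "r = 2 * q" and a: "a \<le> (\<Sum>i<M. i)" "lamB ^ (2 * a) \<le> 1/2"
    and big: "kk + 1 + 2 * a + (4 * a + 2 + 2 * K) * q \<le> 3 * c / 4 * D H"
    and x: "x \<in> V"
  shows "TV ((kk + 1) * tc) x \<le> H * (1/2) ^ r + (exp (- \<theta> * q) + 6 * D H * exp (- \<theta> * q))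
    + ((1/2) ^ q + 2 * D H * (1/2) ^ r) + lamB ^ q * (12 * (1 + 2 * D H))"
proof -
  define l where "l = lev x"
  have l: "l \<le> L" using x by (simp add: l_def lev_le)
  \<comment> \<open>As \<open>lamB ^ (2 * a)\<close> is at most 1/2, \<open>a\<close> steps per
    digit cancel the square root of \<open>2 ^ (b l + r)\<close> from the density bound;
    \<open>q\<close> further steps make the remainder small.\<close>
  define t where "t = a * (b l + r) + q"
  have DL: "D L \<le> D H + K * (2 * q)" using D_add_le[of H r] q by (simp add: L_def)
  have Dl: "D l \<le> D L" using l by (rule D_mono)
  have tt: "t \<le> D l + 2 * a + (4 * a + 1) * q"
    using D_vs_b[OF a(1) l] q by (simp add: t_def algebra_simps)
  have big': "kk + 1 + 2 * a + 4 * (a * q) + 2 * q + 2 * (K * q) \<le> 3/4 * (c * D H)"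
    using big by (simp add: algebra_simps)
  have tT: "real t \<le> real (kk + 1) * tc"
  proof -
    have "real t \<le> D H + 2 * (K * q) + 2 * a + 4 * (a * q) + q" using tt DL Dl by (simp add: algebra_simps)
    also have "\<dots> \<le> (1 + c) * D H - (kk + 1)"
    proof -
      have "0 \<le> c * D H" using c D_nonneg[of H] by (intro mult_nonneg_nonneg) auto
      moreover have "(1 + c) * D H = D H + c * D H" by (simp add: algebra_simps)
      ultimately show ?thesis using big' by linarith
    qed
    finally show ?thesis using T_bounds(2) by linarith
  qed
  then have "t \<le> (kk + 1) * tc" by (simp only: of_nat_le_iff flip: of_nat_mult)
  define s where "s = (kk + 1) * tc - t"
  have st: "(kk + 1) * tc = s + t" using \<open>t \<le> (kk + 1) * tc\<close> by (simp add: s_def)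
  have sr: "real s = real (kk + 1) * tc - t" using st by (metis add_diff_cancel_right' of_nat_add of_nat_mult)
  have s2: "real s \<le> 2 * D H" using sr T_bounds(3) by linarith
  have t2: "real t \<le> 2 * D H" using tT T_bounds(3) by linarith
  have rho: "(1 - \<theta> + \<theta>\<^sup>2 * K\<^sup>2) ^ s * exp (\<theta> * (D L - D l)) \<le> exp (- \<theta> * q)"
  proof -
    have e: "1 - \<theta> + \<theta>\<^sup>2 * K\<^sup>2 = 1 + - (\<theta> * (1 - c / 8))"
      using th(2) by (simp add: power2_eq_square algebra_simps)
    have "\<theta> * 1 \<le> \<theta> * K\<^sup>2" using th K_pos by (intro mult_left_mono) (auto simp: one_le_power)
    then have "\<theta> \<le> 1" using th by linarith
    then have "0 \<le> 1 + - (\<theta> * (1 - c / 8))" using c th mult_le_one[of \<theta> "1 - c/8"] by simp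
    then have "(1 - \<theta> + \<theta>\<^sup>2 * K\<^sup>2) ^ s \<le> exp (- (\<theta> * (1 - c / 8))) ^ s"
      unfolding e using exp_ge_add_one_self[of "- (\<theta> * (1 - c / 8))"] by (intro power_mono) auto
    also have "\<dots> = exp (- \<theta> * (1 - c / 8) * s)" by (simp add: exp_of_nat_mult[symmetric] mult_ac)
    finally have "(1 - \<theta> + \<theta>\<^sup>2 * K\<^sup>2) ^ s * exp (\<theta> * (D L - D l))
        \<le> exp (- \<theta> * (1 - c / 8) * s) * exp (\<theta> * (D L - D l))"
      by (intro mult_right_mono) auto
    also have "\<dots> = exp (- \<theta> * ((1 - c / 8) * s - (D L - D l)))"
      by (simp add: algebra_simps flip: exp_add)
    also have "\<dots> \<le> exp (- \<theta> * q)"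
    proof -
      have "c / 8 * s \<le> c / 8 * (2 * D H)" using s2 c by (intro mult_left_mono) auto
      then have "(1 - c / 8) * s \<ge> s - c / 4 * D H" by (simp add: algebra_simps)
      moreover have "s \<ge> (1 + c) * D H - (kk + 1) - (D l + 2 * a + (4 * a + 1) * q)"
        using sr T_bounds(2) tt by linarith
      ultimately have "(1 - c / 8) * s \<ge> D L - D l + q"
        using big' DL by (simp add: algebra_simps)
      then show ?thesis using th(1) by simp
    qed
    finally show ?thesis .
  qed
  have root: "lamB ^ t * sqrt (12 * 2 ^ b l * (2 ^ r + real s)) \<le> lamB ^ q * (12 * (1 + 2 * D H))"
  proof -
    have l0: "0 \<le> lamB" by (simp add: lamB_def gB_def)
    have "(lamB ^ (a * (b l + r)))\<^sup>2 = (lamB ^ (2 * a)) ^ (b l + r)" by (simp add: mult_ac flip: power_mult)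
    also have "\<dots> \<le> (1/2) ^ (b l + r)" using a l0 by (intro power_mono) auto
    finally have p: "(lamB ^ (a * (b l + r)))\<^sup>2 \<le> (1/2) ^ (b l + r)" .
    have "lamB ^ (a * (b l + r)) * sqrt (12 * 2 ^ b l * (2 ^ r + real s))
        = sqrt ((lamB ^ (a * (b l + r)))\<^sup>2 * (12 * 2 ^ b l * (2 ^ r + real s)))"
      using l0 by (simp add: real_sqrt_mult)
    also have "\<dots> \<le> sqrt ((1/2) ^ (b l + r) * (12 * 2 ^ b l * (2 ^ r + real s)))"
      using p by (intro real_sqrt_le_mono mult_right_mono) auto
    also have "(1/2) ^ (b l + r) * (12 * 2 ^ b l * (2 ^ r + real s)) = 12 * (1 + s * (1/2) ^ r)"
      by (simp add: power_add power_one_over field_simps)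
    also have "sqrt (12 * (1 + s * (1/2) ^ r)) \<le> sqrt (12 * (1 + 2 * D H))"
      using s2 mult_left_le[of "(1/2::real) ^ r" "real s"] power_le_one[of "1/2::real" r]
      by (intro real_sqrt_le_mono) simp
    also have "\<dots> \<le> 12 * (1 + 2 * D H)"
      using D_nonneg[of H] sqrt_le_D[of _ "12 * (1 + 2 * D H)"]
      by (intro real_le_lsqrt) (auto simp: power2_eq_square intro!: mult_nonneg_nonneg)
    finally have "lamB ^ q * (lamB ^ (a * (b l + r)) * sqrt (12 * 2 ^ b l * (2 ^ r + real s)))
        \<le> lamB ^ q * (12 * (1 + 2 * D H))" using l0 by (intro mult_left_mono) auto
    then show ?thesis by (simp add: t_def power_add mult_ac)
  qed
  have "TV ((kk + 1) * tc) x \<le> H * (1/2) ^ r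
    + ((1 - \<theta> + \<theta>\<^sup>2 * K\<^sup>2) ^ s * exp (\<theta> * (D L - D l)) + 3 * real s * exp (- \<theta> * q))
    + ((1/2) ^ q + t * (1/2) ^ r) + lamB ^ t * sqrt (12 * 2 ^ b l * (2 ^ r + real s))"
    unfolding st l_def by (rule TV_bound[OF th(1,3) x]) (simp add: q)
  moreover have "3 * real s * exp (- \<theta> * q) \<le> 6 * D H * exp (- \<theta> * q)"
    using s2 by (intro mult_right_mono) auto
  moreover have "t * (1/2) ^ r \<le> 2 * D H * (1/2) ^ r" using t2 by (intro mult_right_mono) auto
  ultimately show ?thesis using rho root by linarith
qed

end

end

section \<open>Existence of the graphs\<close>

primrec walks :: "'a set \<Rightarrow> ('a \<Rightarrow> 'a \<Rightarrow> bool) \<Rightarrow> nat \<Rightarrow> 'a \<Rightarrow> 'a \<Rightarrow> nat" where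
  "walks V E 0 x y = (if x = y then 1 else 0)"
| "walks V E (Suc t) x y = (\<Sum>z\<in>V. if E x z then walks V E t z y else 0)"

text \<open>\<open>walk_dev V E t x\<close> is \<open>2 \<cdot> 3\<^sup>t \<cdot> card V\<close> times the total variation distance from the uniform
  distribution after \<open>t\<close> steps from \<open>x\<close>.\<close>

definition walk_dev :: "'a set \<Rightarrow> ('a \<Rightarrow> 'a \<Rightarrow> bool) \<Rightarrow> nat \<Rightarrow> 'a \<Rightarrow> nat" where
  "walk_dev V E t x = (\<Sum>y\<in>V. (card V * walks V E t x y - 3 ^ t) + (3 ^ t - card V * walks V E t x y))"

text \<open>All conditions are cleared of denominators, so that they can be tested on natural
  numbers. The two about \<open>walk_dev\<close> say that some start is at distance above
  \<open>1 - 1/k\<close> at every time up to \<open>k * T\<close>, and that all starts are within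
  \<open>1/k\<close> at time \<open>(k + 1) * T\<close>.\<close>

definition good :: "nat \<Rightarrow> nat \<Rightarrow> 'a set \<Rightarrow> ('a \<Rightarrow> 'a \<Rightarrow> bool) \<Rightarrow> nat \<Rightarrow> nat \<Rightarrow> bool" where
  "good q k V E T t \<longleftrightarrow> finite V \<and> k \<le> card V \<and> 0 < T \<and>
    (\<forall>x\<in>V. \<forall>y\<in>V. E x y \<longrightarrow> E y x) \<and> (\<forall>x\<in>V. \<not> E x x) \<and>
    (\<forall>x\<in>V. (\<Sum>y\<in>V. if E x y then 1 else 0) = (3::nat)) \<and>
    (\<forall>S\<subseteq>V. S \<noteq> {} \<longrightarrow> S \<noteq> V \<longrightarrow>
      min (card S) (card V - card S) < q * (\<Sum>x\<in>S. \<Sum>y\<in>V - S. if E x y then 1 else 0)) \<and>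
    (\<forall>s\<le>k * T. \<exists>x\<in>V. 2 * (k - 1) * 3 ^ s * card V < k * walk_dev V E s x) \<and>
    (\<forall>x\<in>V. k * walk_dev V E ((k + 1) * T) x < 2 * 3 ^ ((k + 1) * T) * card V) \<and>
    (\<forall>x\<in>V. \<forall>y\<in>V. 0 < walks V E t x y)"

lemma walk_dev_real:
  "real (walk_dev V E t x) = (\<Sum>y\<in>V. \<bar>real (card V) * walks V E t x y - 3 ^ t\<bar>)"
proof -
  \<comment> \<open>With truncated subtraction one of the two differences is 0, and their sum is the
    absolute difference.\<close>
  have "real ((m - n) + (n - m)) = \<bar>real m - real n\<bar>" for m n :: nat by linarith
  from this[of "card V * walks V E t x _" "3 ^ t"] show ?thesis
    unfolding walk_dev_def of_nat_sum by simp
qed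

lemma lin_geo: "0 \<le> z \<Longrightarrow> z < 1 \<Longrightarrow> (\<lambda>q. (A + B * real q) * z ^ q) \<longlonglongrightarrow> 0" for z :: real
proof -
  assume z: "0 \<le> z" "z < 1"
  have "(\<lambda>q. A * z ^ q + B * (real q * z ^ q)) \<longlonglongrightarrow> A * 0 + B * 0"
    by (intro tendsto_add tendsto_mult tendsto_const LIMSEQ_power_zero powser_times_n_limit_0) (use z in auto)
  then show ?thesis by (simp add: algebra_simps)
qed

context tree_graph
begin

lemma pw_walks: "x \<in> V \<Longrightarrow> G.pw t x y = real (walks V (\<lambda>x y. y \<in> nb x) t x y) / 3 ^ t"
proof (induction t arbitrary: x)
  case (Suc t)
  have "G.pw (Suc t) x y = (\<Sum>z\<in>V. kG x z * G.pw t z y)" by (simp add: kpow_def kapp_def)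
  also have "\<dots> = (\<Sum>z\<in>V. (if z \<in> nb x then real (walks V (\<lambda>x y. y \<in> nb x) t z y) else 0) / 3 ^ Suc t)"
  proof (intro sum.cong refl)
    fix z assume "z \<in> V"
    then show "kG x z * G.pw t z y = (if z \<in> nb x then real (walks V (\<lambda>x y. y \<in> nb x) t z y) else 0) / 3 ^ Suc t"
      using Suc(1)[of z] kG_def[of x z] by (simp split del: if_split) simp
  qed
  finally show ?case by (simp add: sum_divide_distrib if_distrib[of real] cong: if_cong)
qed (simp add: kpow_def)

lemma TV_walk_dev:
  "x \<in> V \<Longrightarrow> TV t x = real (walk_dev V (\<lambda>x y. y \<in> nb x) t x) / (2 * 3 ^ t * card V)"
proof -
  assume x: "x \<in> V"
  have "\<bar>G.pw t x y - 1 / card V\<bar> = \<bar>real (card V) * walks V (\<lambda>x y. y \<in> nb x) t x y - 3 ^ t\<bar> / (3 ^ t * card V)" for y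
  proof -
    have "G.pw t x y - 1 / card V = (real (card V) * walks V (\<lambda>x y. y \<in> nb x) t x y - 3 ^ t) / (3 ^ t * card V)"
      using V_nonempty(2) by (simp add: pw_walks[OF x] field_simps)
    then show ?thesis by (simp add: abs_divide abs_mult)
  qed
  then show ?thesis by (simp add: TV_def walk_dev_real mult_ac flip: sum_divide_distrib)
qed

lemma good_tree:
  fixes kk q :: nat
  assumes kk: "kk \<ge> 1" and tc: "tc > 0" "kk \<le> card V" and q: "gG < real q"
    and start: "\<And>s. s \<le> kk * tc \<Longrightarrow> TV s (Tr 0 0) > 1 - 1 / kk"
    and fin: "\<And>x. x \<in> V \<Longrightarrow> TV ((kk + 1) * tc) x < 1 / kk"
  shows "\<exists>t. good q kk V (\<lambda>x y. y \<in> nb x) tc t"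
proof -
  let ?E = "\<lambda>x y. y \<in> nb x"
  obtain t where t: "\<And>x y. x \<in> V \<Longrightarrow> y \<in> V \<Longrightarrow> G.pw t x y > 0" using pw_pos by blast
  have N: "real (card V) > 0" using V_nonempty by simp
  have deg: "(\<Sum>y\<in>V. if y \<in> nb x then 1 else 0) = (3::nat)" if "x \<in> V" for x
    using that nb_V[OF that] fin_V card_nb[OF that] by (simp add: sum.inter_restrict[symmetric] Int_absorb1)
  have ch: "min (card S) (card V - card S) < q * (\<Sum>x\<in>S. \<Sum>y\<in>V - S. if y \<in> nb x then 1 else 0)"
    if S: "S \<subseteq> V" "S \<noteq> {}" "S \<noteq> V" for S
  proof -
    let ?e = "(\<Sum>x\<in>S. \<Sum>y\<in>V - S. if y \<in> nb x then 1 else 0) :: nat"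
    have fS: "finite S" using S fin_V finite_subset by blast
    have cV: "card (V - S) = card V - card S" using S fS by (simp add: card_Diff_subset)
    have "card S < card V" using S fin_V by (intro psubset_card_mono) auto
    then have pos: "0 < min (card S) (card V - card S)" using S fS by (simp add: card_gt_0_iff)
    have e: "real ?e = (\<Sum>x\<in>S. \<Sum>y\<in>V - S. if y \<in> nb x then 1 else 0)"
      by (simp add: if_distrib[of real] cong: if_cong)
    have le: "real (min (card S) (card V - card S)) \<le> gG * real ?e"
      using edge_expansion[OF S(1)] unfolding e cV .
    have "?e > 0"
    proof (rule ccontr)
      assume "\<not> ?e > 0"
      then have "?e = 0" by simp
      then have "real ?e = 0" by (simp only: of_nat_0)
      then show False using le pos by simp
    qed
    then have "real ?e > 0" by (simp only: of_nat_0_less_iff)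
    with q have "gG * real ?e < q * real ?e" by (rule mult_strict_right_mono)
    with le have "real (min (card S) (card V - card S)) < real (q * ?e)" by simp
    then show ?thesis by (simp only: of_nat_less_iff)
  qed
  have 1: "\<exists>x\<in>V. 2 * (kk - 1) * 3 ^ s * card V < kk * walk_dev V ?E s x" if "s \<le> kk * tc" for s
  proof -
    have x: "Tr 0 0 \<in> V" using L_pos by simp
    have "1 - 1 / kk < real (walk_dev V ?E s (Tr 0 0)) / (2 * 3 ^ s * card V)"
      using start[OF that] by (simp add: TV_walk_dev[OF x])
    then have "(real kk - 1) * (2 * 3 ^ s * card V) < kk * real (walk_dev V ?E s (Tr 0 0))"
      using N kk by (simp add: field_simps)
    then have "real (2 * (kk - 1) * 3 ^ s * card V) < real (kk * walk_dev V ?E s (Tr 0 0))"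
      using kk by (simp add: of_nat_diff mult_ac)
    then show ?thesis using x by (auto simp only: of_nat_less_iff)
  qed
  have 2: "kk * walk_dev V ?E ((kk + 1) * tc) x < 2 * 3 ^ ((kk + 1) * tc) * card V" if x: "x \<in> V" for x
  proof -
    have "real (walk_dev V ?E ((kk + 1) * tc) x) / (2 * 3 ^ ((kk + 1) * tc) * card V) < 1 / kk"
      using fin[OF x] by (simp only: TV_walk_dev[OF x])
    then have "kk * real (walk_dev V ?E ((kk + 1) * tc) x) < 2 * 3 ^ ((kk + 1) * tc) * card V"
      using N kk by (simp add: field_simps del: power_Suc mult_Suc)
    then have "real (kk * walk_dev V ?E ((kk + 1) * tc) x) < real (2 * 3 ^ ((kk + 1) * tc) * card V)"
      by (simp del: mult_Suc)
    then show ?thesis by (simp only: of_nat_less_iff)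
  qed
  have 3: "0 < walks V ?E t x y" if "x \<in> V" "y \<in> V" for x y
    using t[OF that] by (simp add: pw_walks[OF that(1)] zero_less_divide_iff)
  have "good q kk V ?E tc t"
    unfolding good_def
  proof (intro conjI ballI allI impI)
  qed (rule fin_V tc nb_irrefl deg ch 1 2 3 nb_sym; assumption)+
  then show ?thesis by blast
qed

end

lemma count_branch:
  assumes "M > 0"
  shows "(\<Sum>i<M * h + r. if M dvd i \<or> M * h \<le> i then 1 else 0) = h + (r :: nat)"
proof -
  have 1: "(\<Sum>i<M * h. if M dvd i then 1 else 0) = h" for h :: nat
  proof (induction h)
    case (Suc h)
    have "(\<Sum>i<M * Suc h. if M dvd i then 1 else 0)
        = (\<Sum>i<M * h. if M dvd i then 1 else 0) + (\<Sum>i=M * h..<M * h + M. if M dvd i then 1 else 0 :: nat)"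
      by (subst sum.atLeastLessThan_concat[of 0, symmetric, simplified atLeast0LessThan]) (auto simp: add.commute)
    also have "(\<Sum>i=M * h..<M * h + M. if M dvd i then 1 else 0) = (\<Sum>j<M. if M dvd M * h + j then 1 else 0 :: nat)"
      using sum.shift_bounds_nat_ivl[of _ 0 "M * h" M] by (simp add: atLeast0LessThan add.commute)
    also have "\<dots> = (\<Sum>j<M. if j = 0 then 1 else 0)"
      by (intro sum.cong refl) (auto simp: dvd_add_right_iff dest: dvd_imp_le)
    also have "\<dots> = 1" using assms by simp
    finally show ?case using Suc by simp
  qed simp
  show ?thesis
  proof (induction r)
    case 0
    have "(\<Sum>i<M * h. if M dvd i \<or> M * h \<le> i then 1 else 0) = (\<Sum>i<M * h. if M dvd i then 1 else 0 :: nat)"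
      by (intro sum.cong) auto
    then show ?case using 1 by simp
  qed simp
qed

text \<open>The order of the choices gives the uniform expansion: \<open>a\<close>, \<open>M\<close>
  and \<open>qq\<close> come from \<open>lamB\<close> alone. For a given \<open>kk\<close>,
  \<open>R0\<close> makes the tree high compared with \<open>q\<close>, and at last \<open>q\<close>
  is taken large.\<close>

theorem good_exists: "\<exists>q. \<forall>k\<ge>1. \<exists>(V :: vert set) E T t. good q k V E T t"
proof -
  have lam: "0 \<le> lamB" "lamB < 1" by (auto simp: lamB_def gB_def)
  obtain a where a: "(lamB\<^sup>2) ^ a < 1/2"
    using real_arch_pow_inv[of "1/2" "lamB\<^sup>2"] lam by (auto simp: power_less_one_iff abs_square_less_1)
  \<comment> \<open>The sum of the numbers below \<open>a + 2\<close> contains the summand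
    \<open>a\<close>.\<close>
  define M where "M = a + 2"
  have M: "M > 0" by (simp add: M_def)
  have aM: "a \<le> (\<Sum>i<M. i)" by (simp add: M_def)
  define Kc :: real where "Kc = 6 * M + 3"
  define gc :: real where "gc = (1 + (3 - 1) * 2000000) / (1 / (4 * Kc\<^sup>2)) + 2000000"
  define qq where "qq = nat \<lceil>gc\<rceil> + 1"
  have qq: "gc < real qq" unfolding qq_def by linarith
  have "\<exists>(V :: vert set) E T t. good qq kk V E T t" if kk: "kk \<ge> 1" for kk
  proof -
    define c :: real where "c = 1 / (2 * kk + 1)"
    define \<theta> where "\<theta> = c / (8 * Kc\<^sup>2)"
    have c01: "0 < c" "c < 1" using kk by (auto simp: c_def)
    have Kc: "Kc \<ge> 3" by (simp add: Kc_def)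
    have \<theta>: "\<theta> > 0" using c01 Kc by (simp add: \<theta>_def)
    \<comment> \<open>For \<open>q \<ge> 1\<close> the numerator times \<open>q\<close> bounds the
      left side of the hypothesis \<open>big\<close> of \<open>TV_end_bound\<close>, and
      \<open>D H\<close> will be at least \<open>3 * R0 * q\<close>.\<close>
    obtain R0 :: nat where R0: "real R0 \<ge> (kk + 3 + 6 * a + 2 * Kc) / c" using real_arch_simple by blast
    have cR: "c * R0 \<ge> kk + 3 + 6 * a + 2 * Kc" using R0 c01 by (simp add: field_simps)
    \<comment> \<open>An odd \<open>h\<close> and an even \<open>r\<close> make the name length
      \<open>1 + h + r\<close> of the leaves even, as required for an expander with
      \<open>2 ^ (2 * n)\<close> vertices.\<close>
    define h where "h q = 2 * (R0 * q) + 1" for q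
    define H where "H q = M * h q" for q
    define A Bq where "A = Kc * M" and "Bq = Kc * M * (2 * R0)"
    define W where "W q = A + Bq * real q" for q
    have KH: "Kc * H q = W q" for q by (simp add: W_def A_def Bq_def H_def h_def algebra_simps)
    define z where "z = exp (-\<theta>)"
    define z' where "z' = exp (- (\<theta> * c / 2))"
    have z: "0 \<le> z" "z < 1" "0 \<le> z'" "z' < 1" using \<theta> c01 by (auto simp: z_def z'_def)
    \<comment> \<open>\<open>F\<close> and \<open>F'\<close> are the errors of
      \<open>TV_end_bound\<close> and \<open>TV_start_bound\<close> in terms of \<open>W\<close>,
      which bounds \<open>H\<close> and \<open>D H\<close> and is linear in \<open>q\<close>. Every
      term has a geometric factor, so both tend to 0.\<close>
    define F where "F q = W q * (1/4) ^ q + (z ^ q + 6 * W q * z ^ q) + ((1/2) ^ q + 2 * W q * (1/4) ^ q)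
      + lamB ^ q * (12 * (1 + 2 * W q))" for q
    define F' where "F' q = W q * (1/4) ^ q + z' ^ q" for q
    have lW: "(\<lambda>q. W q * y ^ q) \<longlonglongrightarrow> 0" if "0 \<le> y" "y < 1" for y
      unfolding W_def by (rule lin_geo[OF that])
    have lp: "(\<lambda>q. y ^ q) \<longlonglongrightarrow> 0" if "0 \<le> y" "y < 1" for y :: real
      using that by (intro LIMSEQ_power_zero) auto
    have "(\<lambda>q. W q * (1/4) ^ q + (z ^ q + 6 * (W q * z ^ q)) + ((1/2) ^ q + 2 * (W q * (1/4) ^ q))
      + (12 * lamB ^ q + 24 * (W q * lamB ^ q))) \<longlonglongrightarrow> 0 + (0 + 6 * 0) + (0 + 2 * 0) + (12 * 0 + 24 * 0)"
      by (intro tendsto_add tendsto_mult tendsto_const lW lp) (use z lam in auto)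
    moreover have "F = (\<lambda>q. W q * (1/4) ^ q + (z ^ q + 6 * (W q * z ^ q)) + ((1/2) ^ q + 2 * (W q * (1/4) ^ q))
      + (12 * lamB ^ q + 24 * (W q * lamB ^ q)))"
      by (rule ext) (simp add: F_def algebra_simps)
    ultimately have "F \<longlonglongrightarrow> 0" by simp
    then have e1: "eventually (\<lambda>q. F q < 1 / kk) sequentially"
      using kk by (intro order_tendstoD) auto
    have "F' \<longlonglongrightarrow> 0 + 0" unfolding F'_def by (intro tendsto_add lW lp) (use z in auto)
    then have e2: "eventually (\<lambda>q. F' q < 1 / kk) sequentially"
      using kk by (intro order_tendstoD) auto
    obtain q where q: "F q < 1 / kk" "F' q < 1 / kk" "q \<ge> kk" "q \<ge> 1"
      using eventually_happens[OF eventually_conj[OF e1 eventually_conj[OF e2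
        eventually_conj[OF eventually_ge_at_top[of kk] eventually_ge_at_top[of 1]]]]] by auto
    define r where "r = 2 * q"
    define n where "n = R0 * q + q + 1"
    define L where "L = H q + r"
    define br where "br = (\<lambda>l. M dvd l \<or> H q \<le> l)"
    define b where "b = (\<lambda>l. 1 + (\<Sum>i<l. if br i then 1 else 0 :: nat))"
    have bL: "b L = 2 * n"
      using count_branch[OF M, of "h q" r] by (simp add: b_def br_def L_def H_def h_def r_def n_def)
    have "n > 0" by (simp add: n_def)
    then obtain R U T where
      RR: "bij_betw R {..<2 ^ (2 * n)} {..<2 ^ (2 * n)}" and
      UU: "\<And>v. v < 2 ^ (2 * n) \<Longrightarrow> U v < 2 ^ (2 * n) \<and> U (U v) = v \<and> U v \<noteq> v" and
      TT: "\<And>v. v < 2 ^ (2 * n) \<Longrightarrow> T v < 2 ^ (2 * n) \<and> T (T v) = v \<and> T v \<noteq> v" and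
      ex: "\<And>f :: nat \<Rightarrow> real. (\<Sum>v<2 ^ (2 * n). f v) = 0 \<Longrightarrow> (\<Sum>v<2 ^ (2 * n). (f v)\<^sup>2)
      \<le> 216 * ((\<Sum>v<2 ^ (2 * n). (f v - f (R v))\<^sup>2)
        + (\<Sum>v<2 ^ (2 * n). (f v - f (U v))\<^sup>2) + (\<Sum>v<2 ^ (2 * n). (f v - f (T v))\<^sup>2))"
      using expander_exists by blast
    define R' where "R' = inv_into {..<2 ^ (2 * n)} R"
    have R1: "R v < 2 ^ (2 * n) \<and> R' (R v) = v" if "v < 2 ^ (2 * n)" for v
      using that bij_betwE[OF RR] bij_betw_inv_into_left[OF RR] by (auto simp: R'_def)
    have R2: "R' v < 2 ^ (2 * n) \<and> R (R' v) = v" if "v < 2 ^ (2 * n)" for v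
      using that bij_betwE[OF bij_betw_inv_into[OF RR]] bij_betw_inv_into_right[OF RR] by (auto simp: R'_def)
    have bL': "1 + (\<Sum>i<H q + r. if M dvd i \<or> H q \<le> i then 1 else 0) = 2 * n"
      using bL by (simp add: b_def br_def L_def)
    have "tree_graph M (H q) r R R' U T"
      by (unfold tree_graph_def bL') (use M q R1 R2 UU TT ex in \<open>auto simp: r_def\<close>)
    then interpret tree_graph M "H q" r R R' U T L br b
      by (simp_all only: L_def br_def b_def)
    have KK: "tree_graph.K M = Kc" by (simp add: Kc_def K_def)
    have gg: "tree_graph.gG M = gc" by (simp add: gc_def gG_def KK)
    define Dq where "Dq = D (H q)"
    define tc where "tc = nat \<lfloor>Dq / (kk + 1/2)\<rfloor>"
    have "real (1 * (2 * (R0 * q))) \<le> real (H q)"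
      unfolding H_def h_def of_nat_le_iff using M by (intro mult_le_mono) auto
    then have D3: "3 * (R0 * real q) \<le> Dq" using H_le_D by (simp add: Dq_def)
    have DW: "Dq \<le> W q" using D_le_H by (simp add: Dq_def KK KH)
    have D0: "0 \<le> Dq" by (simp add: Dq_def D_nonneg)
    have HW: "real (H q) \<le> W q" using Kc mult_right_mono[of 1 Kc "real (H q)"] by (simp add: KH)
    have q1: "real q \<ge> 1" using q by simp
    have R3: "real R0 \<ge> kk + 3"
    proof -
      have "c * R0 \<le> 1 * real R0" using c01 by (intro mult_right_mono) auto
      then show ?thesis using cR Kc of_nat_0_le_iff[of a, where ?'a = real] by linarith
    qed
    have "3 * real R0 * 1 \<le> 3 * real R0 * q" using q1 by (intro mult_left_mono) auto
    then have Dk: "3 * real R0 \<le> Dq" using D3 by simp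
    have "1 * real q \<le> 3 * real R0 * q" using R3 by (intro mult_right_mono) auto
    then have Dqq: "real q \<le> Dq" using D3 by simp
    have r4: "(1/2::real) ^ r = (1/4) ^ q" by (simp add: r_def power_mult power2_eq_square)
    have big: "kk + 1 + 2 * a + (4 * a + 2 + 2 * Kc) * q \<le> 3 * c / 4 * Dq"
    proof -
      have "(real kk + 1 + 2 * real a) * 1 \<le> (real kk + 1 + 2 * real a) * real q" using q1 by (intro mult_left_mono) auto
      then have "kk + 1 + 2 * a + (4 * a + 2 + 2 * Kc) * q \<le> (kk + 3 + 6 * a + 2 * Kc) * q"
        by (simp add: algebra_simps)
      also have "\<dots> \<le> c * R0 * q" using cR by (intro mult_right_mono) auto
      also have "\<dots> \<le> 3 * c / 4 * (3 * (R0 * real q))"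
        using c01 mult_nonneg_nonneg[of c "R0 * real q"] by simp
      also have "\<dots> \<le> 3 * c / 4 * Dq" using D3 c01 by (intro mult_left_mono) auto
      finally show ?thesis .
    qed
    have W0: "0 \<le> W q" using D0 DW by simp
    have zq: "exp (- \<theta> * real q) = z ^ q" by (simp add: z_def exp_of_nat_mult[symmetric] mult_ac)
    have start: "TV s (Tr 0 0) > 1 - 1 / kk" if "s \<le> kk * tc" for s
    proof -
      have "TV s (Tr 0 0) \<ge> 1 - H q * (1/2) ^ r - exp (- (\<theta> * c / 2) * Dq)"
        unfolding Dq_def
        by (rule TV_start_bound[OF kk c_def _ _ that]) (simp_all add: \<theta>_def KK tc_def Dq_def)
      moreover have "H q * (1/2) ^ r \<le> W q * (1/4) ^ q"
        unfolding r4 using HW by (intro mult_right_mono) auto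
      moreover have "exp (- (\<theta> * c / 2) * Dq) \<le> z' ^ q"
      proof -
        have "(\<theta> * c / 2) * q \<le> (\<theta> * c / 2) * Dq" using Dqq \<theta> c01 by (intro mult_left_mono) auto
        then have "exp (- (\<theta> * c / 2) * Dq) \<le> exp (real q * - (\<theta> * c / 2))" by (simp add: mult_ac)
        then show ?thesis by (simp only: z'_def exp_of_nat_mult)
      qed
      ultimately show ?thesis using q(2) unfolding F'_def by linarith
    qed
    have fin: "TV ((kk + 1) * tc) x < 1 / kk" if x: "x \<in> V" for x
    proof -
      have "TV ((kk + 1) * tc) x \<le> H q * (1/2) ^ r + (exp (- \<theta> * q) + 6 * Dq * exp (- \<theta> * q))
        + ((1/2) ^ q + 2 * Dq * (1/2) ^ r) + lamB ^ q * (12 * (1 + 2 * Dq))"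
        unfolding Dq_def
        by (rule TV_end_bound[OF kk c_def _ _ r_def aM _ _ x])
          (use a big in \<open>simp_all add: \<theta>_def KK tc_def Dq_def power_mult\<close>)
      also have "\<dots> \<le> F q"
        unfolding F_def r4 zq using HW DW lam z
        by (intro add_mono mult_mono mult_left_mono mult_right_mono order_refl) (auto simp: W0 D0)
      also have "\<dots> < 1 / kk" by (rule q)
      finally show ?thesis .
    qed
    have "tc > 0"
    proof -
      have "real kk + 1/2 \<le> Dq" using Dk R3 by linarith
      then have "1 \<le> Dq / (kk + 1/2)" by simp
      then show ?thesis unfolding tc_def by linarith
    qed
    moreover have "kk \<le> card V"
    proof -
      have "kk < 2 ^ kk" by (rule less_exp)
      also have "\<dots> \<le> (2::nat) ^ b L" using q by (intro power_increasing) (auto simp: bL n_def)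
      also have "\<dots> \<le> card V" by (rule card_V_ge)
      finally show ?thesis by simp
    qed
    moreover have "tree_graph.gG M < real qq" using qq gg by simp
    ultimately have "\<exists>t. good qq kk V (\<lambda>x y. y \<in> nb x) tc t"
      using kk start fin by (intro good_tree) auto
    then show ?thesis by blast
  qed
  then show ?thesis by blast
qed

section \<open>Recursive functions\<close>

lemma arg_Cons [simp]: "arg 0 (x # xs) = x" "arg (Suc i) (x # xs) = arg i xs"
  by (auto simp: arg_def)

lemma arg_tl: "arg i (tl xs) = arg (Suc i) xs"
  by (cases xs) (auto simp: arg_def)

text \<open>Finite dependence bridges argument lists of arbitrary length and the rule
  \<open>comp\<close>, which composes with finitely many functions.\<close>

lemma recursive_support:
  assumes "recursive f"
  shows "\<exists>d. \<forall>xs ys. (\<forall>i<d. arg i xs = arg i ys) \<longrightarrow> f xs = f ys"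
  using assms
proof induction
  case zero
  then show ?case by auto
next
  case succ
  then show ?case by (intro exI[of _ 1]) auto
next
  case (proj i)
  then show ?case by (intro exI[of _ "Suc i"]) auto
next
  case (comp f gs)
  have "\<exists>d. \<forall>g\<in>set gs. \<forall>xs ys. (\<forall>i<d. arg i xs = arg i ys) \<longrightarrow> g xs = g ys"
    using comp(3)
  proof (induction gs)
    case (Cons g gs)
    obtain d1 where "\<forall>xs ys. (\<forall>i<d1. arg i xs = arg i ys) \<longrightarrow> g xs = g ys"
      using Cons.prems by auto
    moreover obtain d2 where
      "\<forall>g\<in>set gs. \<forall>xs ys. (\<forall>i<d2. arg i xs = arg i ys) \<longrightarrow> g xs = g ys"
      using Cons by auto
    ultimately show ?case by (intro exI[of _ "max d1 d2"]) auto
  qed auto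
  then obtain d where d: "\<And>g xs ys. g \<in> set gs \<Longrightarrow> (\<forall>i<d. arg i xs = arg i ys) \<Longrightarrow> g xs = g ys" by metis
  show ?case
  proof (intro exI[of _ d] allI impI)
    fix xs ys assume "\<forall>i<d. arg i xs = arg i ys"
    then have "map (\<lambda>g. g xs) gs = map (\<lambda>g. g ys) gs" using d by (intro map_cong) auto
    then show "f (map (\<lambda>g. g xs) gs) = f (map (\<lambda>g. g ys) gs)" by (simp only:)
  qed
next
  case (prec f g)
  then obtain d1 d2 where
    d1: "\<And>xs ys. (\<forall>i<d1. arg i xs = arg i ys) \<Longrightarrow> f xs = f ys" and
    d2: "\<And>xs ys. (\<forall>i<d2. arg i xs = arg i ys) \<Longrightarrow> g xs = g ys" by metis
  show ?case
  proof (intro exI[of _ "Suc (max d1 d2)"] allI impI)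
    fix xs ys assume a: "\<forall>i<Suc (max d1 d2). arg i xs = arg i ys"
    have t: "arg i (tl xs) = arg i (tl ys)" if "i < max d1 d2" for i
      using a that by (simp add: arg_tl)
    have "rec_nat (f (tl xs)) (\<lambda>n r. g (n # r # tl xs)) m = rec_nat (f (tl ys)) (\<lambda>n r. g (n # r # tl ys)) m" for m
    proof (induction m)
      case 0
      show ?case using t by (auto intro: d1)
    next
      case (Suc m)
      have "g (m # r # tl xs) = g (m # r # tl ys)" for r
      proof (rule d2, intro allI impI)
        fix i assume "i < d2"
        then show "arg i (m # r # tl xs) = arg i (m # r # tl ys)"
          using t by (cases i; cases "i - 1") auto
      qed
      then show ?case using Suc by simp
    qed
    then show "rec_nat (f (tl xs)) (\<lambda>n r. g (n # r # tl xs)) (arg 0 xs)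
        = rec_nat (f (tl ys)) (\<lambda>n r. g (n # r # tl ys)) (arg 0 ys)"
      using a by simp
  qed
next
  case (minim f)
  then obtain d where d: "\<And>xs ys. (\<forall>i<d. arg i xs = arg i ys) \<Longrightarrow> f xs = f ys" by metis
  show ?case
  proof (intro exI[of _ d] allI impI)
    fix xs ys assume a: "\<forall>i<d. arg i xs = arg i ys"
    have "f (n # xs) = f (n # ys)" for n
    proof (rule d, intro allI impI)
      fix i assume "i < d"
      then show "arg i (n # xs) = arg i (n # ys)" using a by (cases i) auto
    qed
    then show "(LEAST n. f (n # xs) = 0) = (LEAST n. f (n # ys) = 0)" by simp
  qed
qed

lemma recursive_subst:
  assumes "recursive F" and "\<And>i. recursive (\<lambda>xs. arg i (\<sigma> xs))"
  shows "recursive (\<lambda>xs. F (\<sigma> xs))"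
proof -
  obtain d where d: "\<And>xs ys. (\<forall>i<d. arg i xs = arg i ys) \<Longrightarrow> F xs = F ys"
    using recursive_support[OF assms(1)] by metis
  let ?gs = "map (\<lambda>i xs. arg i (\<sigma> xs)) [0..<d]"
  have "F (\<sigma> xs) = F (map (\<lambda>g. g xs) ?gs)" for xs
    by (rule d) (auto simp: arg_def)
  moreover have "recursive (\<lambda>xs. F (map (\<lambda>g. g xs) ?gs))"
    using assms by (intro recursive.comp) auto
  ultimately show ?thesis by simp
qed

lemma rec_arg: "recursive (\<lambda>xs. arg i xs)"
  by (rule recursive.proj)

lemma rec_arg_tl: "recursive (\<lambda>xs. arg (Suc i) (\<tau> xs)) \<Longrightarrow> recursive (\<lambda>xs. arg i (tl (\<tau> xs)))"
  by (simp add: arg_tl)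

text \<open>A new variable is bound as the head of the argument list; bounded sums, quantifiers and
  searches all treat their variable in this way.\<close>

lemma rec_push:
  assumes "recursive (\<lambda>ys. g (arg 0 ys) (tl ys))" "recursive f"
  shows "recursive (\<lambda>xs. g (f xs) xs)"
proof -
  have "recursive (\<lambda>xs. arg i (f xs # xs))" for i
    by (cases i) (use assms(2) in \<open>auto intro: rec_arg\<close>)
  from recursive_subst[OF assms(1) this] show ?thesis by simp
qed

lemma rec_tl: "recursive f \<Longrightarrow> recursive (\<lambda>xs. f (tl xs))"
  by (rule recursive_subst) (auto simp: arg_tl intro: rec_arg)

lemma rec_Suc: "recursive f \<Longrightarrow> recursive (\<lambda>xs. Suc (f xs))"
  by (rule rec_push[of "\<lambda>y xs. Suc y"]) (auto intro: recursive.succ)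

lemma rec_const: "recursive (\<lambda>xs. c)"
  by (induction c) (auto intro: recursive.zero rec_Suc)

lemma rec_nat_rec:
  assumes "recursive a" "recursive (\<lambda>ys. g (arg 0 ys) (arg 1 ys) (tl (tl ys)))" "recursive f"
  shows "recursive (\<lambda>xs. rec_nat (a xs) (\<lambda>n r. g n r xs) (f xs))"
proof -
  have "recursive (\<lambda>ys. rec_nat (a (tl ys)) (\<lambda>n r. g n r (tl ys)) (arg 0 ys))"
    using recursive.prec[OF assms(1,2)] by simp
  from rec_push[OF this assms(3)] show ?thesis .
qed

lemma rec_add: "recursive f \<Longrightarrow> recursive g \<Longrightarrow> recursive (\<lambda>xs. f xs + g xs)"
proof -
  assume fg: "recursive f" "recursive g"
  have "rec_nat m (\<lambda>_. Suc) n = m + n" for m n by (induction n) auto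
  then show ?thesis
    using rec_nat_rec[of f "\<lambda>n r xs. Suc r" g] fg by (simp add: rec_Suc rec_arg)
qed

lemma rec_mult: "recursive f \<Longrightarrow> recursive g \<Longrightarrow> recursive (\<lambda>xs. f xs * g xs)"
proof -
  assume fg: "recursive f" "recursive g"
  have "rec_nat 0 (\<lambda>_ r. r + m) n = m * n" for m n :: nat by (induction n) auto
  then show ?thesis
    using rec_nat_rec[of "\<lambda>_. 0" "\<lambda>n r xs. r + f xs" g] fg
    by (simp add: rec_add rec_arg rec_const rec_tl[OF rec_tl])
qed

lemma rec_power: "recursive f \<Longrightarrow> recursive g \<Longrightarrow> recursive (\<lambda>xs. f xs ^ g xs)"
proof -
  assume fg: "recursive f" "recursive g"
  have "rec_nat 1 (\<lambda>_ r. r * m) n = m ^ n" for m n :: nat by (induction n) auto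
  then show ?thesis
    using rec_nat_rec[of "\<lambda>_. 1" "\<lambda>n r xs. r * f xs" g] fg
    by (simp add: rec_mult rec_arg rec_const rec_tl[OF rec_tl])
qed

lemma rec_diff: "recursive f \<Longrightarrow> recursive g \<Longrightarrow> recursive (\<lambda>xs. f xs - g xs)"
proof -
  assume fg: "recursive f" "recursive g"
  have p: "rec_nat 0 (\<lambda>n _. n) m = m - 1" for m :: nat by (cases m) auto
  have pred: "recursive (\<lambda>xs. h xs - 1)" if "recursive h" for h
    using rec_nat_rec[of "\<lambda>_. 0" "\<lambda>n r xs. n" h] that by (simp add: p rec_arg rec_const)
  have "rec_nat m (\<lambda>_ r. r - 1) n = m - n" for m n :: nat by (induction n) auto
  then show ?thesis
    using rec_nat_rec[of f "\<lambda>n r xs. r - 1" g] fg by (simp add: pred[unfolded One_nat_def] rec_arg)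
qed

lemma rec_sum:
  assumes "recursive f" "recursive (\<lambda>ys. g (arg 0 ys) (tl ys))"
  shows "recursive (\<lambda>xs. \<Sum>i<f xs. g i xs)"
proof -
  have s: "rec_nat 0 (\<lambda>n r. r + h n) m = (\<Sum>i<m. h i)" for h :: "nat \<Rightarrow> nat" and m
    by (induction m) auto
  have "recursive (\<lambda>ys. g (arg 0 ys) (tl (tl ys)))"
  proof -
    have "recursive (\<lambda>ys. arg i (arg 0 ys # tl (tl ys)))" for i
      by (cases i) (auto simp: arg_tl intro: rec_arg)
    from recursive_subst[OF assms(2) this] show ?thesis by simp
  qed
  then have "recursive (\<lambda>ys. arg 1 ys + g (arg 0 ys) (tl (tl ys)))" by (intro rec_add rec_arg)
  from rec_nat_rec[OF rec_const this assms(1), of 0] show ?thesis by (simp add: s)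
qed

section \<open>Decidable predicates, bounded quantifiers and search\<close>

definition decidable :: "(nat list \<Rightarrow> bool) \<Rightarrow> bool" where
  "decidable P \<longleftrightarrow> recursive (\<lambda>xs. if P xs then 1 else 0)"

lemma dec_eq_0: "recursive f \<Longrightarrow> decidable (\<lambda>xs. f xs = 0)"
proof -
  assume f: "recursive f"
  have "(if f xs = 0 then 1 else 0) = 1 - f xs" for xs by simp
  then show ?thesis unfolding decidable_def by (simp only:) (intro rec_diff rec_const f)
qed

lemma dec_not: "decidable P \<Longrightarrow> decidable (\<lambda>xs. \<not> P xs)"
proof -
  assume "decidable P"
  then have "decidable (\<lambda>xs. (if P xs then 1 else 0 :: nat) = 0)"
    unfolding decidable_def[of P] by (rule dec_eq_0)
  moreover have "((if P xs then 1 else 0 :: nat) = 0) = (\<not> P xs)" for xs by simp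
  ultimately show ?thesis by simp
qed

lemma dec_conj: "decidable P \<Longrightarrow> decidable Q \<Longrightarrow> decidable (\<lambda>xs. P xs \<and> Q xs)"
proof -
  assume PQ: "decidable P" "decidable Q"
  have "(if P xs \<and> Q xs then 1 else 0) = (if P xs then 1 else 0) * (if Q xs then 1 else 0 :: nat)" for xs
    by simp
  then show ?thesis using PQ unfolding decidable_def by (simp only: rec_mult)
qed

lemma dec_imp: "decidable P \<Longrightarrow> decidable Q \<Longrightarrow> decidable (\<lambda>xs. P xs \<longrightarrow> Q xs)"
  using dec_not[OF dec_conj[OF _ dec_not], of P Q] by simp

lemma dec_le: "recursive f \<Longrightarrow> recursive g \<Longrightarrow> decidable (\<lambda>xs. f xs \<le> g xs)"
  using dec_eq_0[OF rec_diff, of f g] by simp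

lemma dec_less: "recursive f \<Longrightarrow> recursive g \<Longrightarrow> decidable (\<lambda>xs. f xs < g xs)"
  using dec_not[OF dec_le, of g f] by (simp add: not_le)

lemma dec_eq: "recursive f \<Longrightarrow> recursive g \<Longrightarrow> decidable (\<lambda>xs. f xs = g xs)"
  using dec_conj[OF dec_le dec_le, of f g g f] by (simp add: eq_iff)

lemma rec_if: "decidable P \<Longrightarrow> recursive f \<Longrightarrow> recursive g \<Longrightarrow> recursive (\<lambda>xs. if P xs then f xs else g xs)"
proof -
  assume a: "decidable P" "recursive f" "recursive g"
  have "(if P xs then f xs else g xs)
      = (if P xs then 1 else 0) * f xs + (1 - (if P xs then 1 else 0)) * g xs" for xs by simp
  then show ?thesis using a unfolding decidable_def by (simp only: rec_mult rec_add rec_diff rec_const)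
qed

lemma dec_all:
  assumes "recursive f" "decidable (\<lambda>ys. P (arg 0 ys) (tl ys))"
  shows "decidable (\<lambda>xs. \<forall>i<f xs. P i xs)"
proof -
  have "recursive (\<lambda>xs. \<Sum>i<f xs. if P i xs then 0 else 1)"
    by (intro rec_sum assms rec_if rec_const)
  from dec_eq_0[OF this] show ?thesis
    by (rule back_subst[of decidable]) (auto intro!: ext)
qed

lemma dec_ex:
  assumes "recursive f" "decidable (\<lambda>ys. P (arg 0 ys) (tl ys))"
  shows "decidable (\<lambda>xs. \<exists>i<f xs. P i xs)"
  using dec_not[OF dec_all[OF assms(1) dec_not[OF assms(2)]]] by simp

lemma rec_Least:
  assumes "decidable (\<lambda>ys. P (arg 0 ys) (tl ys))" "\<And>xs. \<exists>n. P n xs"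
  shows "recursive (\<lambda>xs. LEAST n. P n xs)"
proof -
  have "recursive (\<lambda>ys. if P (arg 0 ys) (tl ys) then 0 else 1)"
    using assms(1) by (intro rec_if rec_const)
  moreover have "((if P n xs then 0 else 1 :: nat) = 0) = P n xs" for n xs by simp
  ultimately show ?thesis
    using recursive.minim[of "\<lambda>ys. if P (arg 0 ys) (tl ys) then 0 else 1"] assms(2) by simp
qed

text \<open>Division as a search. The disjunct \<open>n = 0\<close> makes the search total and
  returns 0, in agreement with \<open>m div 0\<close>.\<close>

lemma rec_div: "recursive f \<Longrightarrow> recursive g \<Longrightarrow> recursive (\<lambda>xs. f xs div g xs)"
proof -
  assume fg: "recursive f" "recursive g"
  have eq: "m div n = (LEAST i. n = 0 \<or> m < Suc i * n)" for m n :: nat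
  proof (cases "n = 0")
    case False
    have "m < Suc (m div n) * n" using False dividend_less_div_times[of n m] by (simp add: mult.commute add.commute)
    moreover have "m div n \<le> i" if "m < Suc i * n" for i
      using less_mult_imp_div_less[OF that] by simp
    ultimately show ?thesis using False by (intro Least_equality[symmetric]) auto
  qed (simp add: Least_equality)
  have ex: "\<exists>i. n = 0 \<or> m < Suc i * n" for m n :: nat
  proof (cases "n = 0")
    case False
    then have "m < Suc m * n" by (cases n) auto
    then show ?thesis by blast
  qed simp
  have or: "n = 0 \<or> m < p \<longleftrightarrow> \<not> (\<not> n = 0 \<and> \<not> m < p)" for m n p :: nat by auto
  show ?thesis
    unfolding eq
    by (rule rec_Least, unfold or)
      (intro dec_not dec_conj dec_eq_0 dec_less rec_mult rec_Suc rec_arg rec_tl fg, use ex in auto)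
qed

lemma rec_mod: "recursive f \<Longrightarrow> recursive g \<Longrightarrow> recursive (\<lambda>xs. f xs mod g xs)"
  unfolding minus_mult_div_eq_mod[symmetric] by (intro rec_diff rec_mult rec_div)

lemmas rec_intros = rec_arg rec_arg_tl rec_const rec_Suc rec_add rec_mult rec_power rec_diff rec_div rec_mod
  rec_sum rec_if dec_not dec_conj dec_imp dec_le dec_less dec_eq dec_all dec_ex

section \<open>Searching for the graphs\<close>

definition dig :: "nat \<Rightarrow> nat \<Rightarrow> nat \<Rightarrow> nat" where "dig w n i = w div n ^ i mod n"

lemma rec_dig: "recursive f \<Longrightarrow> recursive g \<Longrightarrow> recursive h \<Longrightarrow> recursive (\<lambda>xs. dig (f xs) (g xs) (h xs))"
  unfolding dig_def by (intro rec_intros)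

lemma ex_dig:
  assumes "\<And>i. i < l \<Longrightarrow> f i < n"
  shows "\<exists>w<n ^ l. \<forall>i<l. dig w n i = f i"
  using assms
proof (induction l)
  case (Suc l)
  then obtain w where w: "w < n ^ l" "\<And>i. i < l \<Longrightarrow> dig w n i = f i" by fastforce
  have fl: "f l < n" using Suc by simp
  then have n: "n > 0" by simp
  define w' where "w' = w + f l * n ^ l"
  have "f l * n ^ l + n ^ l \<le> n * n ^ l" using fl mult_right_mono[of "Suc (f l)" n "n ^ l"] by simp
  then have "w' < n ^ Suc l" using w by (simp add: w'_def)
  moreover have "dig w' n i = f i" if "i < Suc l" for i
  proof (cases "i = l")
    case True
    then show ?thesis using w fl n by (simp add: dig_def w'_def)
  next
    case False
    then have il: "i < l" using that by simp
    then obtain j where j: "l = i + Suc j" by (metis less_iff_Suc_add add_Suc_right)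
    have "w' = w + (f l * n ^ Suc j) * n ^ i" by (simp add: w'_def j power_add mult_ac)
    then have "w' div n ^ i = w div n ^ i + f l * n ^ Suc j" using n by simp
    also have "\<dots> mod n = w div n ^ i mod n"
      by (simp add: mult.left_commute[of "f l" n])
    finally show ?thesis using w(2)[OF il] by (simp add: dig_def)
  qed
  ultimately show ?case by blast
qed auto

text \<open>The number \<open>w\<close>, read in base \<open>n\<close>, lists the number of vertices, the parameters of the cutoff,
  the adjacency matrix, and the numbers of walks of all relevant lengths.\<close>

definition cN :: "nat \<Rightarrow> nat \<Rightarrow> nat" where "cN w n = dig w n 0"
definition cT :: "nat \<Rightarrow> nat \<Rightarrow> nat" where "cT w n = dig w n 1"
definition cM :: "nat \<Rightarrow> nat \<Rightarrow> nat" where "cM w n = dig w n 2"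
definition cE :: "nat \<Rightarrow> nat \<Rightarrow> nat \<Rightarrow> nat \<Rightarrow> nat" where "cE w n x y = dig w n (3 + (x * cN w n + y))"
definition cW :: "nat \<Rightarrow> nat \<Rightarrow> nat \<Rightarrow> nat \<Rightarrow> nat \<Rightarrow> nat" where
  "cW w n s x y = dig w n (3 + cN w n * cN w n + ((s * cN w n + x) * cN w n + y))"

definition cDev :: "nat \<Rightarrow> nat \<Rightarrow> nat \<Rightarrow> nat \<Rightarrow> nat" where
  "cDev w n s x = (\<Sum>y<cN w n. (cN w n * cW w n s x y - 3 ^ s) + (3 ^ s - cN w n * cW w n s x y))"

text \<open>\<open>good\<close> with bounded quantifiers only. Vertex sets are bit masks
  \<open>m < 2 ^ cN w n\<close>. Walk numbers are not computed but read from a table whose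
  recurrence is checked; \<open>(k + 1) * cT w n \<le> cM w n\<close> ensures that the table reaches
  all the times needed.\<close>

definition cutoff_code :: "nat \<Rightarrow> nat \<Rightarrow> nat \<Rightarrow> nat \<Rightarrow> bool" where
  "cutoff_code q k n w \<longleftrightarrow> k \<le> cN w n \<and> 0 < cT w n \<and> (k + 1) * cT w n \<le> cM w n \<and>
    (\<forall>x<cN w n. \<forall>y<cN w n. cE w n x y = 1 \<longrightarrow> cE w n y x = 1) \<and> (\<forall>x<cN w n. \<not> cE w n x x = 1) \<and>
    (\<forall>x<cN w n. (\<Sum>y<cN w n. if cE w n x y = 1 then 1 else 0) = (3::nat)) \<and>
    (\<forall>m<2 ^ cN w n. 0 < (\<Sum>x<cN w n. dig m 2 x) \<longrightarrow> (\<Sum>x<cN w n. dig m 2 x) < cN w n \<longrightarrow>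
      (if (\<Sum>x<cN w n. dig m 2 x) \<le> cN w n - (\<Sum>x<cN w n. dig m 2 x)
        then (\<Sum>x<cN w n. dig m 2 x) else cN w n - (\<Sum>x<cN w n. dig m 2 x))
      < q * (\<Sum>x<cN w n. \<Sum>y<cN w n. if dig m 2 x = 1 \<and> dig m 2 y = 0 \<and> cE w n x y = 1 then 1 else 0)) \<and>
    (\<forall>x<cN w n. \<forall>y<cN w n. cW w n 0 x y = (if x = y then 1 else 0)) \<and>
    (\<forall>s<cM w n. \<forall>x<cN w n. \<forall>y<cN w n.
      cW w n (Suc s) x y = (\<Sum>z<cN w n. if cE w n x z = 1 then cW w n s z y else 0)) \<and>
    (\<forall>s<Suc (k * cT w n). \<exists>x<cN w n. 2 * (k - 1) * 3 ^ s * cN w n < k * cDev w n s x) \<and>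
    (\<forall>x<cN w n. k * cDev w n ((k + 1) * cT w n) x < 2 * 3 ^ ((k + 1) * cT w n) * cN w n) \<and>
    (\<forall>x<cN w n. \<forall>y<cN w n. 0 < cW w n (cM w n) x y)"

lemma dec_cutoff_code:
  assumes "recursive f" "recursive g" "recursive h"
  shows "decidable (\<lambda>xs. cutoff_code q (f xs) (g xs) (h xs))"
  unfolding cutoff_code_def cDev_def cW_def cE_def cM_def cT_def cN_def
  by (intro rec_intros rec_dig assms[THEN rec_tl] assms rec_tl)

lemma good_facts [rule_format]:
  assumes "good q k V E T t"
  shows "finite V" "k \<le> card V" "0 < T"
    "\<forall>x\<in>V. \<forall>y\<in>V. E x y \<longrightarrow> E y x" "\<forall>x\<in>V. \<not> E x x"
    "\<forall>x\<in>V. (\<Sum>y\<in>V. if E x y then 1 else 0) = (3::nat)"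
    "\<forall>S\<subseteq>V. S \<noteq> {} \<longrightarrow> S \<noteq> V \<longrightarrow>
      min (card S) (card V - card S) < q * (\<Sum>x\<in>S. \<Sum>y\<in>V - S. if E x y then 1 else 0)"
    "\<forall>s\<le>k * T. \<exists>x\<in>V. 2 * (k - 1) * 3 ^ s * card V < k * walk_dev V E s x"
    "\<forall>x\<in>V. k * walk_dev V E ((k + 1) * T) x < 2 * 3 ^ ((k + 1) * T) * card V"
    "\<forall>x\<in>V. \<forall>y\<in>V. 0 < walks V E t x y"
  using assms[unfolded good_def] by - (elim conjE, assumption)+

lemma walks_reindex:
  assumes \<phi>: "bij_betw \<phi> A V"
  shows "x \<in> A \<Longrightarrow> y \<in> A \<Longrightarrow> walks A (\<lambda>x y. E (\<phi> x) (\<phi> y)) t x y = walks V E t (\<phi> x) (\<phi> y)"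
proof (induction t arbitrary: x)
  case 0
  then show ?case using bij_betw_imp_inj_on[OF \<phi>] by (auto simp: inj_on_def)
next
  case (Suc t)
  have "walks A (\<lambda>x y. E (\<phi> x) (\<phi> y)) (Suc t) x y
      = (\<Sum>z\<in>A. if E (\<phi> x) (\<phi> z) then walks V E t (\<phi> z) (\<phi> y) else 0)"
    unfolding walks.simps using Suc by (intro sum.cong) auto
  also have "\<dots> = walks V E (Suc t) (\<phi> x) (\<phi> y)"
    unfolding walks.simps by (rule sum.reindex_bij_betw[OF \<phi>])
  finally show ?case .
qed

lemma good_reindex:
  assumes \<phi>: "bij_betw \<phi> A V" and g: "good q k V E T t"
  shows "good q k A (\<lambda>x y. E (\<phi> x) (\<phi> y)) T t"
proof -
  note inj = bij_betw_imp_inj_on[OF \<phi>] and im = bij_betw_imp_surj_on[OF \<phi>]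
  have in_V: "\<phi> x \<in> V" if "x \<in> A" for x using im that by blast
  have c: "card A = card V" by (rule bij_betw_same_card[OF \<phi>])
  note f = good_facts[OF g]
  have fin: "finite A" using f(1) bij_betw_finite[OF \<phi>] by simp
  have r: "(\<Sum>x\<in>S. F (\<phi> x)) = (\<Sum>x\<in>\<phi> ` S. F x)" if "S \<subseteq> A" for S and F :: "_ \<Rightarrow> nat"
    using inj_on_subset[OF inj that] by (simp add: sum.reindex)
  have dev: "walk_dev A (\<lambda>x y. E (\<phi> x) (\<phi> y)) s x = walk_dev V E s (\<phi> x)" if "x \<in> A" for s x
    unfolding walk_dev_def c sum.reindex_bij_betw[OF \<phi>, symmetric]
    using that by (simp add: walks_reindex[OF \<phi>])
  have ch: "min (card S) (card A - card S) < q * (\<Sum>x\<in>S. \<Sum>y\<in>A - S. if E (\<phi> x) (\<phi> y) then 1 else 0)"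
    if S: "S \<subseteq> A" "S \<noteq> {}" "S \<noteq> A" for S
  proof -
    have "\<phi> ` S \<subseteq> V" "\<phi> ` S \<noteq> {}" using S in_V by auto
    moreover have "\<phi> ` S \<noteq> V" using S inj im inj_on_image_eq_iff[OF inj S(1) order_refl] by simp
    ultimately have "min (card (\<phi> ` S)) (card V - card (\<phi> ` S))
        < q * (\<Sum>x\<in>\<phi> ` S. \<Sum>y\<in>V - \<phi> ` S. if E x y then 1 else 0)"
      by (rule f(7))
    also have "card (\<phi> ` S) = card S" using inj_on_subset[OF inj S(1)] by (rule card_image)
    also have "V - \<phi> ` S = \<phi> ` (A - S)" using inj_on_image_set_diff[OF inj, of A S] S im by simp
    also have "(\<Sum>x\<in>\<phi> ` S. \<Sum>y\<in>\<phi> ` (A - S). if E x y then 1 else 0)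
        = (\<Sum>x\<in>S. \<Sum>y\<in>A - S. if E (\<phi> x) (\<phi> y) then 1 else 0 :: nat)"
      using S(1) by (simp only: r[symmetric] Diff_subset)
    finally show ?thesis unfolding c .
  qed
  have deg: "(\<Sum>y\<in>A. if E (\<phi> x) (\<phi> y) then 1 else 0) = (3::nat)" if "x \<in> A" for x
    using f(6)[OF in_V[OF that]] r[of A "\<lambda>y. if E (\<phi> x) y then 1 else 0"] im by simp
  have 1: "\<exists>x\<in>A. 2 * (k - 1) * 3 ^ s * card A < k * walk_dev A (\<lambda>x y. E (\<phi> x) (\<phi> y)) s x"
    if s: "s \<le> k * T" for s
  proof -
    obtain y where y: "y \<in> V" "2 * (k - 1) * 3 ^ s * card V < k * walk_dev V E s y"
      using f(8)[OF s] by blast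
    then obtain x where "x \<in> A" "y = \<phi> x" using im by blast
    then show ?thesis using y dev c by auto
  qed
  have 2: "k * walk_dev A (\<lambda>x y. E (\<phi> x) (\<phi> y)) ((k + 1) * T) x < 2 * 3 ^ ((k + 1) * T) * card A"
    if x: "x \<in> A" for x
    unfolding dev[OF x] c by (rule f(9)[OF in_V[OF x]])
  have 3: "0 < walks A (\<lambda>x y. E (\<phi> x) (\<phi> y)) t x y" if "x \<in> A" "y \<in> A" for x y
    unfolding walks_reindex[OF \<phi> that] by (intro f(10) in_V that)
  have sym: "E (\<phi> x) (\<phi> y) \<Longrightarrow> E (\<phi> y) (\<phi> x)" and irr: "\<not> E (\<phi> x) (\<phi> x)" if "x \<in> A" "y \<in> A" for x y
    using f(4,5) in_V that by blast+
  have kA: "k \<le> card A" using f(2) c by simp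
  show ?thesis unfolding good_def
  proof (intro conjI ballI allI impI)
  qed (rule fin kA f(3) sym irr deg ch 1 2 3; assumption)+
qed

lemma walks_pos_Suc:
  assumes "good q k V E T t" "x \<in> V" "y \<in> V"
  shows "0 < walks V E (t + j) x y"
  using assms(2)
proof (induction j arbitrary: x)
  case 0
  then show ?case using good_facts(10)[OF assms(1)] assms(3) by simp
next
  case (Suc j)
  have "(\<Sum>z\<in>V. if E x z then 1 else 0 :: nat) \<noteq> 0" using good_facts(6)[OF assms(1) Suc(2)] by simp
  then have "\<exists>z\<in>V. E x z" by (rule contrapos_np) (auto intro!: sum.neutral)
  then obtain z where z: "z \<in> V" "E x z" by blast
  have "0 < (if E x z then walks V E (t + j) z y else 0)" using z Suc by simp
  also have "\<dots> \<le> walks V E (t + Suc j) x y"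
    unfolding add_Suc_right walks.simps using z good_facts(1)[OF assms(1)] by (intro member_le_sum) auto
  finally show ?case .
qed

text \<open>Lets \<open>t\<close> exceed \<open>(k + 1) * T\<close>, since a code stores walk
  numbers only up to the length \<open>t\<close>.\<close>

lemma good_later:
  assumes g: "good q k V E T t"
  shows "good q k V E T (t + j)"
  unfolding good_def
proof (intro conjI)
  show "\<forall>x\<in>V. \<forall>y\<in>V. 0 < walks V E (t + j) x y" using walks_pos_Suc[OF g] by blast
qed (insert g[unfolded good_def], (elim conjE, assumption)+)

lemma mask_sums:
  fixes N m :: nat
  defines "S \<equiv> {x. x < N \<and> dig m 2 x = 1}"
  shows "(\<Sum>x<N. dig m 2 x) = card S"
    "(\<Sum>x<N. \<Sum>y<N. if dig m 2 x = 1 \<and> dig m 2 y = 0 \<and> P x y then 1 else 0)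
      = (\<Sum>x\<in>S. \<Sum>y\<in>{..<N} - S. if P x y then 1 else 0 :: nat)"
proof -
  have d: "dig m 2 x = (if dig m 2 x = 1 then 1 else 0)" for x by (auto simp: dig_def)
  have d0: "dig m 2 x = 0 \<longleftrightarrow> dig m 2 x \<noteq> 1" for x by (auto simp: dig_def)
  have S: "S = {..<N} \<inter> {x. dig m 2 x = 1}" by (auto simp: S_def)
  show "(\<Sum>x<N. dig m 2 x) = card S"
    by (subst d) (simp add: S sum.If_cases)
  have "(\<Sum>x\<in>S. \<Sum>y\<in>{..<N} - S. if P x y then 1 else 0 :: nat)
      = (\<Sum>x<N. if dig m 2 x = 1 then (\<Sum>y\<in>{..<N} - S. if P x y then 1 else 0) else 0)"
    by (subst (2) S) (simp only: sum.inter_restrict finite_lessThan mem_Collect_eq)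
  also have "\<dots> = (\<Sum>x<N. \<Sum>y<N. if dig m 2 x = 1 \<and> dig m 2 y = 0 \<and> P x y then 1 else 0)"
  proof (intro sum.cong refl)
    fix x
    have "{..<N} - S = {..<N} \<inter> {y. dig m 2 y = 0}" by (auto simp: S_def dig_def)
    then have "(\<Sum>y\<in>{..<N} - S. if P x y then 1 else 0 :: nat) = (\<Sum>y<N. if dig m 2 y = 0 then (if P x y then 1 else 0) else 0)"
      by (simp add: sum.inter_restrict)
    then show "(if dig m 2 x = 1 then (\<Sum>y\<in>{..<N} - S. if P x y then 1 else 0 :: nat) else 0)
      = (\<Sum>y<N. if dig m 2 x = 1 \<and> dig m 2 y = 0 \<and> P x y then 1 else 0)"
      by (auto intro!: sum.cong)
  qed
  finally show "(\<Sum>x<N. \<Sum>y<N. if dig m 2 x = 1 \<and> dig m 2 y = 0 \<and> P x y then 1 else 0)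
      = (\<Sum>x\<in>S. \<Sum>y\<in>{..<N} - S. if P x y then 1 else 0 :: nat)" by simp
qed

lemma cutoff_code_facts [rule_format]:
  assumes "cutoff_code q k n w"
  shows "k \<le> cN w n" "0 < cT w n" "(k + 1) * cT w n \<le> cM w n"
    "\<forall>x<cN w n. \<forall>y<cN w n. cE w n x y = 1 \<longrightarrow> cE w n y x = 1"
    "\<forall>x<cN w n. \<not> cE w n x x = 1"
    "\<forall>x<cN w n. (\<Sum>y<cN w n. if cE w n x y = 1 then 1 else 0) = (3::nat)"
    "\<forall>m<2 ^ cN w n. 0 < (\<Sum>x<cN w n. dig m 2 x) \<longrightarrow> (\<Sum>x<cN w n. dig m 2 x) < cN w n \<longrightarrow>
      (if (\<Sum>x<cN w n. dig m 2 x) \<le> cN w n - (\<Sum>x<cN w n. dig m 2 x)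
        then (\<Sum>x<cN w n. dig m 2 x) else cN w n - (\<Sum>x<cN w n. dig m 2 x))
      < q * (\<Sum>x<cN w n. \<Sum>y<cN w n. if dig m 2 x = 1 \<and> dig m 2 y = 0 \<and> cE w n x y = 1 then 1 else 0)"
    "\<forall>x<cN w n. \<forall>y<cN w n. cW w n 0 x y = (if x = y then 1 else 0)"
    "\<forall>s<cM w n. \<forall>x<cN w n. \<forall>y<cN w n.
      cW w n (Suc s) x y = (\<Sum>z<cN w n. if cE w n x z = 1 then cW w n s z y else 0)"
    "\<forall>s<Suc (k * cT w n). \<exists>x<cN w n. 2 * (k - 1) * 3 ^ s * cN w n < k * cDev w n s x"
    "\<forall>x<cN w n. k * cDev w n ((k + 1) * cT w n) x < 2 * 3 ^ ((k + 1) * cT w n) * cN w n"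
    "\<forall>x<cN w n. \<forall>y<cN w n. 0 < cW w n (cM w n) x y"
  using assms[unfolded cutoff_code_def] by - (elim conjE, assumption)+

lemma good_of_code:
  assumes c: "cutoff_code q k n w"
  shows "good q k {..<cN w n} (\<lambda>x y. cE w n x y = 1) (cT w n) (cM w n)"
proof -
  define N where "N = cN w n"
  define T where "T = cT w n"
  define E where "E = (\<lambda>x y. cE w n x y = 1)"
  note f = cutoff_code_facts[OF c, folded N_def T_def]
  have W: "walks {..<N} E s x y = cW w n s x y" if "s \<le> cM w n" "x < N" "y < N" for s x y
    using that
  proof (induction s arbitrary: x)
    case (Suc s)
    have "walks {..<N} E (Suc s) x y = (\<Sum>z<N. if cE w n x z = 1 then cW w n s z y else 0)"
      unfolding walks.simps using Suc by (intro sum.cong refl) (auto simp: E_def)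
    then show ?case using f(9)[of s x y] Suc by simp
  qed (simp add: f)
  have le: "k * T \<le> (k + 1) * T" by simp
  have dev: "walk_dev {..<N} E s x = cDev w n s x" if "s \<le> (k + 1) * T" "x < N" for s x
    unfolding walk_dev_def cDev_def N_def[symmetric] using that f(3) W[of s x] by simp
  have ch: "min (card S) (card {..<N} - card S) < q * (\<Sum>x\<in>S. \<Sum>y\<in>{..<N} - S. if E x y then 1 else 0)"
    if S: "S \<subseteq> {..<N}" "S \<noteq> {}" "S \<noteq> {..<N}" for S
  proof -
    obtain m where m: "m < 2 ^ N" "\<And>i. i < N \<Longrightarrow> dig m 2 i = (if i \<in> S then 1 else 0)"
    proof -
      have "(if i \<in> S then 1 else 0) < (2::nat)" for i by simp
      then show ?thesis using ex_dig[of N "\<lambda>i. if i \<in> S then 1 else 0" 2] that by blast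
    qed
    have Sm: "S = {x. x < N \<and> dig m 2 x = 1}" using S m(2) by (auto split: if_splits)
    have "finite S" using S by (auto intro: finite_subset)
    then have "0 < card S" using S by (simp add: card_gt_0_iff)
    moreover have "card S < N" using psubset_card_mono[of "{..<N}" S] S by auto
    ultimately show ?thesis
      using f(7)[OF m(1)] unfolding mask_sums Sm[symmetric] E_def by (simp add: min_def)
  qed
  have 1: "\<exists>x\<in>{..<N}. 2 * (k - 1) * 3 ^ s * card {..<N} < k * walk_dev {..<N} E s x" if "s \<le> k * T" for s
    using f(10)[of s] that dev[of s] le by fastforce
  have 2: "k * walk_dev {..<N} E ((k + 1) * T) x < 2 * 3 ^ ((k + 1) * T) * card {..<N}" if "x \<in> {..<N}" for x
    using f(11)[of x] dev[of "(k + 1) * T" x] that by (simp only: lessThan_iff card_lessThan order_refl)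
  have 3: "0 < walks {..<N} E (cM w n) x y" if "x \<in> {..<N}" "y \<in> {..<N}" for x y
    using f(12)[of x y] W[of "cM w n" x y] that by simp
  have sym: "E y x" if "x \<in> {..<N}" "y \<in> {..<N}" "E x y" for x y using f(4) that by (auto simp: E_def)
  have irr: "\<not> E x x" if "x \<in> {..<N}" for x using f(5) that by (auto simp: E_def)
  have deg: "(\<Sum>y\<in>{..<N}. if E x y then 1 else 0) = (3::nat)" if "x \<in> {..<N}" for x
    using f(6) that by (simp add: E_def)
  have card: "k \<le> card {..<N}" using f(1) by simp
  show ?thesis unfolding N_def[symmetric] T_def[symmetric] E_def[symmetric] good_def
  proof (intro conjI ballI allI impI)
  qed (rule finite_lessThan card f(2) sym irr deg ch 1 2 3; assumption)+
qed

lemma code_of_good: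
  assumes g0: "good q k V E0 T t0"
  shows "\<exists>n. \<exists>w<n ^ n. cutoff_code q k n w"
proof -
  define N where "N = card V"
  obtain \<phi> where \<phi>: "bij_betw \<phi> {..<N} V"
    using finite_same_card_bij[of "{..<N}" V] good_facts(1)[OF g0] by (auto simp: N_def)
  define E where "E = (\<lambda>x y. E0 (\<phi> x) (\<phi> y))"
  define t where "t = t0 + (k + 1) * T"
  have g: "good q k {..<N} E T t"
    unfolding E_def t_def by (rule good_later[OF good_reindex[OF \<phi> g0]])
  note f = good_facts[OF g, simplified card_lessThan]
  \<comment> \<open>The digits of the code: three parameters, the \<open>N * N\<close> entries of
    the adjacency matrix, then \<open>Suc t\<close> blocks of \<open>N * N\<close> walk
    numbers.\<close>
  define F where "F i = (if i = 0 then N else if i = 1 then T else if i = 2 then t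
    else if i < 3 + N * N then (if E ((i - 3) div N) ((i - 3) mod N) then 1 else 0)
    else walks {..<N} E ((i - (3 + N * N)) div N div N) ((i - (3 + N * N)) div N mod N) ((i - (3 + N * N)) mod N))" for i
  define l where "l = 3 + N * N + Suc t * N * N"
  \<comment> \<open>The base exceeds all digits and also their number \<open>l\<close>, so the code
    lies below \<open>n ^ n\<close>. Hence an unbounded search over \<open>n\<close> with a bounded
    one over \<open>w\<close> finds it.\<close>
  define n where "n = l + (\<Sum>i<l. F i) + 1"
  have "F i < n" if "i < l" for i
    using member_le_sum[of i "{..<l}" F] that by (simp add: n_def)
  then obtain w where w: "w < n ^ l" "\<And>i. i < l \<Longrightarrow> dig w n i = F i" using ex_dig[of l F n] by blast
  have "n ^ l \<le> n ^ n" by (intro power_increasing) (auto simp: n_def)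
  then have wn: "w < n ^ n" using w(1) by simp
  have cN: "cN w n = N" and cT: "cT w n = T" and cM: "cM w n = t"
    using w(2)[of 0] w(2)[of 1] w(2)[of 2] by (auto simp: cN_def cT_def cM_def F_def l_def)
  have sq: "x * N + y < m * N" if "x < m" "y < N" for x y m
  proof -
    have "x * N + y < Suc x * N" using that by simp
    also have "\<dots> \<le> m * N" using that by (intro mult_right_mono) auto
    finally show ?thesis .
  qed
  have cE: "cE w n x y = (if E x y then 1 else 0)" if "x < N" "y < N" for x y
  proof -
    have "x * N + y < N * N" by (rule sq[OF that])
    then have "cE w n x y = F (3 + (x * N + y))" unfolding cE_def cN by (intro w(2)) (simp add: l_def)
    then show ?thesis using sq[OF that] that by (simp add: F_def)
  qed
  have cW: "cW w n s x y = walks {..<N} E s x y" if "s \<le> t" "x < N" "y < N" for s x y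
  proof -
    have "s * N + x < Suc t * N" using that by (intro sq) auto
    then have i: "(s * N + x) * N + y < Suc t * N * N" using that by (intro sq) auto
    then have "cW w n s x y = F (3 + N * N + ((s * N + x) * N + y))"
      unfolding cW_def cN by (intro w(2)) (simp add: l_def)
    then show ?thesis using that by (simp add: F_def)
  qed
  have sum: "(\<Sum>z<N. if cE w n x z = 1 then h z else 0) = (\<Sum>z<N. if E x z then h z else 0)" if "x < N"
    for x and h :: "nat \<Rightarrow> nat"
    using that by (intro sum.cong) (auto simp: cE)
  have dev: "cDev w n s x = walk_dev {..<N} E s x" if "s \<le> t" "x < N" for s x
    unfolding walk_dev_def cDev_def cN using that cW by simp
  have le: "k * T \<le> t" "(k + 1) * T \<le> t" by (auto simp: t_def)
  have ch: "(if (\<Sum>x<N. dig m 2 x) \<le> N - (\<Sum>x<N. dig m 2 x)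
        then (\<Sum>x<N. dig m 2 x) else N - (\<Sum>x<N. dig m 2 x))
      < q * (\<Sum>x<N. \<Sum>y<N. if dig m 2 x = 1 \<and> dig m 2 y = 0 \<and> cE w n x y = 1 then 1 else 0)"
    if m: "0 < (\<Sum>x<N. dig m 2 x)" "(\<Sum>x<N. dig m 2 x) < N" for m
  proof -
    let ?S = "{x. x < N \<and> dig m 2 x = 1}"
    have "?S \<subseteq> {..<N}" by auto
    moreover have "?S \<noteq> {}" using m(1) unfolding mask_sums by (metis card.empty less_irrefl)
    moreover have "?S \<noteq> {..<N}" using m(2) unfolding mask_sums by (metis card_lessThan less_irrefl)
    ultimately have "min (card ?S) (N - card ?S) < q * (\<Sum>x\<in>?S. \<Sum>y\<in>{..<N} - ?S. if E x y then 1 else 0)"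
      by (rule f(7))
    also have "(\<Sum>x\<in>?S. \<Sum>y\<in>{..<N} - ?S. if E x y then 1 else 0)
        = (\<Sum>x\<in>?S. \<Sum>y\<in>{..<N} - ?S. if cE w n x y = 1 then 1 else 0 :: nat)"
      by (intro sum.cong refl) (auto simp: cE)
    finally show ?thesis unfolding mask_sums min_def .
  qed
  have "cutoff_code q k n w"
    unfolding cutoff_code_def cN cT cM
  proof (intro conjI allI impI)
    show "k \<le> N" "0 < T" "(k + 1) * T \<le> t" using f(2,3) le by simp_all
    show "cE w n y x = 1" if "x < N" "y < N" "cE w n x y = 1" for x y
      using that f(4)[of x y] by (auto simp: cE split: if_splits)
    show "cE w n x x \<noteq> 1" if "x < N" for x using that f(5)[of x] by (simp add: cE)
    show "(\<Sum>y<N. if cE w n x y = 1 then 1 else 0) = (3::nat)" if "x < N" for x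
      unfolding sum[OF that] using f(6)[of x] that by simp
    show "cW w n 0 x y = (if x = y then 1 else 0)" if "x < N" "y < N" for x y using that by (simp add: cW)
    show "cW w n (Suc s) x y = (\<Sum>z<N. if cE w n x z = 1 then cW w n s z y else 0)"
      if "s < t" "x < N" "y < N" for s x y
      unfolding sum[OF that(2)] using that by (simp add: cW cong: if_cong)
    show "\<exists>x<N. 2 * (k - 1) * 3 ^ s * N < k * cDev w n s x" if "s < Suc (k * T)" for s
    proof -
      have "s \<le> k * T" using that by simp
      from f(8)[OF this] obtain x where "x < N" "2 * (k - 1) * 3 ^ s * N < k * walk_dev {..<N} E s x" by auto
      then show ?thesis using dev[of s x] \<open>s \<le> k * T\<close> le(1) by auto
    qed
    show "k * cDev w n ((k + 1) * T) x < 2 * 3 ^ ((k + 1) * T) * N" if "x < N" for x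
      using f(9)[of x] dev[OF le(2) that] that by simp
    show "0 < cW w n t x y" if "x < N" "y < N" for x y using f(10)[of x y] that by (simp add: cW)
  qed (rule ch; assumption)
  then show ?thesis using wn by blast
qed

section \<open>The random walks on the graphs found\<close>

definition graph_of :: "nat \<Rightarrow> (nat \<Rightarrow> nat \<Rightarrow> bool) \<Rightarrow> nat pair_pre_digraph" where
  "graph_of N E = \<lparr>pverts = {..<N}, parcs = {(u, v). u < N \<and> v < N \<and> E u v}\<rparr>"

lemma pverts_graph_of [simp]: "pverts (graph_of N E) = {..<N}"
  by (simp add: graph_of_def)

locale good_graph =
  fixes q k N T t :: nat and E :: "nat \<Rightarrow> nat \<Rightarrow> bool"
  assumes good: "good q k {..<N} E T t" and k: "k \<ge> 2"
begin

lemmas f = good_facts[OF good, simplified card_lessThan]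

abbreviation "V \<equiv> {..<N}"
abbreviation "G \<equiv> graph_of N E"
abbreviation "K \<equiv> srw G"

lemma N: "N \<ge> 2" using f(2) k by simp

lemma E_sym: "x < N \<Longrightarrow> y < N \<Longrightarrow> E x y \<longleftrightarrow> E y x" using f(4)[of x y] f(4)[of y x] by auto

lemma card_nbrs: "x < N \<Longrightarrow> card {y. y < N \<and> E x y} = 3"
proof -
  assume "x < N"
  then have "(\<Sum>y<N. if E x y then 1 else 0) = (3::nat)" using f(6)[of x] by simp
  moreover have "(\<Sum>y<N. if E x y then 1 else 0 :: nat) = card ({..<N} \<inter> {y. E x y})"
    by (simp add: sum.If_cases)
  moreover have "{..<N} \<inter> {y. E x y} = {y. y < N \<and> E x y}" by auto
  ultimately show ?thesis by simp
qed

lemma sum_nbrs: "x < N \<Longrightarrow> (\<Sum>y<N. if E x y then c else 0) = 3 * (c :: nat)"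
proof -
  assume x: "x < N"
  have "(\<Sum>y<N. if E x y then c else 0) = (\<Sum>y<N. c * (if E x y then 1 else 0))" by (intro sum.cong) auto
  also have "\<dots> = c * 3" using f(6)[of x] x by (simp only: sum_distrib_left[symmetric] lessThan_iff)
  finally show ?thesis by simp
qed

lemma regular: "regular_graph 3 G"
proof -
  have fin: "finite {(u, v). u < N \<and> v < N \<and> E u v}"
    by (rule finite_subset[of _ "V \<times> V"]) auto
  have "pair_graph G"
    by unfold_locales
      (use fin f(5) E_sym in \<open>auto simp: graph_of_def symmetric_def sym_def\<close>)
  moreover have "out_degree (with_proj G) v = 3" if "v < N" for v
  proof -
    have "out_arcs (with_proj G) v = Pair v ` {y. y < N \<and> E v y}"
      using that by (auto simp: out_arcs_def graph_of_def)
    then show ?thesis by (simp add: out_degree_def card_image inj_on_def card_nbrs[OF that])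
  qed
  ultimately show ?thesis by (auto simp: regular_graph_def graph_of_def)
qed

text \<open>Each boundary edge has exactly one orientation that starts in \<open>S\<close>.\<close>

lemma card_boundary:
  assumes S: "S \<subseteq> V"
  shows "card (edge_boundary G S) = (\<Sum>x\<in>S. \<Sum>y\<in>V - S. if E x y then 1 else 0)"
proof -
  let ?A = "SIGMA x:S. {y \<in> V - S. E x y}"
  have fS: "finite S" using S by (rule finite_subset) simp
  have "edge_boundary G S = (\<lambda>(x, y). {x, y}) ` ?A"
  proof
    show "(\<lambda>(x, y). {x, y}) ` ?A \<subseteq> edge_boundary G S"
    proof
      fix e assume "e \<in> (\<lambda>(x, y). {x, y}) ` ?A"
      then obtain x y where e: "e = {x, y}" "x \<in> S" "y \<in> V - S" "E x y" by auto
      then have "e \<inter> S = {x}" by auto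
      moreover have "e \<in> edges G" using e S by (auto simp: edges_def graph_of_def)
      ultimately show "e \<in> edge_boundary G S" by (simp add: edge_boundary_def)
    qed
  next
    show "edge_boundary G S \<subseteq> (\<lambda>(x, y). {x, y}) ` ?A"
    proof
      fix e assume e: "e \<in> edge_boundary G S"
      then obtain u v where uv: "e = {u, v}" "u < N" "v < N" "E u v"
        by (auto simp: edge_boundary_def edges_def graph_of_def)
      obtain x where x: "e \<inter> S = {x}" using e by (auto simp: edge_boundary_def card_1_singleton_iff)
      have "u \<noteq> v" using f(5)[of u] uv by auto
      moreover have "u \<in> S \<Longrightarrow> u = x" "v \<in> S \<Longrightarrow> v = x" using x uv(1) by auto
      moreover have "x \<in> S" "x = u \<or> x = v" using x uv(1) by auto
      ultimately have "u \<in> S \<and> v \<notin> S \<or> v \<in> S \<and> u \<notin> S" by metis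
      then show "e \<in> (\<lambda>(x, y). {x, y}) ` ?A"
      proof
        assume "u \<in> S \<and> v \<notin> S"
        then show ?thesis using uv by (intro image_eqI[of _ _ "(u, v)"]) auto
      next
        assume "v \<in> S \<and> u \<notin> S"
        then show ?thesis using uv E_sym[of u v] by (intro image_eqI[of _ _ "(v, u)"]) auto
      qed
    qed
  qed
  moreover have "inj_on (\<lambda>(x, y). {x, y}) ?A" by (auto simp: inj_on_def doubleton_eq_iff)
  ultimately have "card (edge_boundary G S) = card ?A" by (simp add: card_image)
  also have "\<dots> = (\<Sum>x\<in>S. card {y \<in> V - S. E x y})" using fS by (subst card_SigmaI) auto
  also have "\<dots> = (\<Sum>x\<in>S. \<Sum>y\<in>V - S. if E x y then 1 else 0)"
    unfolding card_eq_sum by (intro sum.cong refl sum.inter_filter) simp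
  finally show ?thesis .
qed

text \<open>Passing from \<open>q\<close> to \<open>q + 1\<close> gives a positive bound without
  knowing that \<open>q\<close> is positive.\<close>

lemma cheeger_gt: "cheeger G > 1 / (real q + 1)"
proof -
  let ?S = "{S. S \<noteq> {} \<and> S \<subset> V}"
  have fin: "finite ?S" by (rule finite_subset[of _ "Pow V"]) auto
  have "0 \<in> V" "1 \<in> V" "(1::nat) \<notin> {0}" using N by auto
  then have "{0} \<subset> V" by blast
  then have ne: "?S \<noteq> {}" by blast
  have "1 / (real q + 1) < real (card (edge_boundary G S)) / real (min (card S) (card (V - S)))"
    if S: "S \<in> ?S" for S
  proof -
    let ?e = "card (edge_boundary G S)"
    have SV: "S \<subseteq> V" "S \<noteq> {}" "S \<noteq> V" using S by auto
    have fS: "finite S" using SV(1) by (rule finite_subset) simp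
    have cV: "card (V - S) = N - card S" using SV fS by (simp add: card_Diff_subset)
    have "card S < N" using psubset_card_mono[of V S] S by auto
    then have pos: "0 < min (card S) (card (V - S))" using SV fS by (simp add: cV card_gt_0_iff)
    have "min (card S) (card (V - S)) < q * ?e"
      using f(7)[OF SV] by (simp only: card_boundary[OF SV(1)] cV)
    then have "min (card S) (card (V - S)) < (q + 1) * ?e" by simp
    then have "real (min (card S) (card (V - S))) < real ((q + 1) * ?e)" by (simp only: of_nat_less_iff)
    then show ?thesis using pos by (simp add: field_simps)
  qed
  then show ?thesis
    unfolding cheeger_def graph_of_def
    using fin ne by (subst Min_gr_iff) (auto simp: graph_of_def)
qed

section \<open>The law of the walk in terms of walk numbers\<close>

lemma pmf_K: "x < N \<Longrightarrow> pmf (K x) y = (if y < N \<and> E x y then 1 / 3 else 0)"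
proof -
  assume x: "x < N"
  have eq: "{w. (x, w) \<in> parcs G} = {y. y < N \<and> E x y}" using x by (auto simp: graph_of_def)
  have "{y. y < N \<and> E x y} \<noteq> {}" using card_nbrs[OF x] by (metis card.empty zero_neq_numeral)
  then show ?thesis by (simp add: srw_def eq pmf_of_set card_nbrs[OF x] indicator_def)
qed

lemma set_K: "x < N \<Longrightarrow> set_pmf (K x) \<subseteq> V"
proof
  fix y assume x: "x < N" and "y \<in> set_pmf (K x)"
  then have "pmf (K x) y \<noteq> 0" by (simp only: set_pmf_iff not_False_eq_True)
  then show "y \<in> V" using pmf_K[OF x, of y] by (cases "y < N") simp_all
qed

lemma pmf_bind_V:
  assumes "set_pmf \<mu> \<subseteq> V"
  shows "pmf (bind_pmf \<mu> h) y = (\<Sum>z<N. pmf (h z) y * pmf \<mu> z)"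
  unfolding pmf_bind using assms by (intro integral_measure_pmf_real) auto

text \<open>\<open>walks\<close> splits off the first step, whereas \<open>chain_law\<close> adds a
  last one.\<close>

lemma walks_right: "y < N \<Longrightarrow> walks V E (Suc s) x y = (\<Sum>z<N. if E z y then walks V E s x z else 0)"
  if "x < N"
  using that
proof (induction s arbitrary: x)
  case 0
  have delta: "(\<Sum>z<N. if P z then if z = a then 1 else 0 else 0) = (if P a then 1 else 0 :: nat)"
    if "a < N" for P and a
  proof -
    have "(\<Sum>z<N. if P z then if z = a then 1 else 0 else 0) = (\<Sum>z<N. if z = a then if P a then 1 else 0 else 0 :: nat)"
      by (intro sum.cong) auto
    then show ?thesis using that by simp
  qed
  show ?case using delta[OF 0(1), of "E x"] delta[OF 0(2), of "\<lambda>z. E z y"] by (simp only: walks.simps eq_commute[of x])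
next
  case (Suc s)
  have "walks V E (Suc (Suc s)) x y
      = (\<Sum>z<N. if E x z then (\<Sum>w<N. if E w y then walks V E s z w else 0) else 0)"
    unfolding walks.simps(2)[of _ _ "Suc s"] using Suc by (intro sum.cong) auto
  also have "\<dots> = (\<Sum>z<N. \<Sum>w<N. if E x z \<and> E w y then walks V E s z w else 0)"
    by (intro sum.cong) auto
  also have "\<dots> = (\<Sum>w<N. \<Sum>z<N. if E x z \<and> E w y then walks V E s z w else 0)" by (rule sum.swap)
  also have "\<dots> = (\<Sum>w<N. if E w y then walks V E (Suc s) x w else 0)"
    by (intro sum.cong) (auto intro!: sum.cong)
  finally show ?case .
qed

lemma walks_sym: "x < N \<Longrightarrow> y < N \<Longrightarrow> walks V E s x y = walks V E s y x"
proof (induction s arbitrary: x y)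
  case (Suc s)
  have "walks V E (Suc s) x y = (\<Sum>z<N. if E y z then walks V E s z x else 0)"
    unfolding walks_right[OF Suc(2,3)] using Suc E_sym by (intro sum.cong) auto
  then show ?case by simp
qed auto

lemma sum_walks: "x < N \<Longrightarrow> (\<Sum>y<N. walks V E s x y) = 3 ^ s"
proof (induction s arbitrary: x)
  case 0
  then show ?case by simp
next
  case (Suc s)
  have "(\<Sum>y<N. walks V E (Suc s) x y) = (\<Sum>z<N. \<Sum>y<N. if E x z then walks V E s z y else 0)"
    unfolding walks.simps by (rule sum.swap)
  also have "\<dots> = (\<Sum>z<N. if E x z then 3 ^ s else 0)"
    using Suc by (intro sum.cong) auto
  finally show ?case using sum_nbrs[OF Suc(2)] by simp
qed

lemma chain: "x < N \<Longrightarrow> set_pmf (chain_law K x s) \<subseteq> V \<and>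
  (\<forall>y<N. pmf (chain_law K x s) y = walks V E s x y / 3 ^ s)"
proof (induction s)
  case 0
  then show ?case by (auto simp: indicator_def)
next
  case (Suc s)
  then have IH: "set_pmf (chain_law K x s) \<subseteq> V" "\<And>y. y < N \<Longrightarrow> pmf (chain_law K x s) y = walks V E s x y / 3 ^ s"
    by auto
  have "set_pmf (chain_law K x (Suc s)) \<subseteq> V"
  proof -
    have "set_pmf (K z) \<subseteq> V" if "z \<in> set_pmf (chain_law K x s)" for z
      using that IH(1) by (intro set_K) blast
    then show ?thesis by (simp add: set_bind_pmf UN_subset_iff)
  qed
  moreover have "pmf (chain_law K x (Suc s)) y = walks V E (Suc s) x y / 3 ^ Suc s" if y: "y < N" for y
  proof -
    have "pmf (chain_law K x (Suc s)) y = (\<Sum>z<N. (if E z y then real (walks V E s x z) else 0) / 3 ^ Suc s)"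
      unfolding chain_law.simps pmf_bind_V[OF IH(1)] using y by (intro sum.cong refl) (simp add: pmf_K IH(2))
    also have "\<dots> = real (walks V E (Suc s) x y) / 3 ^ Suc s"
      unfolding walks_right[OF Suc(2) y] sum_divide_distrib[symmetric] by (simp add: if_distrib cong: if_cong)
    finally show ?thesis .
  qed
  ultimately show ?case by blast
qed

lemma chain_pmf: "x < N \<Longrightarrow> y < N \<Longrightarrow> pmf (chain_law K x s) y = walks V E s x y / 3 ^ s"
  using chain by blast

lemma V_ne: "V \<noteq> {}" "finite V"
proof -
  have "0 \<in> V" using N by simp
  then show "V \<noteq> {}" by blast
qed simp

section \<open>Stationarity, irreducibility and aperiodicity\<close>

lemma uniform_stationary: "bind_pmf (pmf_of_set V) K = pmf_of_set V"
proof (rule pmf_eqI)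
  fix y
  have s: "set_pmf (pmf_of_set V) \<subseteq> V" using V_ne by simp
  show "pmf (bind_pmf (pmf_of_set V) K) y = pmf (pmf_of_set V) y"
  proof (cases "y < N")
    case True
    have "pmf (bind_pmf (pmf_of_set V) K) y = (\<Sum>z<N. real (if E y z then 1 else 0) / (3 * N))"
      unfolding pmf_bind_V[OF s]
      using True E_sym V_ne by (intro sum.cong) (auto simp: pmf_K indicator_def)
    also have "\<dots> = real (\<Sum>z<N. if E y z then 1 else 0) / (3 * N)"
      by (simp only: sum_divide_distrib of_nat_sum)
    also have "(\<Sum>z<N. if E y z then 1 else 0) = (3::nat)" using sum_nbrs[OF True, of 1] by simp
    finally show ?thesis using True V_ne by (simp add: indicator_def)
  next
    case False
    then show ?thesis unfolding pmf_bind_V[OF s] using V_ne by (simp add: pmf_K)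
  qed
qed

text \<open>Maximum principle for the \<open>t\<close>-step kernel, which is doubly stochastic with
  positive entries: a maximum of a stationary density is an average with positive weights of all its
  values, so the density is constant.\<close>

lemma stationary_unique:
  assumes s: "set_pmf \<pi> \<subseteq> V" and st: "bind_pmf \<pi> K = \<pi>"
  shows "\<pi> = pmf_of_set V"
proof -
  have "bind_pmf \<pi> (\<lambda>x. chain_law K x s) = \<pi>" for s
  proof (induction s)
    case (Suc s)
    have "bind_pmf \<pi> (\<lambda>x. chain_law K x (Suc s)) = bind_pmf (bind_pmf \<pi> (\<lambda>x. chain_law K x s)) K"
      by (simp add: bind_assoc_pmf)
    then show ?case using Suc st by simp
  qed (simp add: bind_return_pmf')
  then have *: "pmf \<pi> y = (\<Sum>z<N. pmf (chain_law K z t) y * pmf \<pi> z)" for y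
    using pmf_bind_V[OF s, of "\<lambda>x. chain_law K x t" y] by simp
  have avg: "pmf \<pi> y = (\<Sum>z<N. walks V E t z y / 3 ^ t * pmf \<pi> z)" if "y < N" for y
    by (subst *) (intro sum.cong refl, simp add: chain_pmf that)
  have tot: "(\<Sum>z<N. walks V E t z y / 3 ^ t) = (1::real)" if "y < N" for y
  proof -
    have "(\<Sum>z<N. walks V E t z y) = (\<Sum>z<N. walks V E t y z)"
      using that by (intro sum.cong) (auto simp: walks_sym)
    then have "(\<Sum>z<N. real (walks V E t z y)) = 3 ^ t" using sum_walks[OF that, of t] by (simp flip: of_nat_sum)
    then show ?thesis by (simp flip: sum_divide_distrib)
  qed
  obtain y where y: "y \<in> V" and max: "\<And>z. z \<in> V \<Longrightarrow> pmf \<pi> z \<le> pmf \<pi> y"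
  proof -
    have "Max (pmf \<pi> ` V) \<in> pmf \<pi> ` V" using V_ne by (intro Max_in) auto
    then obtain y where "y \<in> V" "Max (pmf \<pi> ` V) = pmf \<pi> y" by auto
    moreover have "pmf \<pi> z \<le> Max (pmf \<pi> ` V)" if "z \<in> V" for z
      using that by (intro Max_ge) auto
    ultimately show ?thesis by (intro that[of y]) auto
  qed
  have const: "pmf \<pi> x = pmf \<pi> y" if x: "x \<in> V" for x
  proof (rule ccontr)
    assume "pmf \<pi> x \<noteq> pmf \<pi> y"
    then have "pmf \<pi> x < pmf \<pi> y" using max[OF x] by simp
    then have "(\<Sum>z<N. walks V E t z y / 3 ^ t * pmf \<pi> z) < (\<Sum>z<N. walks V E t z y / 3 ^ t * pmf \<pi> y)"
      using x f(10)[OF x y] max by (intro sum_strict_mono_ex1) (auto intro!: mult_left_mono mult_strict_left_mono divide_right_mono divide_strict_right_mono bexI[of _ x])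
    also have "\<dots> = (\<Sum>z<N. walks V E t z y / 3 ^ t) * pmf \<pi> y"
      by (rule sum_distrib_right[symmetric])
    also have "\<dots> = pmf \<pi> y" using tot[of y] y by simp
    finally show False using avg[of y] y by simp
  qed
  have "(\<Sum>z\<in>V. pmf \<pi> z) = 1" using s by (intro sum_pmf_eq_1) auto
  moreover have "(\<Sum>z\<in>V. pmf \<pi> z) = (\<Sum>z\<in>V. pmf \<pi> y)" by (intro sum.cong refl const)
  ultimately have "N * pmf \<pi> y = 1" by simp
  then have py: "pmf \<pi> y = 1 / N" using N by (simp add: field_simps)
  show ?thesis
  proof (rule pmf_eqI)
    fix x
    show "pmf \<pi> x = pmf (pmf_of_set V) x"
    proof (cases "x < N")
      case True
      then show ?thesis using const[of x] py V_ne by (simp add: indicator_def)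
    next
      case False
      then have "x \<notin> set_pmf \<pi>" using s by auto
      then show ?thesis using False V_ne by (simp add: set_pmf_iff indicator_def)
    qed
  qed
qed

lemma stationary_eq: "stationary V K = pmf_of_set V"
  unfolding stationary_def
proof (rule the_equality)
  show "set_pmf (pmf_of_set V) \<subseteq> V \<and> bind_pmf (pmf_of_set V) K = pmf_of_set V"
    using uniform_stationary V_ne by simp
qed (use stationary_unique in blast)

lemma irreducible: "irreducible_chain V K"
  unfolding irreducible_chain_def
proof (intro ballI exI)
  fix x y assume xy: "x \<in> V" "y \<in> V"
  then show "0 < pmf (chain_law K x t) y" using f(10)[OF xy] by (simp add: chain_pmf)
qed

text \<open>Returns are possible at the consecutive times \<open>t + 1\<close> and
  \<open>t + 2\<close>; the shift excludes time 0.\<close>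

lemma aperiodic: "aperiodic_chain V K"
  unfolding aperiodic_chain_def
proof
  fix x assume x: "x \<in> V"
  let ?A = "{s. s \<ge> 1 \<and> pmf (chain_law K x s) x > 0}"
  have "t + j \<in> ?A" if "j \<ge> 1" for j
    using walks_pos_Suc[OF good x x, of j] x that by (simp add: chain_pmf)
  from this[of 1] this[of 2] have "Gcd ?A dvd t + 1" "Gcd ?A dvd t + 2" by (intro Gcd_dvd; simp)+
  then have "Gcd ?A dvd (t + 2) - (t + 1)" by (rule dvd_diff_nat[rotated])
  then show "Gcd ?A = 1" by simp
qed

section \<open>Mixing times\<close>

lemma tv_walk: "x < N \<Longrightarrow> tv_dist V (chain_law K x s) (stationary V K) = walk_dev V E s x / (2 * 3 ^ s * N)"
proof -
  assume x: "x < N"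
  have "\<bar>pmf (chain_law K x s) y - pmf (pmf_of_set V) y\<bar> = \<bar>real N * walks V E s x y - 3 ^ s\<bar> / (3 ^ s * N)"
    if "y \<in> V" for y
  proof -
    have "pmf (chain_law K x s) y - pmf (pmf_of_set V) y = (real N * walks V E s x y - 3 ^ s) / (3 ^ s * N)"
      using that x V_ne N by (simp add: chain_pmf indicator_def field_simps)
    then show ?thesis by (simp add: abs_divide abs_mult)
  qed
  then show ?thesis
    by (simp add: tv_dist_def stationary_eq walk_dev_real mult_ac flip: sum_divide_distrib)
qed

lemma worst_early: "s \<le> k * T \<Longrightarrow> worst_dist V K s > 1 - 1 / k"
proof -
  assume s: "s \<le> k * T"
  obtain x where x: "x \<in> V" "2 * (k - 1) * 3 ^ s * N < k * walk_dev V E s x" using f(8)[OF s] by blast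
  have "real (2 * (k - 1) * 3 ^ s * N) < real (k * walk_dev V E s x)" using x(2) by (simp only: of_nat_less_iff)
  then have "2 * (real k - 1) * 3 ^ s * N < k * real (walk_dev V E s x)" using k by (simp add: of_nat_diff)
  then have "1 - 1 / k < walk_dev V E s x / (2 * 3 ^ s * N)"
    using k N by (simp add: field_simps)
  also have "\<dots> = tv_dist V (chain_law K x s) (stationary V K)" using x by (simp add: tv_walk)
  also have "\<dots> \<le> worst_dist V K s" unfolding worst_dist_def using x by (intro Max_ge) auto
  finally show ?thesis .
qed

lemma worst_late: "worst_dist V K ((k + 1) * T) < 1 / k"
proof -
  have "tv_dist V (chain_law K x ((k + 1) * T)) (stationary V K) < 1 / k" if x: "x \<in> V" for x
  proof -
    define s where "s = (k + 1) * T"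
    have "k * walk_dev V E s x < 2 * 3 ^ s * N" unfolding s_def by (rule f(9)[OF x])
    then have "real (k * walk_dev V E s x) < real (2 * 3 ^ s * N)" by (simp only: of_nat_less_iff)
    then have "walk_dev V E s x / (2 * 3 ^ s * N) < 1 / k" using k N by (simp add: field_simps)
    then show ?thesis using x by (simp only: tv_walk lessThan_iff s_def)
  qed
  then show ?thesis unfolding worst_dist_def using V_ne by (subst Max_less_iff) auto
qed

text \<open>Monotonicity of the distance in time is avoided: the early bound holds at every time up
  to \<open>k * T\<close>, so the least admissible time lies beyond it.\<close>

lemma mixing_bounds:
  assumes "1 / k < \<epsilon>" "\<epsilon> < 1 - 1 / k"
  shows "k * T < mixing_time V K \<epsilon>" "mixing_time V K \<epsilon> \<le> (k + 1) * T"
proof -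
  have late: "worst_dist V K ((k + 1) * T) < \<epsilon>" using worst_late assms by simp
  show "mixing_time V K \<epsilon> \<le> (k + 1) * T" unfolding mixing_time_def using late by (rule Least_le)
  have "worst_dist V K (mixing_time V K \<epsilon>) < \<epsilon>" unfolding mixing_time_def using late by (rule LeastI)
  then show "k * T < mixing_time V K \<epsilon>" using worst_early[of "mixing_time V K \<epsilon>"] assms by fastforce
qed

text \<open>Both mixing times lie between \<open>k * T\<close> and \<open>(k + 1) * T\<close>, so
  they differ by at most \<open>T\<close>, while the denominator exceeds
  \<open>k * T\<close>.\<close>

lemma mixing_ratio:
  assumes "1 / k < \<epsilon>" "\<epsilon> < 1 - 1 / k"
  shows "\<bar>real (mixing_time V K \<epsilon>) / real (mixing_time V K (1 - \<epsilon>)) - 1\<bar> \<le> 1 / k"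
proof -
  have "1 / k < 1 - \<epsilon>" "1 - \<epsilon> < 1 - 1 / k" using assms by auto
  note m = mixing_bounds[OF assms] mixing_bounds[OF this]
  define a b where "a = real (mixing_time V K \<epsilon>)" and "b = real (mixing_time V K (1 - \<epsilon>))"
  have "real (k * T) < a" "a \<le> real ((k + 1) * T)" "real (k * T) < b" "b \<le> real ((k + 1) * T)"
    unfolding a_def b_def by (simp_all only: of_nat_less_iff of_nat_le_iff m)
  then have ab: "k * T < a" "a \<le> k * T + T" "real k * T < b" "b \<le> real k * T + T"
    by (auto simp: algebra_simps)
  have "0 \<le> real k * T" by simp
  then have b0: "b > 0" using ab by linarith
  have "\<bar>a - b\<bar> \<le> T" using ab by auto
  then have "k * \<bar>a - b\<bar> \<le> real k * T" using k by (intro mult_left_mono) auto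
  then have "k * \<bar>a - b\<bar> \<le> b" using ab by linarith
  then have "\<bar>a - b\<bar> / b \<le> 1 / k" using b0 k by (simp add: field_simps)
  moreover have "a / b - 1 = (a - b) / b" using b0 by (simp add: diff_divide_distrib)
  then have "\<bar>a / b - 1\<bar> = \<bar>a - b\<bar> / b" using b0 by (simp add: abs_divide)
  ultimately show ?thesis by (simp add: a_def b_def)
qed

end

theorem theorem1:
  shows "\<exists>(G :: nat \<Rightarrow> nat pair_pre_digraph) (c :: real).
    explicit_graphs G \<and>
    (\<forall>k\<ge>1. regular_graph 3 (G k)) \<and>
    filterlim (\<lambda>k. card (pverts (G k))) at_top sequentially \<and>
    c > 0 \<and> (\<forall>k\<ge>1. cheeger (G k) > c) \<and>
    (\<forall>k\<ge>1. irreducible_chain (pverts (G k)) (srw (G k)) \<and>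
           aperiodic_chain (pverts (G k)) (srw (G k))) \<and>
    (\<forall>\<epsilon>::real. 0 < \<epsilon> \<and> \<epsilon> < 1 \<longrightarrow>
      (\<lambda>k. real (mixing_time (pverts (G k)) (srw (G k)) \<epsilon>) /
           real (mixing_time (pverts (G k)) (srw (G k)) (1 - \<epsilon>))) \<longlonglongrightarrow> 1)"
proof -
  obtain q where q: "\<And>k. k \<ge> 1 \<Longrightarrow> \<exists>(V :: vert set) E T t. good q k V E T t"
    using good_exists by blast
  \<comment> \<open>The shift by two gives a precision of at least 2 for every index, including 0,
    as the locale \<open>good_graph\<close> requires.\<close>
  have code: "\<exists>n. \<exists>w<n ^ n. cutoff_code q (Suc (Suc k)) n w" for k
    using q[of "Suc (Suc k)"] code_of_good by fastforce
  \<comment> \<open>Two minimisations single out one code per index; both are total by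
    \<open>code\<close>, so base and word are recursive functions of \<open>k\<close>.\<close>
  define base where "base k = (LEAST n. \<exists>w<n ^ n. cutoff_code q (Suc (Suc k)) n w)" for k
  define word where "word k = (LEAST w. cutoff_code q (Suc (Suc k)) (base k) w)" for k
  have base: "\<exists>w<base k ^ base k. cutoff_code q (Suc (Suc k)) (base k) w" for k
    unfolding base_def using code by (rule LeastI_ex)
  then have ex: "\<exists>w. cutoff_code q (Suc (Suc k)) (base k) w" for k by blast
  then have word: "cutoff_code q (Suc (Suc k)) (base k) (word k)" for k
    unfolding word_def by (rule LeastI_ex)
  define N where "N k = cN (word k) (base k)" for k
  define A where "A k u v = cE (word k) (base k) u v" for k u v
  define G where "G k = graph_of (N k) (\<lambda>u v. A k u v = 1)" for k
  have good: "good_graph q (Suc (Suc k)) (N k) (cT (word k) (base k)) (cM (word k) (base k)) (\<lambda>u v. A k u v = 1)" for k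
    unfolding N_def A_def using good_of_code[OF word] by unfold_locales auto
  have rec_base: "recursive (\<lambda>xs. base (arg 0 xs))"
    unfolding base_def
    by (rule rec_Least, intro rec_intros dec_cutoff_code) (use code in blast)
  have rec_word: "recursive (\<lambda>xs. word (arg 0 xs))"
    unfolding word_def
    by (rule rec_Least, intro rec_intros dec_cutoff_code rec_tl[OF rec_base]) (use ex in blast)
  have rec_N: "recursive (\<lambda>xs. N (arg 0 xs))"
    unfolding N_def cN_def by (intro rec_intros rec_dig rec_base rec_word)
  have rec_A: "recursive (\<lambda>xs. A (arg 0 xs) (arg 1 xs) (arg 2 xs))"
    unfolding A_def cE_def cN_def by (intro rec_intros rec_dig rec_base rec_word)
  have verts: "pverts (G k) = {..<N k}" for k by (simp add: G_def)
  have "explicit_graphs G"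
    unfolding explicit_graphs_def
    by (rule exI[of _ "\<lambda>xs. N (arg 0 xs)"], rule exI[of _ "\<lambda>xs. A (arg 0 xs) (arg 1 xs) (arg 2 xs)"])
      (use rec_N rec_A in \<open>auto simp: G_def graph_of_def arg_def\<close>)
  moreover have "filterlim (\<lambda>k. card (pverts (G k))) at_top sequentially"
  proof (rule filterlim_at_top_mono[OF filterlim_ident])
    show "eventually (\<lambda>k. k \<le> card (pverts (G k))) sequentially"
      using good_graph.f(2)[OF good] by (auto simp: verts intro!: always_eventually intro: Suc_leD)
  qed
  moreover have "\<forall>k\<ge>1. regular_graph 3 (G k)" using good_graph.regular[OF good] by (simp add: G_def)
  moreover have "1 / (real q + 1) > 0" by simp
  moreover have "\<forall>k\<ge>1. cheeger (G k) > 1 / (real q + 1)"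
    using good_graph.cheeger_gt[OF good] by (simp add: G_def)
  moreover have "\<forall>k\<ge>1. irreducible_chain (pverts (G k)) (srw (G k)) \<and> aperiodic_chain (pverts (G k)) (srw (G k))"
    using good_graph.irreducible[OF good] good_graph.aperiodic[OF good] by (simp add: G_def)
  moreover have "(\<lambda>k. real (mixing_time (pverts (G k)) (srw (G k)) \<epsilon>) /
           real (mixing_time (pverts (G k)) (srw (G k)) (1 - \<epsilon>))) \<longlonglongrightarrow> 1" if \<epsilon>: "0 < \<epsilon> \<and> \<epsilon> < 1" for \<epsilon>
  proof -
    have lim: "(\<lambda>k. 1 / real (Suc (Suc k))) \<longlonglongrightarrow> 0"
      using LIMSEQ_Suc[OF LIMSEQ_inverse_real_of_nat] by (simp add: inverse_eq_divide)
    have "eventually (\<lambda>k. 1 / real (Suc (Suc k)) < min \<epsilon> (1 - \<epsilon>)) sequentially"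
      using lim \<epsilon> by (intro order_tendstoD) auto
    then have "eventually (\<lambda>k. norm (real (mixing_time (pverts (G k)) (srw (G k)) \<epsilon>) /
           real (mixing_time (pverts (G k)) (srw (G k)) (1 - \<epsilon>)) - 1) \<le> 1 / real (Suc (Suc k))) sequentially"
    proof (eventually_elim)
      case (elim k)
      then show ?case
        using good_graph.mixing_ratio[OF good, of k \<epsilon>] by (simp add: G_def del: of_nat_Suc)
    qed
    from Lim_null_comparison[OF this lim] show ?thesis by (simp add: LIM_zero_iff)
  qed
  ultimately show ?thesis by (intro exI[of _ G] exI[of _ "1 / (real q + 1)"]) blast
qed

end
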